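(* Let $d$ be a positive integer, fix $x\in\binom{[2d]}{d}$, and let $\mathcal{T}$ be the Terwilliger algebra of the Johnson scheme $J(2d,d)$ with respect to $x$. Then, as $\mathbb{C}$-algebras, $$\mathcal{T}\simeq\bigoplus_{s=0}^{\lfloor d/2\rfloor}\ \bigoplus_{r=0}^{s}\mathrm{Mat}_{d_{r,s}+1}(\mathbb{C}).$$
   Context: Johnson scheme and Terwilliger algebra. $[m]=\{1,\dots,m\}$, $\binom{[m]}{k}$ is the set of $k$-subsets of $[m]$, and $X=\binom{[2d]}{d}$. $\mathrm{Mat}_X(\mathbb{C})$ is the algebra of complex matrices with rows and columns indexed by $X$. For $0\le i\le d$ let $R_i=\{(y,z)\in X\times X: |y\cap z|=d-i\}$ and let $A_i\in\mathrm{Mat}_X(\mathbb{C})$ be the $0/1$ matrix with $(y,z)$-entry $1$ iff $(y,z)\in R_i$; $J(2d,d)=(X,\{R_i\}_{i=0}^d)$. For fixed $x\in X$ let $E_i^*$ be the diagonal matrix with $(y,y)$-entry $1$ if $(x,y)\in R_i$ and $0$ otherwise. The Terwilliger algebra $\mathcal{T}$ (with respect to $x$) is the subalgebra of $\mathrm{Mat}_X(\mathbb{C})$ generated by $A_0,\dots,A_d,E_0^*,\dots,E_d^*$. Idempotents. For $0\le k\le v$, let $A_1^{(v,k)}$ be the $0/1$ matrix indexed by $\binom{[v]}{k}$ with $(\alpha,\beta)$-entry $1$ iff $|\alpha\cap\beta|=k-1$ (adjacency matrix of $J(v,k)$; it is $0$ if $k\in\{0,v\}$). $E^{(v,k)}_j$,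 $0\le j\le\min(k,v-k)$, denotes the primitive idempotent of the Bose–Mesner algebra of $J(v,k)$ with $A_1^{(v,k)}E^{(v,k)}_j=\big((k-j)(v-k-j)-j\big)E^{(v,k)}_j$, i.e. the orthogonal projection onto the corresponding eigenspace of $A_1^{(v,k)}$. Convention: $E^{(v,k)}_j=0$ if $j>\min(k,v-k)$. The numbers $d_{r,s}$. For integers $0\le r,s\le d/2$, $$d_{r,s}=\big|\{i\in\{0,1,\dots,d\}: E^{(d,d-i)}_r\otimes E^{(d,i)}_s+E^{(d,d-i)}_s\otimes E^{(d,i)}_r\ne0\}\big|-1 .$$ $\mathrm{Mat}_m(\mathbb{C})$ is the algebra of $m\times m$ complex matrices. *)

theory Defs
  imports
    "HOL-Library.Ramsey"
    "HOL-Algebra.QuotRing"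
    "HOL-Algebra.Module"
    "Jordan_Normal_Form.Matrix"
begin

hide_const (open) Multiset.mult

section \<open>Complex algebras\<close>

text \<open>
  A complex algebra is represented by a \<^typ>\<open>(complex, 'b) module\<close> record, i.e. a ring record
  together with a scalar multiplication by arbitrary complex numbers.  (The locale
  \<^locale>\<open>algebra\<close> of the library is about commutative algebras only.)
\<close>

definition subalgebra_of :: "(complex, 'b) module \<Rightarrow> 'b set \<Rightarrow> bool" where
  "subalgebra_of M B \<longleftrightarrow>
     B \<subseteq> carrier M \<and> \<one>\<^bsub>M\<^esub> \<in> B \<and>
     (\<forall>a\<in>B. \<forall>b\<in>B. a \<oplus>\<^bsub>M\<^esub> b \<in> B) \<and>
     (\<forall>a\<in>B. \<forall>b\<in>B. a \<otimes>\<^bsub>M\<^esub> b \<in> B) \<and>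
     (\<forall>c. \<forall>a\<in>B. c \<odot>\<^bsub>M\<^esub> a \<in> B)"

definition generated_subalgebra ::
    "(complex, 'b) module \<Rightarrow> 'b set \<Rightarrow> (complex, 'b) module" where
  "generated_subalgebra M S = M\<lparr>carrier := subalgebra_of M hull S\<rparr>"

definition algebra_isomorphic ::
    "(complex, 'b) module \<Rightarrow> (complex, 'c) module \<Rightarrow> bool"  (infix \<open>\<simeq>\<^sub>a\<^sub>l\<^sub>g\<close> 50) where
  "M \<simeq>\<^sub>a\<^sub>l\<^sub>g N \<longleftrightarrow>
     (\<exists>h \<in> ring_iso M N. \<forall>c. \<forall>a \<in> carrier M. h (c \<odot>\<^bsub>M\<^esub> a) = c \<odot>\<^bsub>N\<^esub> h a)"

text \<open>Only used for finite index sets, where the direct sum is the full product.\<close>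

definition direct_sum ::
    "'i set \<Rightarrow> ('i \<Rightarrow> (complex, 'b) module) \<Rightarrow> (complex, 'i \<Rightarrow> 'b) module" where
  "direct_sum I M =
     \<lparr>carrier = (\<Pi>\<^sub>E i\<in>I. carrier (M i)),
      mult = (\<lambda>f g. \<lambda>i\<in>I. f i \<otimes>\<^bsub>M i\<^esub> g i),
      one = (\<lambda>i\<in>I. \<one>\<^bsub>M i\<^esub>),
      zero = (\<lambda>i\<in>I. \<zero>\<^bsub>M i\<^esub>),
      add = (\<lambda>f g. \<lambda>i\<in>I. f i \<oplus>\<^bsub>M i\<^esub> g i),
      smult = (\<lambda>c f. \<lambda>i\<in>I. c \<odot>\<^bsub>M i\<^esub> f i)\<rparr>"


section \<open>Matrices with rows and columns indexed by a finite set\<close>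

text \<open>
  Vectors and matrices indexed by \<open>I\<close> are functions that vanish outside \<open>I\<close> and
  \<open>I \<times> I\<close>, respectively.
\<close>

type_synonym 'a smat = "'a \<Rightarrow> 'a \<Rightarrow> complex"
type_synonym 'a svec = "'a \<Rightarrow> complex"

definition smat_carrier :: "'a set \<Rightarrow> 'a smat set" where
  "smat_carrier I = {A. \<forall>y z. A y z \<noteq> 0 \<longrightarrow> y \<in> I \<and> z \<in> I}"

definition svec_carrier :: "'a set \<Rightarrow> 'a svec set" where
  "svec_carrier I = {u. \<forall>y. u y \<noteq> 0 \<longrightarrow> y \<in> I}"

definition Mat_algebra :: "'a set \<Rightarrow> (complex, 'a smat) module" where
  "Mat_algebra I =
     \<lparr>carrier = smat_carrier I,
      mult = (\<lambda>A B y z. \<Sum>w\<in>I. A y w * B w z),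
      one = (\<lambda>y z. if y \<in> I \<and> y = z then 1 else 0),
      zero = (\<lambda>y z. 0),
      add = (\<lambda>A B y z. A y z + B y z),
      smult = (\<lambda>c A y z. c * A y z)\<rparr>"

definition smat_apply :: "'a set \<Rightarrow> 'a smat \<Rightarrow> 'a svec \<Rightarrow> 'a svec" where
  "smat_apply I A u = (\<lambda>y. \<Sum>z\<in>I. A y z * u z)"

definition svec_inner :: "'a set \<Rightarrow> 'a svec \<Rightarrow> 'a svec \<Rightarrow> complex" where
  "svec_inner I u w = (\<Sum>y\<in>I. u y * cnj (w y))"

definition eigenspace :: "'a set \<Rightarrow> 'a smat \<Rightarrow> complex \<Rightarrow> 'a svec set" where
  "eigenspace I A \<theta> = {u \<in> svec_carrier I. smat_apply I A u = (\<lambda>y. \<theta> * u y)}"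

definition is_orthogonal_projection :: "'a set \<Rightarrow> 'a svec set \<Rightarrow> 'a smat \<Rightarrow> bool" where
  "is_orthogonal_projection I W P \<longleftrightarrow>
     P \<in> smat_carrier I \<and>
     (\<forall>u \<in> svec_carrier I.
        smat_apply I P u \<in> W \<and>
        (\<forall>w\<in>W. svec_inner I (\<lambda>y. u y - smat_apply I P u y) w = 0))"

definition orthogonal_projection :: "'a set \<Rightarrow> 'a svec set \<Rightarrow> 'a smat" where
  "orthogonal_projection I W = (THE P. is_orthogonal_projection I W P)"

text \<open>The Kronecker product \<open>A \<otimes> B\<close>, indexed by pairs.\<close>

definition smat_tensor :: "'a smat \<Rightarrow> 'b smat \<Rightarrow> ('a \<times> 'b) smat" where
  "smat_tensor A B = (\<lambda>(a, b) (a', b'). A a a' * B b b')"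


section \<open>The Terwilliger algebra of the Johnson scheme \<open>J(2d,d)\<close>\<close>

definition johnson_X :: "nat \<Rightarrow> nat set set" where
  "johnson_X d = nsets {1..2 * d} d"

definition johnson_R :: "nat \<Rightarrow> nat \<Rightarrow> (nat set \<times> nat set) set" where
  "johnson_R d i = {(y, z) \<in> johnson_X d \<times> johnson_X d. card (y \<inter> z) = d - i}"

definition johnson_A :: "nat \<Rightarrow> nat \<Rightarrow> nat set smat" where
  "johnson_A d i = (\<lambda>y z. if (y, z) \<in> johnson_R d i then 1 else 0)"

definition johnson_dual_E :: "nat \<Rightarrow> nat set \<Rightarrow> nat \<Rightarrow> nat set smat" where
  "johnson_dual_E d x i = (\<lambda>y z. if y = z \<and> (x, y) \<in> johnson_R d i then 1 else 0)"

definition terwilliger_algebra :: "nat \<Rightarrow> nat set \<Rightarrow> (complex, nat set smat) module" where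
  "terwilliger_algebra d x =
     generated_subalgebra (Mat_algebra (johnson_X d))
       (johnson_A d ` {0..d} \<union> johnson_dual_E d x ` {0..d})"


section \<open>Primitive idempotents of \<open>J(v,k)\<close> and the numbers \<open>d\<^sub>r\<^sub>,\<^sub>s\<close>\<close>

text \<open>
  The condition \<open>|\<alpha> \<inter> \<beta>| = k - 1\<close> is written additively: with truncated subtraction
  it would hold for \<open>k = 0\<close>, \<open>\<alpha> = \<beta> = {}\<close>.
\<close>

definition johnson_adj :: "nat \<Rightarrow> nat \<Rightarrow> nat set smat" where
  "johnson_adj v k =
     (\<lambda>\<alpha> \<beta>. if \<alpha> \<in> nsets {1..v} k \<and> \<beta> \<in> nsets {1..v} k \<and> card (\<alpha> \<inter> \<beta>) + 1 = k
             then 1 else 0)"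

definition johnson_eigenvalue :: "nat \<Rightarrow> nat \<Rightarrow> nat \<Rightarrow> complex" where
  "johnson_eigenvalue v k j =
     (of_nat k - of_nat j) * (of_nat v - of_nat k - of_nat j) - of_nat j"

definition johnson_E :: "nat \<Rightarrow> nat \<Rightarrow> nat \<Rightarrow> nat set smat" where
  "johnson_E v k j =
     (if j \<le> min k (v - k)
      then orthogonal_projection (nsets {1..v} k)
             (eigenspace (nsets {1..v} k) (johnson_adj v k) (johnson_eigenvalue v k j))
      else (\<lambda>\<alpha> \<beta>. 0))"

definition d_num :: "nat \<Rightarrow> nat \<Rightarrow> nat \<Rightarrow> int" where
  "d_num d r s =
     int (card {i \<in> {0..d}.
       (\<lambda>p q. smat_tensor (johnson_E d (d - i) r) (johnson_E d i s) p q
            + smat_tensor (johnson_E d (d - i) s) (johnson_E d i r) p q) \<noteq> (\<lambda>p q. 0)}) - 1"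

end

theory Submission
  imports Defs "HOL-Computational_Algebra.Polynomial"
begin

text \<open>
  Write \<open>x'\<close> for the complement of \<open>x\<close> in \<open>{1..2d}\<close>.  Subsets of \<open>{1..2d}\<close> are pairs of a subset
  of \<open>x\<close> and one of \<open>x'\<close>, and on the functions of either half \<open>sl\<^sub>2\<close> acts by adding and removing a
  point.  The Casimir operators \<open>C\<close> and \<open>C'\<close> of the two actions commute with both actions; they are
  diagonalisable with eigenvalues \<open>c\<^sub>r = - r (d + 1 - r)\<close>, \<open>0 \<le> r \<le> d/2\<close>, and the eigenspace for
  \<open>c\<^sub>r\<close> lives exactly on the layers \<open>r, \<dots>, d - r\<close> of the half
  (\<open>isotypic_layer\<close>, \<open>casimir_eigenvector_exists\<close>).

  The adjacency operator \<open>A\<close> of the Johnson graph is \<open>R + L + C + C'\<close> plus a scalar on each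
  distance layer, where \<open>R\<close> and \<open>L\<close> move a point from \<open>x\<close> to \<open>x'\<close> and back (\<open>A_p\<close>).  As \<open>L R\<close> acts on
  distance layer \<open>i\<close> as \<open>(C - c) (C' - c)\<close> with \<open>c = c\<^sub>i\<^sub>+\<^sub>1\<close> (\<open>L_R_p\<close>), the Terwilliger algebra contains
  \<open>R\<close>, \<open>L\<close>, \<open>C + C'\<close> and \<open>C C'\<close>, all compressed to the vertices, and hence \<open>(\<i> + C) (\<i> + C')\<close>.
  The latter is central, and since the eigenvalues of \<open>C\<close> and \<open>C'\<close> are real it separates the unordered
  pairs \<open>{r, s}\<close>, so its spectral idempotents are central idempotents indexed by \<open>r \<le> s \<le> d/2\<close>.

  On the component of \<open>{r, s}\<close>, which lives on the distance layers \<open>s, \<dots>, d - s\<close>, the operator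
  \<open>L R\<close> acts on each layer below the last by a nonzero scalar.  Suitably scaled,
  \<open>R\<^sup>i \<epsilon> E\<^sub>s\<^sup>* L\<^sup>j\<close>, with \<open>\<epsilon>\<close> the central idempotent and \<open>0 \<le> i, j \<le> d - 2s\<close>, are therefore
  matrix units (\<open>dnw_upw\<close>).  Their span contains the \<open>E\<^sub>i\<^sup>*\<close> and is stable under \<open>A\<close>, hence it
  contains all generators by the three-term recurrence of the scheme (\<open>B_span\<close>); conversely every
  matrix unit lies in the algebra (\<open>span_minimal\<close>).  This gives one block of size \<open>d - 2s + 1\<close> for
  each \<open>r \<le> s\<close>.  Finally \<open>d\<^sub>r\<^sub>,\<^sub>s = d - 2s\<close> (\<open>d_num_eq\<close>), because the primitive idempotents of the
  Johnson schemes are the compressions of the spectral projections of the Casimir operator.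
\<close>


section \<open>The ring of linear operators on a space of functions\<close>

text \<open>
  A linear operator on the complex functions on a type, with composition as product.  All
  functions are admitted, not only the finitely supported ones, so that the operators below form a
  \<^class>\<open>ring_1\<close> with a total product and no carrier set is needed.
\<close>

typedef 'a lop =
  "{F :: ('a \<Rightarrow> complex) \<Rightarrow> 'a \<Rightarrow> complex.
      (\<forall>u w. F (\<lambda>z. u z + w z) = (\<lambda>y. F u y + F w y)) \<and>
      (\<forall>c u. F (\<lambda>z. c * u z) = (\<lambda>y. c * F u y))}"
  morphisms app Lop
  by (rule exI[of _ "\<lambda>u. u"]) simp

setup_lifting type_definition_lop

lemma app_add: "app F (\<lambda>z. u z + w z) = (\<lambda>y. app F u y + app F w y)"
  using app[of F] by simp

lemma app_scale: "app F (\<lambda>z. c * u z) = (\<lambda>y. c * app F u y)"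
  using app[of F] by simp

lemma app_zero [simp]: "app F (\<lambda>z. 0) = (\<lambda>y. 0)"
  using app_scale[of F 0 "\<lambda>z. 0"] by simp

lemma app_sum: "app F (\<lambda>z. \<Sum>i\<in>I. u i z) = (\<lambda>y. \<Sum>i\<in>I. app F (u i) y)"
  by (induction I rule: infinite_finite_induct) (simp_all add: app_add)

lemma lop_eqI: "(\<And>u y. app F u y = app G u y) \<Longrightarrow> F = G"
  by (metis app_inject ext)

instantiation lop :: (type) ring_1
begin

lift_definition zero_lop :: "'a lop" is "\<lambda>u y. 0" by simp
lift_definition one_lop :: "'a lop" is "\<lambda>u. u" by simp
lift_definition plus_lop :: "'a lop \<Rightarrow> 'a lop \<Rightarrow> 'a lop" is "\<lambda>F G u y. F u y + G u y"
  by (auto simp: algebra_simps)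
lift_definition minus_lop :: "'a lop \<Rightarrow> 'a lop \<Rightarrow> 'a lop" is "\<lambda>F G u y. F u y - G u y"
  by (auto simp: algebra_simps)
lift_definition uminus_lop :: "'a lop \<Rightarrow> 'a lop" is "\<lambda>F u y. - F u y"
  by (auto simp: algebra_simps)
lift_definition times_lop :: "'a lop \<Rightarrow> 'a lop \<Rightarrow> 'a lop" is "\<lambda>F G u. F (G u)"
  by auto

instance
proof
  show "(0 :: 'a lop) \<noteq> 1"
  proof
    assume "(0 :: 'a lop) = 1"
    then have "app 0 (\<lambda>_ :: 'a. 1 :: complex) = app 1 (\<lambda>_. 1)" by simp
    then show False by (simp add: zero_lop.rep_eq one_lop.rep_eq fun_eq_iff)
  qed
qed (transfer; auto simp: algebra_simps fun_eq_iff)+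

end

text \<open>
  Multiplication by a function \<open>g\<close>: the diagonal operator with entries \<open>g\<close>.
\<close>

lift_definition diag :: "('a \<Rightarrow> complex) \<Rightarrow> 'a lop" is "\<lambda>g u y. g y * u y"
  by (auto simp: algebra_simps)

text \<open>
  Complex scalars, embedded as the central operators that multiply by a constant.
\<close>

definition sc :: "complex \<Rightarrow> 'a lop" where
  "sc c = diag (\<lambda>_. c)"

lemmas app_ring [simp] = zero_lop.rep_eq one_lop.rep_eq plus_lop.rep_eq minus_lop.rep_eq
  uminus_lop.rep_eq times_lop.rep_eq diag.rep_eq

lemma app_sc [simp]: "app (sc c) u = (\<lambda>y. c * u y)"
  by (simp add: sc_def)

lemma app_sum_left: "app (\<Sum>i\<in>I. F i) u y = (\<Sum>i\<in>I. app (F i) u y)"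
  by (induction I rule: infinite_finite_induct) simp_all

lemma diag_mult: "diag g * diag h = diag (\<lambda>y. g y * h y)"
  by (rule lop_eqI) simp

lemma diag_sum: "(\<Sum>i\<in>I. diag (g i)) = diag (\<lambda>y. \<Sum>i\<in>I. g i y)"
  by (rule lop_eqI) (simp add: app_sum_left sum_distrib_right)

lemma sc_commute: "F * sc c = sc c * F"
  by (rule lop_eqI) (simp add: app_scale)

lemma sc_left_commute: "F * (sc c * G) = sc c * (F * G)"
  by (metis mult.assoc sc_commute)

lemma sc_0 [simp]: "sc 0 = 0" and sc_1 [simp]: "sc 1 = 1"
  and sc_add: "sc (a + b) = sc a + sc b" and sc_diff: "sc (a - b) = sc a - sc b"
  and sc_minus: "sc (- a) = - sc a" and sc_mult: "sc (a * b) = sc a * sc b"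
  by (auto intro!: lop_eqI simp: algebra_simps)

lemma sc_eq_0_iff:
  assumes "c \<noteq> 0"
  shows "sc c * F = 0 \<longleftrightarrow> F = 0"
proof
  assume "sc c * F = 0"
  then have "sc (inverse c * c) * F = 0"
    by (simp only: sc_mult mult.assoc mult_zero_right)
  then show "F = 0" using assms by simp
qed simp


section \<open>Polynomials in an operator\<close>

text \<open>The value \<open>p(F)\<close> of a complex polynomial \<open>p\<close> at an operator \<open>F\<close>.\<close>

definition ev :: "complex poly \<Rightarrow> 'a lop \<Rightarrow> 'a lop" where
  "ev p F = fold_coeffs (\<lambda>a G. sc a + F * G) p 0"

lemma ev_0 [simp]: "ev 0 F = 0"
  by (simp add: ev_def)

lemma ev_pCons [simp]: "ev (pCons a p) F = sc a + F * ev p F"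
  by (cases "p = 0 \<and> a = 0") (auto simp: ev_def)

lemma ev_1 [simp]: "ev 1 F = 1"
  by (simp add: one_pCons)

lemma ev_linear: "ev [:- c, 1:] F = F - sc c"
  by (simp add: sc_minus)

lemma ev_add: "ev (p + q) F = ev p F + ev q F"
  by (induction p q rule: poly_induct2) (simp_all add: sc_add algebra_simps)

lemma ev_smult: "ev (Polynomial.smult c p) F = sc c * ev p F"
  by (induction p) (simp_all add: sc_mult sc_left_commute distrib_left)

lemma ev_mult: "ev (p * q) F = ev p F * ev q F"
  by (induction p) (simp_all add: ev_add ev_smult algebra_simps)

lemma ev_sum: "ev (\<Sum>i\<in>I. p i) F = (\<Sum>i\<in>I. ev (p i) F)"
  by (induction I rule: infinite_finite_induct) (simp_all add: ev_add)

lemma ev_commute: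
  assumes "F * G = G * F"
  shows "ev p F * G = G * ev p F"
proof (induction p)
  case (pCons a p)
  have "F * ev p F * G = G * (F * ev p F)"
    by (simp only: mult.assoc pCons.IH) (simp only: mult.assoc [symmetric] assms)
  then show ?case by (simp add: algebra_simps sc_commute)
qed simp

lemma ev_eigen:
  assumes "F * E = sc c * E"
  shows "ev p F * E = sc (poly p c) * E"
proof (induction p)
  case (pCons a p)
  have "F * ev p F * E = sc (poly p c) * (sc c * E)"
    by (simp only: mult.assoc pCons.IH sc_left_commute[of F] assms)
  also have "\<dots> = sc (c * poly p c) * E"
    by (simp only: mult.assoc [symmetric] sc_mult [symmetric] mult.commute[of c])
  finally show ?case by (simp add: sc_add distrib_right)
qed simp

lemma ev_app_eigen:
  assumes "app F u = (\<lambda>y. c * u y)"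
  shows "app (ev p F) u = (\<lambda>y. poly p c * u y)"
proof (induction p)
  case (pCons a p)
  show ?case unfolding ev_pCons poly_pCons plus_lop.rep_eq times_lop.rep_eq pCons.IH app_scale assms
    by (simp add: algebra_simps)
qed simp

text \<open>The Lagrange polynomial that is \<open>1\<close> at \<open>a\<close> and \<open>0\<close> at the other points of \<open>A\<close>.\<close>

definition lagrange :: "complex set \<Rightarrow> complex \<Rightarrow> complex poly" where
  "lagrange A a = (\<Prod>b\<in>A - {a}. Polynomial.smult (1 / (a - b)) [:- b, 1:])"

lemma poly_lagrange:
  assumes "finite A" "b \<in> A"
  shows "poly (lagrange A a) b = (if b = a then 1 else 0)"
proof (cases "b = a")
  case True
  have "(\<Prod>c\<in>A - {a}. poly (Polynomial.smult (1 / (a - c)) [:- c, 1:]) a) = 1"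
    by (intro prod.neutral) (auto simp: divide_simps)
  then show ?thesis using True by (simp add: lagrange_def poly_prod)
next
  case False
  have "(\<Prod>c\<in>A - {a}. poly (Polynomial.smult (1 / (a - c)) [:- c, 1:]) b) = 0"
    using assms False by (intro prod_zero) auto
  then show ?thesis using False by (simp add: lagrange_def poly_prod)
qed

lemma sum_lagrange:
  assumes "finite A" "A \<noteq> {}"
  shows "(\<Sum>a\<in>A. lagrange A a) = 1"
proof (rule poly_eqI_degree)
  fix x assume x: "x \<in> A"
  then have "(\<Sum>a\<in>A. poly (lagrange A a) x) = (\<Sum>a\<in>A. if x = a then 1 else 0)"
    using assms by (intro sum.cong) (auto simp: poly_lagrange)
  then show "poly (\<Sum>a\<in>A. lagrange A a) x = poly 1 x"
    using x assms by (simp add: poly_sum)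
next
  have "degree (lagrange A a) \<le> card A - 1" if "a \<in> A" for a
  proof -
    have "degree (lagrange A a) \<le> (\<Sum>b\<in>A - {a}. degree (Polynomial.smult (1 / (a - b)) [:- b, 1:]))"
      unfolding lagrange_def using assms(1)
      by (intro order.trans[OF degree_prod_sum_le]) (simp_all only: finite_Diff o_def order.refl)
    also have "\<dots> \<le> (\<Sum>b\<in>A - {a}. 1)"
      by (intro sum_mono) auto
    finally show ?thesis using that assms by simp
  qed
  then have "degree (\<Sum>a\<in>A. lagrange A a) \<le> card A - 1"
    using assms by (intro degree_sum_le) auto
  moreover have "card A > 0" using assms by (simp add: card_gt_0_iff)
  ultimately show "degree (\<Sum>a\<in>A. lagrange A a) < card A" by linarith
qed (use assms in \<open>simp add: card_gt_0_iff\<close>)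

lemma lagrange_mult:
  fixes a :: complex
  assumes "finite A" "a \<in> A"
  shows "\<exists>k. [:- a, 1:] * lagrange A a = Polynomial.smult k (\<Prod>b\<in>A. [:- b, 1:])"
proof
  have "lagrange A a = Polynomial.smult (\<Prod>b\<in>A - {a}. 1 / (a - b)) (\<Prod>b\<in>A - {a}. [:- b, 1:])"
    unfolding lagrange_def by (rule prod_smult)
  moreover have "(\<Prod>b\<in>A. [:- b, 1:]) = [:- a, 1:] * (\<Prod>b\<in>A - {a}. [:- b, 1:])"
    using assms by (rule prod.remove)
  ultimately show "[:- a, 1:] * lagrange A a
      = Polynomial.smult (\<Prod>b\<in>A - {a}. 1 / (a - b)) (\<Prod>b\<in>A. [:- b, 1:])"
    by (simp only: mult_smult_right)
qed

text \<open>
  An operator annihilated by a polynomial with simple roots has spectral idempotents that are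
  polynomials in it.
\<close>

lemma spectral_idempotents:
  assumes "finite A" "A \<noteq> {}" and null: "ev (\<Prod>b\<in>A. [:- b, 1:]) F = 0"
  shows "(\<Sum>a\<in>A. ev (lagrange A a) F) = 1"
    and "a \<in> A \<Longrightarrow> F * ev (lagrange A a) F = sc a * ev (lagrange A a) F"
    and "a \<in> A \<Longrightarrow> b \<in> A \<Longrightarrow>
      ev (lagrange A a) F * ev (lagrange A b) F = (if a = b then ev (lagrange A a) F else 0)"
proof -
  show "(\<Sum>a\<in>A. ev (lagrange A a) F) = 1"
    using sum_lagrange[OF assms(1,2)] by (metis ev_1 ev_sum)
  show eig: "F * ev (lagrange A a) F = sc a * ev (lagrange A a) F" if a: "a \<in> A" for a
  proof -
    obtain k where "[:- a, 1:] * lagrange A a = Polynomial.smult k (\<Prod>b\<in>A. [:- b, 1:])"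
      using lagrange_mult[OF assms(1) a] by blast
    then have "ev [:- a, 1:] F * ev (lagrange A a) F = 0"
      by (metis ev_mult ev_smult null mult_zero_right)
    then show ?thesis by (simp only: ev_linear left_diff_distrib right_minus_eq)
  qed
  show "ev (lagrange A a) F * ev (lagrange A b) F = (if a = b then ev (lagrange A a) F else 0)"
    if "a \<in> A" "b \<in> A"
    using ev_eigen[OF eig[OF that(2)], of "lagrange A a"] poly_lagrange[OF assms(1) that(2), of a]
    by auto
qed

section \<open>Raising and lowering operators on the subsets of a finite set\<close>

text \<open>
  The action of \<open>sl\<^sub>2\<close> on the functions of a subset variable, restricted to the points of \<open>S\<close>.
  As matrices, \<open>raising S\<close> maps the basis vector of a set \<open>z\<close> to the sum of the basis vectors of
  \<open>z \<union> {a}\<close> for \<open>a \<in> S - z\<close>, and \<open>lowering S\<close> is its transpose.  Points outside \<open>S\<close> are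
  not touched, so operators for disjoint sets act like operators on different tensor factors.
\<close>

lift_definition raising :: "'a set \<Rightarrow> 'a set lop" is "\<lambda>S u y. \<Sum>a\<in>S \<inter> y. u (y - {a})"
  by (auto simp: sum.distrib sum_distrib_left)

lift_definition lowering :: "'a set \<Rightarrow> 'a set lop" is "\<lambda>S u y. \<Sum>a\<in>S - y. u (insert a y)"
  by (auto simp: sum.distrib sum_distrib_left)

text \<open>
  The diagonal operator with entries \<open>|S \<inter> y|\<close>.
\<close>

definition num :: "'a set \<Rightarrow> 'a set lop" where
  "num S = diag (\<lambda>y. of_nat (card (S \<inter> y)))"

text \<open>
  The projection onto the functions supported on the sets that meet \<open>S\<close> in \<open>k\<close> points.
\<close>

definition layer :: "'a set \<Rightarrow> nat \<Rightarrow> 'a set lop" where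
  "layer S k = diag (\<lambda>y. if card (S \<inter> y) = k then 1 else 0)"

text \<open>
  The Casimir operator of this action, normalised to vanish on the constants.  On the sets that meet
  \<open>S\<close> in \<open>k\<close> points it is the adjacency operator of the Johnson graph minus \<open>k (|S| - k)\<close>.
\<close>

definition casimir :: "'a set \<Rightarrow> 'a set lop" where
  "casimir S = raising S * lowering S - num S * (sc (of_nat (card S)) + 1 - num S)"

lemma raising_diag:
  assumes "\<And>y a. a \<in> S \<Longrightarrow> a \<in> y \<Longrightarrow> g (y - {a}) = h y"
  shows "raising S * diag g = diag h * raising S"
  by (rule lop_eqI) (auto simp: raising.rep_eq sum_distrib_left assms intro!: sum.cong)

lemma lowering_diag:
  assumes "\<And>y a. a \<in> S \<Longrightarrow> a \<notin> y \<Longrightarrow> g (insert a y) = h y"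
  shows "lowering S * diag g = diag h * lowering S"
  by (rule lop_eqI) (auto simp: lowering.rep_eq sum_distrib_left assms intro!: sum.cong)

lemma card_Int_Diff1:
  assumes "finite S" "a \<in> S" "a \<in> y"
  shows "card (S \<inter> y) = Suc (card (S \<inter> (y - {a})))"
proof -
  have "S \<inter> y = insert a (S \<inter> (y - {a}))" using assms by auto
  then show ?thesis using assms by simp
qed

lemma card_Int_insert1:
  assumes "finite S" "a \<in> S" "a \<notin> y"
  shows "card (S \<inter> insert a y) = Suc (card (S \<inter> y))"
  using assms by simp

lemma num_raising: "finite S \<Longrightarrow> num S * raising S = raising S * (num S + 1)"
proof -
  assume S: "finite S"
  have "num S + 1 = diag (\<lambda>y. of_nat (card (S \<inter> y)) + 1)"
    by (rule lop_eqI) (simp add: num_def algebra_simps)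
  then show ?thesis
    using raising_diag[of S "\<lambda>y. of_nat (card (S \<inter> y)) + 1" "\<lambda>y. of_nat (card (S \<inter> y))"]
    by (simp add: num_def card_Int_Diff1[OF S])
qed

lemma lowering_num: "finite S \<Longrightarrow> lowering S * num S = (num S + 1) * lowering S"
proof -
  assume S: "finite S"
  have "num S + 1 = diag (\<lambda>y. of_nat (card (S \<inter> y)) + 1)"
    by (rule lop_eqI) (simp add: num_def algebra_simps)
  then show ?thesis
    using lowering_diag[of S "\<lambda>y. of_nat (card (S \<inter> y))" "\<lambda>y. of_nat (card (S \<inter> y)) + 1"]
    by (simp add: num_def S)
qed

text \<open>
  Both products of the two operators are the sum over all ways to exchange a point of \<open>S \<inter> y\<close> for
  one of \<open>S - y\<close>, plus a diagonal term; their difference is therefore diagonal.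
\<close>

lemma app_raising_lowering:
  assumes "finite S"
  shows "app (raising S) (app (lowering S) u) y = of_nat (card (S \<inter> y)) * u y
    + (\<Sum>a\<in>S \<inter> y. \<Sum>b\<in>S - y. u (insert b (y - {a})))"
proof -
  have "(\<Sum>b\<in>S - (y - {a}). u (insert b (y - {a})))
      = u y + (\<Sum>b\<in>S - y. u (insert b (y - {a})))" if "a \<in> S \<inter> y" for a
  proof -
    have "S - (y - {a}) = insert a (S - y)" "insert a (y - {a}) = y" using that by auto
    then show ?thesis using that assms by simp
  qed
  then show ?thesis
    by (simp add: raising.rep_eq lowering.rep_eq sum.distrib)
qed

lemma app_lowering_raising:
  assumes "finite S"
  shows "app (lowering S) (app (raising S) u) y = of_nat (card (S - y)) * u y
    + (\<Sum>a\<in>S \<inter> y. \<Sum>b\<in>S - y. u (insert b (y - {a})))"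
proof -
  have "(\<Sum>a\<in>S \<inter> insert b y. u (insert b y - {a}))
      = u y + (\<Sum>a\<in>S \<inter> y. u (insert b (y - {a})))" if "b \<in> S - y" for b
  proof -
    have "S \<inter> insert b y = insert b (S \<inter> y)" "insert b y - {b} = y" using that by auto
    moreover have "(\<Sum>a\<in>S \<inter> y. u (insert b y - {a})) = (\<Sum>a\<in>S \<inter> y. u (insert b (y - {a})))"
      using that by (intro sum.cong) (auto simp: insert_Diff_if)
    ultimately show ?thesis using that assms by simp
  qed
  then show ?thesis
    by (simp add: raising.rep_eq lowering.rep_eq sum.distrib sum.swap[of _ "S - y"])
qed

lemma lowering_raising:
  assumes "finite S"
  shows "lowering S * raising S
    = casimir S + (num S + 1) * (sc (of_nat (card S)) - num S)"
proof (rule lop_eqI)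
  fix u y
  have "card (S \<inter> y) \<le> card S" using assms by (simp add: card_mono)
  then have c: "(of_nat (card (S - y)) :: complex) = of_nat (card S) - of_nat (card (S \<inter> y))"
    using assms by (simp add: card_Diff_subset_Int of_nat_diff)
  then show "app (lowering S * raising S) u y
    = app (casimir S + (num S + 1) * (sc (of_nat (card S)) - num S)) u y"
    by (simp add: casimir_def num_def app_raising_lowering[OF assms]
        app_lowering_raising[OF assms] c) (simp add: algebra_simps)
qed

lemma casimir_raising:
  assumes "finite S"
  shows "casimir S * raising S = raising S * casimir S"
proof -
  let ?N = "num S" and ?n = "sc (of_nat (card S)) :: 'a set lop"
  let ?e = "raising S" and ?f = "lowering S"
  have "?N * (?n + 1 - ?N) * ?e = ?e * ((?N + 1) * (?n - ?N))"
  proof -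
    have "(?n + 1 - ?N) * ?e = ?e * (?n - ?N)"
      using num_raising[OF assms] sc_commute[of ?e] by (simp add: algebra_simps)
    then have "?N * (?n + 1 - ?N) * ?e = ?N * ?e * (?n - ?N)"
      by (simp only: mult.assoc)
    then show ?thesis by (simp only: num_raising[OF assms] mult.assoc)
  qed
  moreover have "?e * casimir S = ?e * (?f * ?e) - ?e * ((?N + 1) * (?n - ?N))"
    by (simp only: lowering_raising[OF assms] right_diff_distrib [symmetric] add_diff_cancel_right')
  ultimately show ?thesis
    by (simp only: casimir_def left_diff_distrib mult.assoc)
qed

lemma casimir_lowering:
  assumes "finite S"
  shows "casimir S * lowering S = lowering S * casimir S"
proof -
  let ?N = "num S" and ?n = "sc (of_nat (card S)) :: 'a set lop"
  let ?e = "raising S" and ?f = "lowering S"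
  have "?f * (?N * (?n + 1 - ?N)) = (?N + 1) * (?n - ?N) * ?f"
  proof -
    have "?f * (?n + 1 - ?N) = (?n - ?N) * ?f"
      using lowering_num[OF assms] sc_commute[of ?f] by (simp add: algebra_simps)
    then have "(?N + 1) * (?f * (?n + 1 - ?N)) = (?N + 1) * (?n - ?N) * ?f"
      by (simp only: mult.assoc)
    then show ?thesis by (simp only: mult.assoc [symmetric] lowering_num[OF assms])
  qed
  moreover have "casimir S * ?f = ?f * ?e * ?f - (?N + 1) * (?n - ?N) * ?f"
    by (simp only: lowering_raising[OF assms] left_diff_distrib [symmetric] add_diff_cancel_right')
  ultimately show ?thesis
    by (simp only: casimir_def right_diff_distrib mult.assoc)
qed

lemma casimir_diag:
  assumes "\<And>y a. a \<in> S \<Longrightarrow> a \<notin> y \<Longrightarrow> g (insert a y) = g y"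
  shows "casimir S * diag g = diag g * casimir S"
proof -
  have l: "lowering S * diag g = diag g * lowering S"
    by (rule lowering_diag) (rule assms)
  have r: "raising S * diag g = diag g * raising S"
    by (rule raising_diag) (metis Diff_iff assms insertI1 insert_Diff)
  have "raising S * lowering S * diag g = diag g * (raising S * lowering S)"
    by (simp only: l mult.assoc) (simp only: r mult.assoc [symmetric])
  moreover have "num S * (sc (of_nat (card S)) + 1 - num S) * diag g
      = diag g * (num S * (sc (of_nat (card S)) + 1 - num S))"
    by (rule lop_eqI) (simp add: num_def algebra_simps)
  ultimately show ?thesis
    by (simp only: casimir_def left_diff_distrib right_diff_distrib)
qed

lemma raising_layer: "finite S \<Longrightarrow> raising S * layer S k = layer S (Suc k) * raising S"
  unfolding layer_def by (rule raising_diag) (simp add: card_Int_Diff1)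

lemma lowering_layer: "finite S \<Longrightarrow> lowering S * layer S (Suc k) = layer S k * lowering S"
  unfolding layer_def by (rule lowering_diag) simp

lemma lowering_layer_0: "finite S \<Longrightarrow> lowering S * layer S 0 = 0"
  by (rule lop_eqI) (auto simp: layer_def lowering.rep_eq intro!: sum.neutral)

lemma layer_eq_0: "finite S \<Longrightarrow> k > card S \<Longrightarrow> layer S k = 0"
  by (rule lop_eqI) (use card_mono[of S "S \<inter> _"] in \<open>auto simp: layer_def leD\<close>)

lemma sum_layer:
  assumes "finite S"
  shows "(\<Sum>k\<le>card S. layer S k) = 1"
  by (rule lop_eqI)
    (use assms card_mono[of S "S \<inter> _"] in \<open>auto simp: layer_def diag_sum sum.delta' leD\<close>)

text \<open>
  The eigenvalue of the Casimir operator of an \<open>n\<close>-set on the component whose lowest layer is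
  \<open>r\<close>.  It takes the same value at \<open>r\<close> and \<open>n + 1 - r\<close>, and different values for
  different \<open>r \<le> n/2\<close>.
\<close>

definition cval :: "nat \<Rightarrow> nat \<Rightarrow> complex" where
  "cval n r = - (of_nat r * (of_nat n + 1 - of_nat r))"

lemma cval_eq_iff:
  "cval n r = cval n q \<longleftrightarrow> r = q \<or> r + q = n + 1"
proof -
  have "cval n r = cval n q \<longleftrightarrow> (of_nat r - of_nat q) * (of_nat n + 1 - (of_nat r + of_nat q)) = (0::complex)"
  proof -
    have "cval n q - cval n r = (of_nat r - of_nat q) * (of_nat n + 1 - (of_nat r + of_nat q))"
      by (simp add: cval_def algebra_simps)
    then show ?thesis by (metis right_minus_eq)
  qed
  also have "\<dots> \<longleftrightarrow> of_nat r = (of_nat q::complex) \<or> of_nat (n + 1) = (of_nat (r + q)::complex)"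
    by (simp add: add.commute)
  finally show ?thesis by (simp only: of_nat_eq_iff) auto
qed

lemma inj_on_cval: "inj_on (cval n) {..n div 2}"
  by (rule inj_onI) (auto simp: cval_eq_iff)

lemma raising_lowering_layer:
  "raising S * lowering S * layer S k = (casimir S - sc (cval (card S) k)) * layer S k"
  by (rule lop_eqI) (auto simp: casimir_def num_def layer_def cval_def app_scale algebra_simps)

lemma lowering_raising_layer:
  assumes "finite S"
  shows "lowering S * raising S * layer S k
    = (casimir S - sc (cval (card S) (Suc k))) * layer S k"
  unfolding lowering_raising[OF assms]
  by (rule lop_eqI) (auto simp: num_def layer_def cval_def app_scale algebra_simps)

lemma casimir_layer: "finite S \<Longrightarrow> casimir S * layer S k = layer S k * casimir S"
proof -
  assume S: "finite S"
  have "raising S * lowering S * layer S k = layer S k * (raising S * lowering S)"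
  proof (cases k)
    case 0
    have "layer S 0 * raising S = 0"
      by (rule lop_eqI) (auto simp: layer_def raising.rep_eq S)
    then show ?thesis
      by (simp add: 0 mult.assoc lowering_layer_0[OF S]) (simp add: mult.assoc [symmetric])
  next
    case (Suc j)
    show ?thesis
      by (simp only: Suc mult.assoc lowering_layer[OF S])
        (simp only: mult.assoc [symmetric] raising_layer[OF S])
  qed
  moreover have "num S * (sc (of_nat (card S)) + 1 - num S) * layer S k
      = layer S k * (num S * (sc (of_nat (card S)) + 1 - num S))"
    by (rule lop_eqI) (simp add: num_def layer_def algebra_simps)
  ultimately show ?thesis
    by (simp only: casimir_def left_diff_distrib right_diff_distrib)
qed


section \<open>The spectrum of the Casimir operator\<close>

text \<open>
  On layer \<open>k\<close> the operator \<open>casimir S - cval k\<close> factors through layer \<open>k - 1\<close>, so induction from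
  the empty layer shows that only the eigenvalues \<open>cval 0, \<dots>, cval k\<close> occur there.  The next lemma
  is the same argument from the top layer.
\<close>

lemma casimir_annihilated_below:
  assumes S: "finite S"
  shows "ev (\<Prod>q\<le>k. [:- cval (card S) q, 1:]) (casimir S) * layer S k = 0"
proof (induction k)
  case 0
  have "(casimir S - sc (cval (card S) 0)) * layer S 0 = 0"
    by (simp only: raising_lowering_layer [symmetric] mult.assoc lowering_layer_0[OF S] mult_zero_right)
  then show ?case by (simp only: atMost_0 prod.insert finite.emptyI empty_iff not_False_eq_True
        prod.empty mult_1_right ev_linear)
next
  case (Suc k)
  let ?p = "\<Prod>q\<le>k. [:- cval (card S) q, 1:]"
  have "ev [:- cval (card S) (Suc k), 1:] (casimir S) * layer S (Suc k)
      = raising S * (layer S k * lowering S)"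
    by (simp only: ev_linear lowering_layer[OF S, symmetric] mult.assoc [symmetric]
        raising_lowering_layer)
  then have "ev (\<Prod>q\<le>Suc k. [:- cval (card S) q, 1:]) (casimir S) * layer S (Suc k)
      = ev ?p (casimir S) * raising S * (layer S k * lowering S)"
    by (simp only: prod.atMost_Suc ev_mult mult.assoc)
  also have "\<dots> = raising S * (ev ?p (casimir S) * layer S k) * lowering S"
    by (simp only: ev_commute[OF casimir_raising[OF S]] mult.assoc)
  finally show ?case by (simp only: Suc.IH mult_zero_left mult_zero_right)
qed

lemma casimir_annihilated_above:
  assumes S: "finite S" and "k + j = card S"
  shows "ev (\<Prod>q\<le>j. [:- cval (card S) q, 1:]) (casimir S) * layer S k = 0"
  using assms(2)
proof (induction j arbitrary: k)
  case 0
  \<comment> \<open>\<open>k = card S\<close> here, so that \<open>Suc k\<close> and \<open>0\<close> have the same eigenvalue\<close>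
  then have c: "cval (card S) (Suc k) = cval (card S) 0"
    by (simp add: cval_eq_iff)
  have "(casimir S - sc (cval (card S) (Suc k))) * layer S k = 0"
    using 0 by (simp only: lowering_raising_layer[OF S, symmetric] mult.assoc raising_layer[OF S]) (simp add: layer_eq_0[OF S])
  then show ?case by (simp only: c atMost_0 prod.insert finite.emptyI empty_iff not_False_eq_True
        prod.empty mult_1_right ev_linear)
next
  case (Suc j)
  then have c: "cval (card S) (Suc j) = cval (card S) (Suc k)"
    by (simp add: cval_eq_iff)
  let ?p = "\<Prod>q\<le>j. [:- cval (card S) q, 1:]"
  have "ev [:- cval (card S) (Suc j), 1:] (casimir S) * layer S k
      = lowering S * (layer S (Suc k) * raising S)"
    by (simp only: c ev_linear raising_layer[OF S, symmetric] mult.assoc [symmetric]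
        lowering_raising_layer[OF S])
  then have "ev (\<Prod>q\<le>Suc j. [:- cval (card S) q, 1:]) (casimir S) * layer S k
      = ev ?p (casimir S) * lowering S * (layer S (Suc k) * raising S)"
    by (simp only: prod.atMost_Suc ev_mult mult.assoc)
  also have "\<dots> = lowering S * (ev ?p (casimir S) * layer S (Suc k)) * raising S"
    by (simp only: ev_commute[OF casimir_lowering[OF S]] mult.assoc)
  finally show ?case using Suc.IH[of "Suc k"] Suc.prems by simp
qed

text \<open>
  The projection onto the eigenspace of the Casimir operator for \<open>cval r\<close>, as a polynomial in the
  Casimir operator.
\<close>

definition isotypic :: "'a set \<Rightarrow> nat \<Rightarrow> 'a set lop" where
  "isotypic S r =
     ev (lagrange (cval (card S) ` {..card S div 2}) (cval (card S) r)) (casimir S)"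

lemma ev_dvd_eq_0:
  assumes "p dvd q" "ev p F * E = 0"
  shows "ev q F * E = 0"
  using assms by (auto simp: ev_mult mult.assoc mult.commute[of p])

lemma casimir_annihilated:
  assumes S: "finite S" and A: "finite A" and k: "\<And>q. q \<le> k \<Longrightarrow> q + k \<le> card S \<Longrightarrow> q \<in> A"
  shows "ev (\<Prod>q\<in>A. [:- cval (card S) q, 1:]) (casimir S) * layer S k = 0"
proof (cases "k \<le> card S")
  case True
  show ?thesis
  proof (cases "2 * k \<le> card S")
    case True
    then have "{..k} \<subseteq> A" using k by auto
    then show ?thesis
      using casimir_annihilated_below[OF S, of k] prod_dvd_prod_subset[OF A] ev_dvd_eq_0 by blast
  next
    case False
    then have "{..card S - k} \<subseteq> A" using k \<open>k \<le> card S\<close> by auto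
    then show ?thesis
      using casimir_annihilated_above[OF S, of k "card S - k"] prod_dvd_prod_subset[OF A]
        ev_dvd_eq_0 \<open>k \<le> card S\<close> by (metis le_add_diff_inverse)
  qed
qed (simp add: layer_eq_0[OF S])

lemma prod_cval_image:
  assumes "A \<subseteq> {..n div 2}"
  shows "(\<Prod>b\<in>cval n ` A. [:- b, 1:]) = (\<Prod>q\<in>A. [:- cval n q, 1:])"
  using inj_on_subset[OF inj_on_cval assms] by (simp add: prod.reindex)

lemma casimir_null:
  assumes S: "finite S"
  shows "ev (\<Prod>b\<in>cval (card S) ` {..card S div 2}. [:- b, 1:]) (casimir S) = 0"
proof -
  let ?p = "\<Prod>q\<le>card S div 2. [:- cval (card S) q, 1:]"
  have "ev ?p (casimir S) * (\<Sum>k\<le>card S. layer S k) = 0"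
    unfolding sum_distrib_left
    by (intro sum.neutral ballI casimir_annihilated[OF S]) auto
  then show ?thesis by (simp add: sum_layer[OF S] prod_cval_image)
qed

lemma sum_isotypic:
  assumes "finite S"
  shows "(\<Sum>r\<le>card S div 2. isotypic S r) = 1"
  using spectral_idempotents(1)[OF _ _ casimir_null[OF assms]]
  by (simp add: isotypic_def sum.reindex[OF inj_on_cval])

lemma casimir_isotypic:
  assumes "finite S" "r \<le> card S div 2"
  shows "casimir S * isotypic S r = sc (cval (card S) r) * isotypic S r"
  using spectral_idempotents(2)[OF _ _ casimir_null[OF assms(1)]] assms(2)
  by (simp add: isotypic_def)

text \<open>
  The component with lowest layer \<open>r\<close> lives on the layers \<open>r, \<dots>, |S| - r\<close> only.
\<close>

lemma isotypic_layer:
  assumes S: "finite S" and r: "r \<le> card S div 2" and k: "k < r \<or> card S < k + r"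
  shows "isotypic S r * layer S k = 0"
proof -
  let ?A = "{..card S div 2}" and ?c = "cval (card S)"
  have "?c ` ?A - {?c r} = ?c ` (?A - {r})"
    using inj_on_cval[of "card S"] r by (auto simp: inj_on_def)
  then have "lagrange (?c ` ?A) (?c r) = (\<Prod>b\<in>?c ` (?A - {r}). Polynomial.smult (1 / (?c r - b)) [:- b, 1:])"
    by (simp add: lagrange_def)
  also have "\<dots> = Polynomial.smult (\<Prod>b\<in>?c ` (?A - {r}). 1 / (?c r - b)) (\<Prod>q\<in>?A - {r}. [:- ?c q, 1:])"
    by (simp only: prod_smult prod_cval_image Diff_subset)
  finally have "isotypic S r * layer S k = sc (\<Prod>b\<in>?c ` (?A - {r}). 1 / (?c r - b))
      * (ev (\<Prod>q\<in>?A - {r}. [:- ?c q, 1:]) (casimir S) * layer S k)"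
    by (simp only: isotypic_def ev_smult mult.assoc)
  also have "\<dots> = 0"
    using k by (subst casimir_annihilated[OF S]) auto
  finally show ?thesis .
qed

text \<open>
  The vector is the product of the differences of the indicators of \<open>a\<^sub>k \<in> y\<close> and \<open>b\<^sub>k \<in> y\<close> over
  \<open>r\<close> disjoint pairs \<open>{a\<^sub>k, b\<^sub>k}\<close> of points of \<open>S\<close>, on the sets that meet \<open>S\<close> in \<open>r\<close> points.
  It depends on \<open>S \<inter> y\<close> only, so that such vectors for disjoint sets can be multiplied.
\<close>

lemma lowest_weight_vector_exists:
  fixes S :: "'a set"
  assumes S: "finite S" and r: "2 * r \<le> card S"
  shows "\<exists>v. v \<noteq> (\<lambda>_. 0) \<and> app (lowering S) v = (\<lambda>_. 0)
    \<and> (\<forall>y. v y \<noteq> 0 \<longrightarrow> card (S \<inter> y) = r) \<and> (\<forall>y. v y = v (S \<inter> y))"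
proof -
  obtain h where h: "bij_betw h {0..<card S} S"
    using ex_bij_betw_nat_finite[OF S] by blast
  define a b where "a k = h (2 * k)" and "b k = h (2 * k + 1)" for k
  have inj: "inj_on h {0..<card S}" using h by (rule bij_betw_imp_inj_on)
  have inS: "a k \<in> S" "b k \<in> S" if "k < r" for k
    using that r bij_betwE[OF h] by (auto simp: a_def b_def)
  have aa: "a j = a k \<longleftrightarrow> j = k" and bb: "b j = b k \<longleftrightarrow> j = k" and ab: "a j \<noteq> b k"
    if "j < r" "k < r" for j k
  proof -
    have less: "2 * j + 1 < card S" "2 * k + 1 < card S" using that r by auto
    show "a j = a k \<longleftrightarrow> j = k" "b j = b k \<longleftrightarrow> j = k"
      using less by (auto simp: a_def b_def inj_on_eq_iff[OF inj])
    have "2 * j \<noteq> 2 * k + 1" by presburger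
    then show "a j \<noteq> b k"
      using less by (simp add: a_def b_def inj_on_eq_iff[OF inj])
  qed
  define \<chi> :: "'a set \<Rightarrow> nat \<Rightarrow> complex" where "\<chi> y k = of_bool (a k \<in> y) - of_bool (b k \<in> y)" for y k
  define v where "v y = (if card (S \<inter> y) = r then \<Prod>k<r. \<chi> y k else 0)" for y
  have "v (a ` {..<r}) \<noteq> 0"
  proof -
    have "inj_on a {..<r}" by (auto simp: inj_on_def aa)
    moreover have "S \<inter> a ` {..<r} = a ` {..<r}" using inS by auto
    moreover have "b k \<notin> a ` {..<r}" if "k < r" for k using ab that by fastforce
    ultimately show ?thesis by (auto simp: v_def \<chi>_def card_image)
  qed
  then have "v \<noteq> (\<lambda>_. 0)" by auto
  moreover have "app (lowering S) v y = 0" for y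
  proof (cases "Suc (card (S \<inter> y)) = r")
    case False
    then show ?thesis by (simp add: lowering.rep_eq v_def S)
  next
    case True
    \<comment> \<open>a set of fewer than \<open>r\<close> points misses one of the \<open>r\<close> disjoint pairs\<close>
    have "\<exists>k<r. a k \<notin> y \<and> b k \<notin> y"
    proof (rule ccontr)
      assume *: "\<not> (\<exists>k<r. a k \<notin> y \<and> b k \<notin> y)"
      define g where "g k = (if a k \<in> y then a k else b k)" for k
      have "inj_on g {..<r}"
        by (auto simp: inj_on_def g_def aa bb ab ab[symmetric] split: if_splits)
      moreover have "g ` {..<r} \<subseteq> S \<inter> y" using * inS by (auto simp: g_def)
      ultimately have "r \<le> card (S \<inter> y)" using S by (metis card_inj_on_le card_lessThan finite_Int)
      then show False using True by simp
    qed
    then obtain k where k: "k < r" "a k \<notin> y" "b k \<notin> y" by blast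
    have v: "v (insert c y) = \<chi> (insert c y) k * (\<Prod>j\<in>{..<r} - {k}. \<chi> (insert c y) j)"
      if "c \<in> S - y" for c
      using that True S k(1) by (simp add: v_def prod.remove[of "{..<r}" k])
    have "app (lowering S) v y = (\<Sum>c\<in>S - y. v (insert c y))"
      by (simp add: lowering.rep_eq)
    also have "\<dots> = (\<Sum>c\<in>{a k, b k}. v (insert c y))"
      by (rule sum.mono_neutral_right) (use S k inS v in \<open>auto simp: \<chi>_def\<close>)
    also have "\<dots> = v (insert (a k) y) + v (insert (b k) y)"
      using ab k(1) by simp
    also have "\<dots> = (\<Prod>j\<in>{..<r} - {k}. \<chi> (insert (a k) y) j)
        - (\<Prod>j\<in>{..<r} - {k}. \<chi> (insert (b k) y) j)"
      using k inS ab[of k k] by (simp add: v) (simp add: \<chi>_def)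
    also have "(\<Prod>j\<in>{..<r} - {k}. \<chi> (insert (a k) y) j) = (\<Prod>j\<in>{..<r} - {k}. \<chi> (insert (b k) y) j)"
      using k(1) by (intro prod.cong) (auto simp: \<chi>_def aa bb ab ab[symmetric])
    finally show ?thesis by simp
  qed
  moreover have "\<forall>y. v y \<noteq> 0 \<longrightarrow> card (S \<inter> y) = r" by (simp add: v_def)
  moreover have "\<forall>y. v y = v (S \<inter> y)" using inS by (simp add: v_def \<chi>_def)
  ultimately show ?thesis by blast
qed

text \<open>
  Raising a lowest weight vector keeps the eigenvalue, and lowering the result again multiplies it
  by a nonzero scalar until layer \<open>|S| - r\<close> is reached.
\<close>

lemma casimir_eigenvector_exists:
  fixes S :: "'a set"
  assumes S: "finite S" and "r \<le> k" and "k + r \<le> card S"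
  shows "\<exists>v. v \<noteq> (\<lambda>_. 0) \<and> app (casimir S) v = (\<lambda>y. cval (card S) r * v y)
    \<and> (\<forall>y. v y \<noteq> 0 \<longrightarrow> card (S \<inter> y) = k) \<and> (\<forall>y. v y = v (S \<inter> y))"
  using assms(2,3)
proof (induction k rule: dec_induct)
  case base
  obtain v where v: "v \<noteq> (\<lambda>_. 0)" "app (lowering S) v = (\<lambda>_. 0)"
    "\<forall>y. v y \<noteq> 0 \<longrightarrow> card (S \<inter> y) = r" "\<forall>y. v y = v (S \<inter> y)"
    using lowest_weight_vector_exists[OF S, of r] base by auto
  have "app (casimir S) v y = cval (card S) r * v y" for y
    using v(2,3) by (cases "v y = 0") (simp_all add: casimir_def num_def cval_def algebra_simps)
  then show ?case using v by blast
next
  case (step k)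
  then obtain v where v: "v \<noteq> (\<lambda>_. 0)" "app (casimir S) v = (\<lambda>y. cval (card S) r * v y)"
    "\<And>y. v y \<noteq> 0 \<Longrightarrow> card (S \<inter> y) = k" "\<And>y. v y = v (S \<inter> y)"
    by auto
  define w where "w = app (raising S) v"
  have "app (layer S k) v = v" using v(3) by (auto simp: layer_def fun_eq_iff)
  then have "app (lowering S) w = app (lowering S * raising S * layer S k) v"
    by (simp add: w_def)
  also have "\<dots> = (\<lambda>y. (cval (card S) r - cval (card S) (Suc k)) * v y)"
    unfolding lowering_raising_layer[OF S]
    using \<open>app (layer S k) v = v\<close> v(2) by (simp add: algebra_simps)
  finally have lw: "app (lowering S) w = (\<lambda>y. (cval (card S) r - cval (card S) (Suc k)) * v y)" .
  have "cval (card S) r \<noteq> cval (card S) (Suc k)"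
    using step by (simp add: cval_eq_iff)
  then have "w \<noteq> (\<lambda>_. 0)" using lw v(1) by (force simp: fun_eq_iff)
  moreover have "app (casimir S) w = (\<lambda>y. cval (card S) r * w y)"
  proof -
    have "app (casimir S) w = app (raising S * casimir S) v"
      by (simp only: w_def casimir_raising[OF S, symmetric] times_lop.rep_eq)
    then show ?thesis by (simp add: v(2) app_scale w_def)
  qed
  moreover have "\<forall>y. w y \<noteq> 0 \<longrightarrow> card (S \<inter> y) = Suc k"
  proof (intro allI impI)
    fix y assume "w y \<noteq> 0"
    then obtain a where "a \<in> S \<inter> y" "v (y - {a}) \<noteq> 0"
      unfolding w_def raising.rep_eq by (meson sum.not_neutral_contains_not_neutral)
    then show "card (S \<inter> y) = Suc k"
      using v(3) card_Int_Diff1[OF S] by fastforce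
  qed
  moreover have "w y = w (S \<inter> y)" for y
  proof -
    have "v (y - {a}) = v (S \<inter> y - {a})" for a
      using v(4)[of "y - {a}"] v(4)[of "S \<inter> y - {a}"] by (simp add: Int_Diff)
    then show ?thesis by (simp add: w_def raising.rep_eq)
  qed
  ultimately show ?case by blast
qed

section \<open>Primitive idempotents of the Johnson scheme\<close>

text \<open>
  The basis vector of \<open>z\<close>.
\<close>

definition delta :: "'a \<Rightarrow> 'a \<Rightarrow> complex" where
  "delta z = (\<lambda>y. if y = z then 1 else 0)"

lemma svec_delta_sum:
  assumes "finite I" "u \<in> svec_carrier I"
  shows "u = (\<lambda>y. \<Sum>z\<in>I. u z * delta z y)"
proof
  fix y
  show "u y = (\<Sum>z\<in>I. u z * delta z y)"
    using assms by (cases "y \<in> I") (auto simp: delta_def svec_carrier_def if_distrib cong: if_cong)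
qed

lemma smat_apply_delta:
  assumes "finite I" "z \<in> I"
  shows "smat_apply I P (delta z) = (\<lambda>y. P y z)"
  using assms by (simp add: smat_apply_def delta_def if_distrib cong: if_cong)

lemma svec_inner_self_eq_0:
  assumes "finite I" "u \<in> svec_carrier I" "svec_inner I u u = 0"
  shows "u = (\<lambda>_. 0)"
proof -
  have "svec_inner I u u = of_real (\<Sum>y\<in>I. (cmod (u y))\<^sup>2)"
    by (simp add: svec_inner_def complex_norm_square del: of_real_power)
  then have "(\<Sum>y\<in>I. (cmod (u y))\<^sup>2) = 0" using assms(3) by (metis of_real_eq_0_iff)
  then have "\<forall>y\<in>I. u y = 0" using assms(1) by (simp add: sum_nonneg_eq_0_iff)
  then show ?thesis using assms(2) by (auto simp: svec_carrier_def)
qed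

lemma svec_inner_diff: "svec_inner I (\<lambda>y. u y - v y) w = svec_inner I u w - svec_inner I v w"
  by (simp add: svec_inner_def left_diff_distrib sum_subtractf)

lemma svec_inner_sum: "svec_inner I (\<lambda>y. \<Sum>q\<in>Q. u q y) w = (\<Sum>q\<in>Q. svec_inner I (u q) w)"
  unfolding svec_inner_def sum_distrib_right by (rule sum.swap)

lemma eigenspace_diff:
  assumes "u \<in> eigenspace I A \<theta>" "w \<in> eigenspace I A \<theta>"
  shows "(\<lambda>y. u y - w y) \<in> eigenspace I A \<theta>"
proof -
  have "smat_apply I A (\<lambda>y. u y - w y) y = smat_apply I A u y - smat_apply I A w y" for y
    by (simp add: smat_apply_def right_diff_distrib sum_subtractf)
  then show ?thesis
    using assms unfolding eigenspace_def svec_carrier_def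
    by (auto simp: fun_eq_iff right_diff_distrib) (metis diff_self)
qed

lemma is_orthogonal_projection_column:
  assumes "finite I" "is_orthogonal_projection I W P" "z \<in> I"
  shows "(\<lambda>y. P y z) \<in> W"
    and "w \<in> W \<Longrightarrow> svec_inner I (\<lambda>y. delta z y - P y z) w = 0"
proof -
  have "delta z \<in> svec_carrier I" using assms(3) by (simp add: delta_def svec_carrier_def)
  then have "smat_apply I P (delta z) \<in> W
      \<and> (\<forall>w\<in>W. svec_inner I (\<lambda>y. delta z y - smat_apply I P (delta z) y) w = 0)"
    using assms(2) unfolding is_orthogonal_projection_def by blast
  then show "(\<lambda>y. P y z) \<in> W"
    and "w \<in> W \<Longrightarrow> svec_inner I (\<lambda>y. delta z y - P y z) w = 0"
    by (simp_all add: smat_apply_delta[OF assms(1,3)])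
qed

lemma is_orthogonal_projection_outside:
  assumes "is_orthogonal_projection I W P" "y \<notin> I \<or> z \<notin> I"
  shows "P y z = 0"
proof -
  have "P \<in> smat_carrier I" using assms(1) by (simp only: is_orthogonal_projection_def)
  then show ?thesis using assms(2) by (auto simp: smat_carrier_def)
qed

lemma orthogonal_projection_eq:
  assumes I: "finite I" and P: "is_orthogonal_projection I (eigenspace I A \<theta>) P"
  shows "orthogonal_projection I (eigenspace I A \<theta>) = P"
  unfolding orthogonal_projection_def
proof (rule the_equality)
  fix P' assume P': "is_orthogonal_projection I (eigenspace I A \<theta>) P'"
  have "P' y z = P y z" for y z
  proof (cases "z \<in> I")
    case True
    define w where "w = (\<lambda>y. P' y z - P y z)"
    note col = is_orthogonal_projection_column[OF I _ True]
    have w: "w \<in> eigenspace I A \<theta>"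
      unfolding w_def by (intro eigenspace_diff col(1) P P')
    have "svec_inner I (\<lambda>y. delta z y - P y z) w = 0" "svec_inner I (\<lambda>y. delta z y - P' y z) w = 0"
      using col(2) P P' w by blast+
    then have "svec_inner I w w = 0" unfolding w_def by (simp add: svec_inner_diff)
    moreover have "w \<in> svec_carrier I" using w by (simp add: eigenspace_def)
    ultimately have "w = (\<lambda>_. 0)" by (intro svec_inner_self_eq_0[OF I])
    then show ?thesis by (simp add: w_def fun_eq_iff)
  next
    case False
    then show ?thesis
      using P P' by (simp add: is_orthogonal_projection_outside)
  qed
  then show "P' = P" by blast
qed (rule P)

text \<open>
  An orthogonal projection has nonnegative diagonal entries, and a zero column where the diagonal
  entry vanishes.
\<close>

lemma orthogonal_projection_diagonal:
  assumes I: "finite I" and P: "is_orthogonal_projection I W P" and a: "a \<in> I"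
  shows "P a a = of_real (\<Sum>y\<in>I. (cmod (P y a))\<^sup>2)"
proof -
  have "svec_inner I (\<lambda>y. delta a y - P y a) (\<lambda>y. P y a) = 0"
    using is_orthogonal_projection_column[OF I P a] by blast
  moreover have "svec_inner I (delta a) (\<lambda>y. P y a) = cnj (P a a)"
    using I a by (simp add: svec_inner_def delta_def if_distrib if_distribR cong: if_cong)
  ultimately have "cnj (P a a) = of_real (\<Sum>y\<in>I. (cmod (P y a))\<^sup>2)"
    by (simp only: svec_inner_diff) (simp add: svec_inner_def complex_norm_square del: of_real_power)
  then show ?thesis by (metis complex_cnj_cnj complex_cnj_complex_of_real)
qed

lemma eigenspace_orthogonal:
  assumes I: "finite I" and A: "\<And>y z. A z y = cnj (A y z)"
    and u: "u \<in> eigenspace I A \<theta>" and w: "w \<in> eigenspace I A \<eta>" and "\<theta> \<noteq> cnj \<eta>"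
  shows "svec_inner I u w = 0"
proof -
  have "\<theta> * svec_inner I u w = svec_inner I (smat_apply I A u) w"
    using u by (simp add: eigenspace_def svec_inner_def sum_distrib_left mult.assoc)
  also have "\<dots> = svec_inner I u (smat_apply I A w)"
  proof -
    have "svec_inner I (smat_apply I A u) w = (\<Sum>y\<in>I. \<Sum>z\<in>I. A y z * u z * cnj (w y))"
      by (simp add: svec_inner_def smat_apply_def sum_distrib_right)
    also have "\<dots> = (\<Sum>z\<in>I. \<Sum>y\<in>I. A y z * u z * cnj (w y))" by (rule sum.swap)
    also have "\<dots> = svec_inner I u (smat_apply I A w)"
      unfolding svec_inner_def smat_apply_def cnj_sum sum_distrib_left
      by (intro sum.cong) (simp_all add: A[symmetric] algebra_simps)
    finally show ?thesis .
  qed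
  also have "\<dots> = cnj \<eta> * svec_inner I u w"
    using w by (simp add: eigenspace_def svec_inner_def sum_distrib_left algebra_simps)
  finally show ?thesis using \<open>\<theta> \<noteq> cnj \<eta>\<close> by simp
qed

lemma sum_adjacent:
  assumes S: "finite S" and y: "y \<in> nsets S k"
  shows "(\<Sum>z\<in>nsets S k. (if card (y \<inter> z) + 1 = k then 1 else 0) * u z)
    = (\<Sum>a\<in>S \<inter> y. \<Sum>b\<in>S - y. u (insert b (y - {a})) :: complex)"
proof -
  have yS: "y \<subseteq> S" "finite y" "card y = k" using y by (auto simp: nsets_def)
  let ?g = "\<lambda>(a, b). insert b (y - {a})"
  let ?Z = "{z \<in> nsets S k. card (y \<inter> z) + 1 = k}"
  have "inj_on ?g (y \<times> (S - y))"
  proof (rule inj_onI, clarsimp)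
    fix a b a' b'
    assume "a \<in> y" "a' \<in> y" "b \<notin> y" "b' \<notin> y" and e: "insert b (y - {a}) = insert b' (y - {a'})"
    then have "{a} = y - insert b (y - {a})" "{a'} = y - insert b (y - {a})"
      "{b} = insert b (y - {a}) - y" "{b'} = insert b (y - {a}) - y" by auto
    then show "a = a' \<and> b = b'" by (metis singleton_inject)
  qed
  moreover have "?g ` (y \<times> (S - y)) = ?Z"
  proof (intro equalityI subsetI)
    fix z assume "z \<in> ?g ` (y \<times> (S - y))"
    then obtain a b where z: "a \<in> y" "b \<in> S" "b \<notin> y" "z = insert b (y - {a})" by auto
    then have "y \<inter> z = y - {a}" by auto
    moreover have "card (y - {a}) + 1 = k"
      using z yS by (metis Suc_eq_plus1 card_Suc_Diff1)
    ultimately show "z \<in> ?Z" using z yS by (auto simp: nsets_def)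
  next
    fix z assume z: "z \<in> ?Z"
    then have z': "z \<subseteq> S" "finite z" "card z = k" "card (y \<inter> z) + 1 = k" by (auto simp: nsets_def)
    have "card (y - z) = 1" "card (z - y) = 1"
      using z' yS card_Diff_subset_Int[of y z] card_Diff_subset_Int[of z y]
      by (auto simp: Int_commute)
    then obtain a b where ab: "y - z = {a}" "z - y = {b}" by (meson card_1_singletonE)
    then have "z = ?g (a, b)" "a \<in> y" "b \<in> S - y" using z' by auto
    then show "z \<in> ?g ` (y \<times> (S - y))" by blast
  qed
  ultimately have "(\<Sum>z\<in>?Z. u z) = (\<Sum>p\<in>y \<times> (S - y). u (?g p))"
    using sum.reindex[of ?g "y \<times> (S - y)" u] by (simp add: o_def)
  also have "\<dots> = (\<Sum>a\<in>y. \<Sum>b\<in>S - y. u (insert b (y - {a})))"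
    by (simp add: sum.cartesian_product case_prod_unfold)
  also have "(\<Sum>z\<in>?Z. u z) = (\<Sum>z\<in>nsets S k. (if card (y \<inter> z) + 1 = k then 1 else 0) * u z)"
    using S by (intro sum.mono_neutral_cong_left) (auto simp: finite_imp_finite_nsets)
  finally show ?thesis using yS(1) by (simp add: Int_absorb1)
qed

lemma casimir_app:
  assumes S: "finite S"
  shows "app (casimir S) u y = (\<Sum>a\<in>S \<inter> y. \<Sum>b\<in>S - y. u (insert b (y - {a})))
    - of_nat (card (S \<inter> y)) * (of_nat (card S) - of_nat (card (S \<inter> y))) * u y"
  by (simp add: casimir_def num_def app_raising_lowering[OF S]) (simp add: algebra_simps)

text \<open>
  The projection onto the functions supported on the \<open>k\<close>-subsets of \<open>S\<close>; unlike \<open>layer S k\<close>, it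
  also excludes the sets with points outside \<open>S\<close>.
\<close>

definition level :: "'a set \<Rightarrow> nat \<Rightarrow> 'a set lop" where
  "level S k = diag (\<lambda>y. if y \<in> nsets S k then 1 else 0)"

lemma casimir_level:
  assumes "finite S"
  shows "casimir S * level S k = level S k * casimir S"
proof -
  let ?D = "diag (\<lambda>y. if y \<subseteq> S then 1 else 0)"
  have l: "level S k = layer S k * ?D"
    by (rule lop_eqI) (use finite_subset[OF _ assms] in \<open>auto simp: level_def layer_def nsets_def Int_absorb1\<close>)
  have "casimir S * ?D = ?D * casimir S"
    by (rule casimir_diag) auto
  then show ?thesis
    unfolding l by (metis casimir_layer[OF assms] mult.assoc)
qed

lemma app_level_id:
  "app (level S k) u = u \<longleftrightarrow> u \<in> svec_carrier (nsets S k)"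
  by (auto simp: level_def svec_carrier_def fun_eq_iff)

lemma smat_apply_johnson_adj:
  assumes u: "u \<in> svec_carrier (nsets {1..v} k)"
  shows "smat_apply (nsets {1..v} k) (johnson_adj v k) u
    = (\<lambda>y. app (casimir {1..v}) u y + of_nat k * (of_nat v - of_nat k) * u y)"
proof
  fix y
  let ?S = "{1..v}"
  let ?I = "nsets ?S k"
  show "smat_apply ?I (johnson_adj v k) u y
    = app (casimir ?S) u y + of_nat k * (of_nat v - of_nat k) * u y"
  proof (cases "y \<in> ?I")
    case True
    then have "?S \<inter> y = y" "card y = k" by (auto simp: nsets_def)
    moreover have "smat_apply ?I (johnson_adj v k) u y
        = (\<Sum>z\<in>?I. (if card (y \<inter> z) + 1 = k then 1 else 0) * u z)"
      unfolding smat_apply_def johnson_adj_def using True by (intro sum.cong) auto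
    ultimately show ?thesis
      using sum_adjacent[OF _ True, of u] by (simp add: casimir_app)
  next
    case False
    have "app (casimir ?S) u y = app (level ?S k * casimir ?S) u y"
      using u by (metis app_level_id casimir_level finite_atLeastAtMost times_lop.rep_eq)
    also have "\<dots> = 0" using False by (simp add: level_def)
    finally show ?thesis
      using False u by (auto simp: smat_apply_def johnson_adj_def svec_carrier_def)
  qed
qed

lemma mem_johnson_eigenspace_iff:
  "u \<in> eigenspace (nsets {1..v} k) (johnson_adj v k) (johnson_eigenvalue v k j) \<longleftrightarrow>
    u \<in> svec_carrier (nsets {1..v} k) \<and> app (casimir {1..v}) u = (\<lambda>y. cval v j * u y)"
proof (cases "u \<in> svec_carrier (nsets {1..v} k)")
  case True
  have "johnson_eigenvalue v k j = cval v j + of_nat k * (of_nat v - of_nat k)"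
    by (simp add: johnson_eigenvalue_def cval_def algebra_simps)
  then show ?thesis
    using True smat_apply_johnson_adj[OF True] by (simp add: eigenspace_def fun_eq_iff distrib_right)
qed (simp add: eigenspace_def)

text \<open>
  The compression of \<open>isotypic {1..v} j\<close> to the \<open>k\<close>-subsets is the orthogonal projection: the other
  isotypic components are eigenspaces of the real symmetric adjacency matrix for other real
  eigenvalues, hence orthogonal.
\<close>

lemma johnson_E_is_orthogonal_projection:
  assumes j: "j \<le> min k (v - k)"
  shows "is_orthogonal_projection (nsets {1..v} k)
    (eigenspace (nsets {1..v} k) (johnson_adj v k) (johnson_eigenvalue v k j)) (johnson_E v k j)"
proof -
  let ?S = "{1..v}"
  let ?I = "nsets ?S k"
  let ?W = "\<lambda>q. eigenspace ?I (johnson_adj v k) (johnson_eigenvalue v k q)"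
  have I: "finite ?I" by (simp add: finite_imp_finite_nsets)
  have jv: "j \<le> v div 2" using j by linarith
  define P where "P a b = (if a \<in> ?I \<and> b \<in> ?I then app (isotypic ?S j) (delta b) a else 0)" for a b
  have car: "app (isotypic ?S q) u \<in> svec_carrier ?I" if "u \<in> svec_carrier ?I" for q u
  proof -
    have "isotypic ?S q * level ?S k = level ?S k * isotypic ?S q"
      unfolding isotypic_def by (intro ev_commute casimir_level) simp
    then show ?thesis using that by (metis app_level_id times_lop.rep_eq)
  qed
  have eig: "app (isotypic ?S q) u \<in> ?W q" if "u \<in> svec_carrier ?I" "q \<le> v div 2" for q u
  proof -
    have "app (casimir ?S * isotypic ?S q) u = app (sc (cval v q) * isotypic ?S q) u"
      using casimir_isotypic[of ?S q] that(2) by simp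
    then show ?thesis unfolding mem_johnson_eigenspace_iff using car[OF that(1)] by simp
  qed
  have app_P: "smat_apply ?I P u = app (isotypic ?S j) u" if u: "u \<in> svec_carrier ?I" for u
  proof
    fix y
    show "smat_apply ?I P u y = app (isotypic ?S j) u y"
    proof (cases "y \<in> ?I")
      case True
      have "app (isotypic ?S j) u y = (\<Sum>z\<in>?I. u z * app (isotypic ?S j) (delta z) y)"
        by (subst svec_delta_sum[OF I u]) (simp add: app_sum app_scale)
      then show ?thesis using True by (simp add: smat_apply_def P_def mult.commute)
    next
      case False
      then show ?thesis
        using car[OF u, of j] unfolding smat_apply_def P_def svec_carrier_def by auto
    qed
  qed
  have "is_orthogonal_projection ?I (?W j) P"
    unfolding is_orthogonal_projection_def
  proof (intro conjI ballI)
    show "P \<in> smat_carrier ?I" by (simp add: smat_carrier_def P_def)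
  next
    fix u assume u: "u \<in> svec_carrier ?I"
    show "smat_apply ?I P u \<in> ?W j" using app_P[OF u] eig[OF u jv] by simp
    fix w assume w: "w \<in> ?W j"
    have "app (\<Sum>q\<le>v div 2. isotypic ?S q) u = u"
      using sum_isotypic[of ?S] by simp
    then have "u y - smat_apply ?I P u y = (\<Sum>q\<in>{..v div 2} - {j}. app (isotypic ?S q) u y)" for y
      unfolding app_P[OF u] using jv
      by (simp add: fun_eq_iff app_sum_left sum.remove[of "{..v div 2}" j] algebra_simps)
    moreover have "svec_inner ?I (app (isotypic ?S q) u) w = 0" if q: "q \<in> {..v div 2} - {j}" for q
    proof (rule eigenspace_orthogonal[OF I _ eig[OF u] w])
      show "johnson_adj v k z y = cnj (johnson_adj v k y z)" for y z
        by (simp add: johnson_adj_def Int_commute)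
      have "cval v q \<noteq> cval v j" using q jv by (auto simp: cval_eq_iff)
      then show "johnson_eigenvalue v k q \<noteq> cnj (johnson_eigenvalue v k j)"
        by (simp add: johnson_eigenvalue_def cval_def algebra_simps)
    qed (use q in simp)
    ultimately show "svec_inner ?I (\<lambda>y. u y - smat_apply ?I P u y) w = 0"
      by (simp add: svec_inner_sum)
  qed
  then show ?thesis
    using j by (simp only: johnson_E_def orthogonal_projection_eq[OF I] if_True)
qed

lemma johnson_E_outside:
  "y \<notin> nsets {1..v} k \<or> z \<notin> nsets {1..v} k \<Longrightarrow> johnson_E v k j y z = 0"
  using is_orthogonal_projection_outside[OF johnson_E_is_orthogonal_projection]
  by (cases "j \<le> min k (v - k)") (blast, simp add: johnson_E_def)

lemma johnson_E_diagonal: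
  "0 \<le> Re (johnson_E v k j a a)" "Im (johnson_E v k j a a) = 0"
proof -
  have "0 \<le> Re (johnson_E v k j a a) \<and> Im (johnson_E v k j a a) = 0"
  proof (cases "j \<le> min k (v - k) \<and> a \<in> nsets {1..v} k")
    case True
    have "johnson_E v k j a a = of_real (\<Sum>y\<in>nsets {1..v} k. (cmod (johnson_E v k j y a))\<^sup>2)"
      using True by (intro orthogonal_projection_diagonal[OF _ johnson_E_is_orthogonal_projection])
        (auto simp: finite_imp_finite_nsets)
    then show ?thesis by (metis Re_complex_of_real Im_complex_of_real sum_nonneg zero_le_power2)
  next
    case False
    then have "johnson_E v k j a a = 0"
      using johnson_E_outside[of a v k a j] by (auto simp: johnson_E_def)
    then show ?thesis by simp
  qed
  then show "0 \<le> Re (johnson_E v k j a a)" "Im (johnson_E v k j a a) = 0" by auto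
qed

lemma johnson_E_diagonal_pos:
  assumes j: "j \<le> min k (v - k)" and "k \<le> v"
  shows "\<exists>a. 0 < Re (johnson_E v k j a a)"
proof (rule ccontr)
  let ?S = "{1..v}"
  let ?I = "nsets ?S k" and ?E = "johnson_E v k j"
  let ?W = "eigenspace ?I (johnson_adj v k) (johnson_eigenvalue v k j)"
  have I: "finite ?I" by (simp add: finite_imp_finite_nsets)
  note P = johnson_E_is_orthogonal_projection[OF j]
  assume "\<not> (\<exists>a. 0 < Re (?E a a))"
  then have "Re (?E a a) = 0" for a
    using johnson_E_diagonal(1)[of v k j a] by (metis less_eq_real_def)
  then have "\<forall>a\<in>?I. (\<Sum>y\<in>?I. (cmod (?E y a))\<^sup>2) = 0"
    using orthogonal_projection_diagonal[OF I P] by (metis Re_complex_of_real)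
  then have "\<forall>y\<in>?I. \<forall>a\<in>?I. ?E y a = 0"
    by (simp add: sum_nonneg_eq_0_iff[OF I] del: One_nat_def)
  then have "?E y a = 0" for y a
    using johnson_E_outside[of y v k a j] by blast
  then have E: "smat_apply ?I ?E u = (\<lambda>_. 0)" for u
    by (simp add: smat_apply_def)
  obtain w where w: "w \<noteq> (\<lambda>_. 0)" "app (casimir ?S) w = (\<lambda>y. cval v j * w y)"
    "\<And>y. w y \<noteq> 0 \<Longrightarrow> card (?S \<inter> y) = k" "\<And>y. w y = w (?S \<inter> y)"
  proof -
    have "k + j \<le> card ?S" using j \<open>k \<le> v\<close> by (simp add: le_diff_conv2 add.commute)
    then show thesis using casimir_eigenvector_exists[of ?S j k] j that
      by (simp del: One_nat_def) blast
  qed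
  define u where "u = app (level ?S k) w"
  have u: "u \<in> svec_carrier ?I" by (auto simp: u_def level_def svec_carrier_def)
  have "app (casimir ?S) u = app (level ?S k * casimir ?S) w"
    unfolding u_def by (simp add: casimir_level [symmetric] del: times_lop.rep_eq) (simp add: times_lop.rep_eq)
  then have "u \<in> ?W"
    unfolding mem_johnson_eigenspace_iff using u w(2) by (simp add: app_scale u_def)
  then have "svec_inner ?I (\<lambda>y. u y - smat_apply ?I ?E u y) u = 0"
    using P u by (simp add: is_orthogonal_projection_def)
  then have "u = (\<lambda>_. 0)"
    using svec_inner_self_eq_0[OF I u] by (simp add: E del: One_nat_def)
  moreover obtain y where "w y \<noteq> 0" using w(1) by auto
  then have "w (?S \<inter> y) \<noteq> 0" "?S \<inter> y \<in> ?I" using w(3,4) by (auto simp: nsets_def)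
  then have "u (?S \<inter> y) \<noteq> 0" by (simp add: u_def level_def)
  ultimately show False by simp
qed

text \<open>
  The sum of the two tensor products is nonzero as soon as one of them is, because both have
  nonnegative diagonals.  For \<open>r \<le> s\<close> this happens exactly for \<open>s \<le> i \<le> d - s\<close>.
\<close>

lemma d_num_eq:
  assumes "r \<le> s" "s \<le> d div 2"
  shows "d_num d r s = int d - 2 * int s"
proof -
  let ?T = "\<lambda>i p q. smat_tensor (johnson_E d (d - i) r) (johnson_E d i s) p q
            + smat_tensor (johnson_E d (d - i) s) (johnson_E d i r) p q"
  have "?T i \<noteq> (\<lambda>p q. 0) \<longleftrightarrow> s \<le> i \<and> i \<le> d - s" if i: "i \<le> d" for i
  proof
    assume "s \<le> i \<and> i \<le> d - s"
    then have le: "s \<le> i" "i \<le> d - s" "r \<le> min (d - i) (d - (d - i))" "s \<le> min i (d - i)"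
      using assms i by auto
    obtain a b where ab: "0 < Re (johnson_E d (d - i) r a a)" "0 < Re (johnson_E d i s b b)"
      using johnson_E_diagonal_pos[OF le(3)] johnson_E_diagonal_pos[OF le(4) i] by auto
    have "0 < Re (?T i (a, b) (a, b))"
      using mult_pos_pos[OF ab]
        mult_nonneg_nonneg[OF johnson_E_diagonal(1)[of d "d - i" s a] johnson_E_diagonal(1)[of d i r b]]
      by (simp add: smat_tensor_def johnson_E_diagonal(2))
    then show "?T i \<noteq> (\<lambda>p q. 0)" by (metis less_irrefl zero_complex.simps(1))
  next
    assume T: "?T i \<noteq> (\<lambda>p q. 0)"
    show "s \<le> i \<and> i \<le> d - s"
    proof (rule ccontr)
      assume "\<not> (s \<le> i \<and> i \<le> d - s)"
      then have "johnson_E d i s = (\<lambda>_ _. 0)" "johnson_E d (d - i) s = (\<lambda>_ _. 0)"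
        using i by (auto simp: johnson_E_def)
      then show False using T by (auto simp: smat_tensor_def fun_eq_iff split: prod.splits)
    qed
  qed
  then have "i \<in> {i \<in> {0..d}. ?T i \<noteq> (\<lambda>p q. 0)} \<longleftrightarrow> i \<in> {s..d - s}" for i
    by (cases "i \<le> d") auto
  then have "{i \<in> {0..d}. ?T i \<noteq> (\<lambda>p q. 0)} = {s..d - s}" by blast
  then show ?thesis using assms by (simp add: d_num_def)
qed

section \<open>The Casimir operators of the two halves\<close>

lemma commute_mult:
  fixes F :: "'a :: ring_1"
  assumes "F * G = G * F" "F * H = H * F"
  shows "F * (G * H) = G * H * F"
  using assms by (metis mult.assoc)

lemma commute_power:
  fixes F :: "'a :: ring_1"
  assumes "F * G = G * F"
  shows "F * G ^ k = G ^ k * F"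
  using assms by (induction k) (simp_all add: commute_mult)

lemma raising_Un: "finite S \<Longrightarrow> finite T \<Longrightarrow> S \<inter> T = {} \<Longrightarrow>
    raising (S \<union> T) = raising S + raising T"
  by (rule lop_eqI) (simp add: raising.rep_eq Int_Un_distrib2, subst sum.union_disjoint, auto)

lemma lowering_Un: "finite S \<Longrightarrow> finite T \<Longrightarrow> S \<inter> T = {} \<Longrightarrow>
    lowering (S \<union> T) = lowering S + lowering T"
  by (rule lop_eqI) (simp add: lowering.rep_eq Un_Diff, subst sum.union_disjoint, auto)

lemma raising_raising_commute:
  assumes "S \<inter> T = {}"
  shows "raising S * raising T = raising T * raising S"
proof (rule lop_eqI)
  fix u y
  have "T \<inter> (y - {a}) = T \<inter> y" if "a \<in> S" for a using that assms by auto
  moreover have "S \<inter> (y - {a}) = S \<inter> y" if "a \<in> T" for a using that assms by auto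
  moreover have "y - {a} - {b} = y - {b} - {a}" for a b by auto
  ultimately show "app (raising S * raising T) u y = app (raising T * raising S) u y"
    by (simp add: raising.rep_eq sum.swap[of _ "S \<inter> y"])
qed

lemma lowering_lowering_commute:
  assumes "S \<inter> T = {}"
  shows "lowering S * lowering T = lowering T * lowering S"
proof (rule lop_eqI)
  fix u y
  have "T - insert a y = T - y" if "a \<in> S" for a using that assms by auto
  moreover have "S - insert a y = S - y" if "a \<in> T" for a using that assms by auto
  ultimately show "app (lowering S * lowering T) u y = app (lowering T * lowering S) u y"
    by (simp add: lowering.rep_eq sum.swap[of _ "S - y"] insert_commute)
qed

lemma raising_lowering_commute:
  assumes "S \<inter> T = {}"
  shows "raising S * lowering T = lowering T * raising S"
proof (rule lop_eqI)
  fix u y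
  have "T - (y - {a}) = T - y" if "a \<in> S" for a using that assms by auto
  moreover have "S \<inter> insert b y = S \<inter> y" if "b \<in> T" for b using that assms by auto
  moreover have "insert b (y - {a}) = insert b y - {a}" if "a \<in> S" "b \<in> T" for a b
    using that assms by auto
  ultimately show "app (raising S * lowering T) u y = app (lowering T * raising S) u y"
    by (simp add: lowering.rep_eq raising.rep_eq sum.swap[of _ "S \<inter> y"])
qed

lemma num_commute:
  assumes "S \<inter> T = {}"
  shows "raising S * num T = num T * raising S" "lowering S * num T = num T * lowering S"
proof -
  have "T \<inter> (y - {a}) = T \<inter> y" "T \<inter> insert a y = T \<inter> y" if "a \<in> S" for a y using that assms by auto
  then show "raising S * num T = num T * raising S" "lowering S * num T = num T * lowering S"
    unfolding num_def by (auto intro!: raising_diag lowering_diag)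
qed

lemma commute_casimir:
  assumes "F * raising T = raising T * F" "F * lowering T = lowering T * F" "F * num T = num T * F"
  shows "F * casimir T = casimir T * F"
proof -
  have "F * (sc c + 1 - num T) = (sc c + 1 - num T) * F" for c
    using assms(3) by (simp add: distrib_left distrib_right left_diff_distrib right_diff_distrib sc_commute)
  then show ?thesis
    by (simp only: casimir_def left_diff_distrib[of _ _ F] right_diff_distrib[of F] commute_mult assms)
qed

text \<open>
  Real and imaginary part of \<open>(\<i> + a) (\<i> + b)\<close> give \<open>a b\<close> and \<open>a + b\<close>, hence the unordered pair.
\<close>

lemma theta_eq_imp:
  fixes a b a' b' :: complex
  assumes "Im a = 0" "Im b = 0" "Im a' = 0" "Im b' = 0"
    and eq: "(\<i> + a) * (\<i> + b) = (\<i> + a') * (\<i> + b')"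
  shows "a = a' \<and> b = b' \<or> a = b' \<and> b = a'"
proof -
  have p: "Re a * Re b = Re a' * Re b'" and s: "Re a + Re b = Re a' + Re b'"
    using eq assms(1-4) by (auto simp: complex_eq_iff)
  have b: "Re b = Re a' + Re b' - Re a" using s by simp
  have "(Re a - Re a') * (Re a - Re b') = 0"
    using p unfolding b by (simp add: algebra_simps)
  then have "Re a = Re a' \<or> Re a = Re b'" by simp
  then show ?thesis using s assms(1-4) by (auto simp: complex_eq_iff)
qed

lemma Im_cval [simp]: "Im (cval n r) = 0"
  by (simp add: cval_def)

text \<open>
  The vertices are the \<open>d\<close>-subsets \<open>y\<close> of \<open>S = {1..2d}\<close>, seen through the two halves \<open>x \<inter> y\<close>
  and \<open>xc \<inter> y\<close>, where \<open>xc\<close> is the complement of the base vertex \<open>x\<close>.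
\<close>

locale terwilliger =
  fixes d :: nat and x :: "nat set"
  assumes d_pos: "d > 0" and x: "x \<in> johnson_X d"
begin

abbreviation S :: "nat set" where "S \<equiv> {1..2 * d}"

definition xc :: "nat set" where "xc = S - x"

abbreviation "m \<equiv> d div 2"

lemma x_props: "finite x" "finite xc" "card x = d" "card xc = d" "x \<inter> xc = {}" "xc \<inter> x = {}"
  "x \<subseteq> S" "xc \<subseteq> S" "S = x \<union> xc"
proof -
  have *: "finite x" "x \<subseteq> S" "card x = d" using x by (auto simp: johnson_X_def nsets_def)
  then show "finite x" "finite xc" "card x = d" "card xc = d" "x \<inter> xc = {}" "xc \<inter> x = {}"
    "x \<subseteq> S" "xc \<subseteq> S" "S = x \<union> xc"
    by (auto simp: xc_def card_Diff_subset simp del: One_nat_def)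
qed

text \<open>
  \<open>R\<close> and \<open>L\<close> exchange a point of \<open>x\<close> for one of \<open>xc\<close> and conversely.  On the vertices, \<open>A\<close> is the
  adjacency operator of the Johnson graph.
\<close>

definition R :: "nat set lop" where "R = lowering x * raising xc"
definition L :: "nat set lop" where "L = raising x * lowering xc"
definition A :: "nat set lop" where "A = raising S * lowering S - sc (of_nat d)"

text \<open>
  The projection onto the vertices at distance \<open>i\<close> from \<open>x\<close>, that is the dual idempotent
  \<open>E\<^sub>i\<^sup>*\<close>.  The first cardinality is stated additively, so that \<open>p i = 0\<close> for \<open>i > d\<close>.
\<close>

definition p :: "nat \<Rightarrow> nat set lop" where
  "p i = diag (\<lambda>y. if y \<subseteq> S \<and> card (x \<inter> y) + i = d \<and> card (xc \<inter> y) = i then 1 else 0)"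

lemma p_eq_0: "i > d \<Longrightarrow> p i = 0"
  by (rule lop_eqI) (auto simp: p_def)

lemma p_mult: "p i * p j = (if i = j then p i else 0)"
  by (rule lop_eqI) (auto simp: p_def)

lemma p_layers: "i \<le> d \<Longrightarrow> layer x (d - i) * p i = p i" "layer xc i * p i = p i"
  by (rule lop_eqI; auto simp: p_def layer_def)+

lemma R_p: "R * p i = p (Suc i) * R"
proof -
  define D where "D = diag (\<lambda>y. if y \<subseteq> S \<and> card (x \<inter> y) + i = d \<and> card (xc \<inter> y) = Suc i then 1 else 0)"
  have "raising xc * p i = D * raising xc"
    unfolding p_def D_def
  proof (rule raising_diag)
    fix y a assume a: "a \<in> xc" "a \<in> y"
    then have "x \<inter> (y - {a}) = x \<inter> y" "y - {a} \<subseteq> S \<longleftrightarrow> y \<subseteq> S" using x_props by auto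
    then show "(if y - {a} \<subseteq> S \<and> card (x \<inter> (y - {a})) + i = d \<and> card (xc \<inter> (y - {a})) = i
        then 1 else 0) = (if y \<subseteq> S \<and> card (x \<inter> y) + i = d \<and> card (xc \<inter> y) = Suc i then 1 else 0)"
      using card_Int_Diff1[OF x_props(2) a] by simp
  qed
  moreover have "lowering x * D = p (Suc i) * lowering x"
    unfolding p_def D_def
  proof (rule lowering_diag)
    fix y a assume a: "a \<in> x" "a \<notin> y"
    then have "xc \<inter> insert a y = xc \<inter> y" "insert a y \<subseteq> S \<longleftrightarrow> y \<subseteq> S" using x_props by auto
    then show "(if insert a y \<subseteq> S \<and> card (x \<inter> insert a y) + i = d \<and> card (xc \<inter> insert a y) = Suc i
        then 1 else 0) = (if y \<subseteq> S \<and> card (x \<inter> y) + Suc i = d \<and> card (xc \<inter> y) = Suc i then 1 else 0)"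
      using card_Int_insert1[OF x_props(1) a] by simp
  qed
  ultimately show ?thesis unfolding R_def by (metis mult.assoc)
qed

lemma L_p: "L * p (Suc i) = p i * L"
proof -
  define D where "D = diag (\<lambda>y. if y \<subseteq> S \<and> card (x \<inter> y) + Suc i = d \<and> card (xc \<inter> y) = i then 1 else 0)"
  have "lowering xc * p (Suc i) = D * lowering xc"
    unfolding p_def D_def
  proof (rule lowering_diag)
    fix y a assume a: "a \<in> xc" "a \<notin> y"
    then have "x \<inter> insert a y = x \<inter> y" "insert a y \<subseteq> S \<longleftrightarrow> y \<subseteq> S" using x_props by auto
    then show "(if insert a y \<subseteq> S \<and> card (x \<inter> insert a y) + Suc i = d \<and> card (xc \<inter> insert a y) = Suc i
        then 1 else 0) = (if y \<subseteq> S \<and> card (x \<inter> y) + Suc i = d \<and> card (xc \<inter> y) = i then 1 else 0)"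
      using card_Int_insert1[OF x_props(2) a] by simp
  qed
  moreover have "raising x * D = p i * raising x"
    unfolding p_def D_def
  proof (rule raising_diag)
    fix y a assume a: "a \<in> x" "a \<in> y"
    then have "xc \<inter> (y - {a}) = xc \<inter> y" "y - {a} \<subseteq> S \<longleftrightarrow> y \<subseteq> S" using x_props by auto
    then show "(if y - {a} \<subseteq> S \<and> card (x \<inter> (y - {a})) + Suc i = d \<and> card (xc \<inter> (y - {a})) = i
        then 1 else 0) = (if y \<subseteq> S \<and> card (x \<inter> y) + i = d \<and> card (xc \<inter> y) = i then 1 else 0)"
      using card_Int_Diff1[OF x_props(1) a] by simp
  qed
  ultimately show ?thesis unfolding L_def by (metis mult.assoc)
qed

lemma L_p_0: "L * p 0 = 0"
proof -
  have "lowering xc * p 0 = lowering xc * layer xc 0 * p 0"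
    using p_layers(2)[of 0] by (simp add: mult.assoc)
  then show ?thesis
    by (simp add: L_def mult.assoc lowering_layer_0[OF x_props(2)])
qed

lemma casimir_commutes:
  assumes "c = casimir x \<or> c = casimir xc"
  shows "c * raising x = raising x * c" "c * lowering x = lowering x * c"
    "c * raising xc = raising xc * c" "c * lowering xc = lowering xc * c"
proof -
  have "raising x * casimir xc = casimir xc * raising x"
    by (intro commute_casimir num_commute raising_raising_commute raising_lowering_commute x_props)
  moreover have "lowering x * casimir xc = casimir xc * lowering x"
    by (intro commute_casimir num_commute lowering_lowering_commute x_props
        raising_lowering_commute[symmetric])
  moreover have "raising xc * casimir x = casimir x * raising xc"
    by (intro commute_casimir num_commute raising_raising_commute raising_lowering_commute x_props)
  moreover have "lowering xc * casimir x = casimir x * lowering xc"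
    by (intro commute_casimir num_commute lowering_lowering_commute x_props
        raising_lowering_commute[symmetric])
  ultimately show "c * raising x = raising x * c" "c * lowering x = lowering x * c"
    "c * raising xc = raising xc * c" "c * lowering xc = lowering xc * c"
    using assms casimir_raising[OF x_props(1)] casimir_lowering[OF x_props(1)]
      casimir_raising[OF x_props(2)] casimir_lowering[OF x_props(2)] by metis+
qed

lemma casimir_R_L:
  assumes "c = casimir x \<or> c = casimir xc"
  shows "c * R = R * c" "c * L = L * c"
  unfolding R_def L_def by (intro commute_mult casimir_commutes[OF assms])+

lemma casimir_casimir: "casimir x * casimir xc = casimir xc * casimir x"
proof -
  have "casimir x * num xc = num xc * casimir x"
    unfolding num_def
  proof (rule casimir_diag)
    fix y a assume "a \<in> x"
    then have "xc \<inter> insert a y = xc \<inter> y" using x_props by auto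
    then show "of_nat (card (xc \<inter> insert a y)) = of_nat (card (xc \<inter> y))" by simp
  qed
  then show ?thesis by (intro commute_casimir casimir_commutes) simp_all
qed

lemma casimir_p:
  assumes "c = casimir x \<or> c = casimir xc"
  shows "c * p i = p i * c"
proof (cases "i \<le> d")
  case True
  let ?D = "diag (\<lambda>y. if y \<subseteq> S then 1 else 0)"
  have p: "p i = layer x (d - i) * (layer xc i * ?D)"
    using True by (intro lop_eqI) (auto simp: p_def layer_def)
  have D: "casimir T * ?D = ?D * casimir T" if "T \<subseteq> S" for T
    by (rule casimir_diag) (use that in auto)
  have "casimir T * layer U k = layer U k * casimir T" if "T \<inter> U = {}" for T U :: "nat set" and k
    unfolding layer_def
  proof (rule casimir_diag)
    fix y a assume "a \<in> T"
    then have "U \<inter> insert a y = U \<inter> y" using that by auto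
    then show "(if card (U \<inter> insert a y) = k then 1 else 0) = (if card (U \<inter> y) = k then 1 else 0)"
      by simp
  qed
  then have "c * layer x k = layer x k * c" "c * layer xc k = layer xc k * c" for k
    using assms casimir_layer x_props by auto
  then show ?thesis
    unfolding p using assms D x_props(7,8) by (intro commute_mult) auto
qed (simp add: p_eq_0)

lemma raising_lowering_p:
  "raising x * lowering x * p i = (casimir x - sc (cval d (Suc i))) * p i"
  "raising xc * lowering xc * p i = (casimir xc - sc (cval d i)) * p i"
  "lowering xc * raising xc * p i = (casimir xc - sc (cval d (Suc i))) * p i"
  "lowering x * raising x * p (Suc i) = (casimir x - sc (cval d (Suc i))) * p (Suc i)"
proof -
  show "raising x * lowering x * p i = (casimir x - sc (cval d (Suc i))) * p i"
  proof (cases "i \<le> d")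
    case True
    then have c: "cval d (d - i) = cval d (Suc i)" by (simp add: cval_eq_iff)
    show ?thesis
      using raising_lowering_layer[of x "d - i"] p_layers(1)[OF True]
      by (metis c mult.assoc x_props(3))
  qed (simp add: p_eq_0)
  show "raising xc * lowering xc * p i = (casimir xc - sc (cval d i)) * p i"
    using raising_lowering_layer[of xc i] p_layers(2)[of i] by (metis mult.assoc x_props(4))
  show "lowering xc * raising xc * p i = (casimir xc - sc (cval d (Suc i))) * p i"
    using lowering_raising_layer[OF x_props(2), of i] p_layers(2)[of i]
    by (metis mult.assoc x_props(4))
  show "lowering x * raising x * p (Suc i) = (casimir x - sc (cval d (Suc i))) * p (Suc i)"
  proof (cases "Suc i \<le> d")
    case True
    then have c: "cval d (Suc (d - Suc i)) = cval d (Suc i)" by (simp add: cval_eq_iff)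
    show ?thesis
      using lowering_raising_layer[OF x_props(1), of "d - Suc i"] p_layers(1)[OF True]
      by (metis c mult.assoc x_props(3))
  qed (simp add: p_eq_0)
qed

text \<open>
  Going up and down again acts on each distance layer as a symmetric polynomial in the two commuting
  Casimir operators.
\<close>

lemma L_R_p:
  "L * R * p i = (casimir x - sc (cval d (Suc i))) * (casimir xc - sc (cval d (Suc i))) * p i"
proof -
  let ?c = "sc (cval d (Suc i))"
  have "L * R = (raising x * lowering x) * (lowering xc * raising xc)"
    unfolding L_def R_def using lowering_lowering_commute[OF x_props(5)] by (metis mult.assoc)
  then have "L * R * p i = (raising x * lowering x) * (lowering xc * raising xc * p i)"
    by (simp only: mult.assoc)
  also have "lowering xc * raising xc * p i = (casimir xc - ?c) * p i"
    by (rule raising_lowering_p)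
  also have "(casimir xc - ?c) * p i = p i * (casimir xc - ?c)"
    by (simp add: left_diff_distrib right_diff_distrib casimir_p sc_commute)
  also have "(raising x * lowering x) * (p i * (casimir xc - ?c))
      = (casimir x - ?c) * (p i * (casimir xc - ?c))"
    by (simp only: mult.assoc[symmetric] raising_lowering_p(1))
  also have "p i * (casimir xc - ?c) = (casimir xc - ?c) * p i"
    by (simp add: left_diff_distrib right_diff_distrib casimir_p sc_commute)
  finally show ?thesis by (simp only: mult.assoc)
qed

lemma R_L_p:
  "R * L * p (Suc i)
    = (casimir x - sc (cval d (Suc i))) * (casimir xc - sc (cval d (Suc i))) * p (Suc i)"
proof -
  let ?c = "sc (cval d (Suc i))" and ?p = "p (Suc i)"
  have "R * L = (lowering x * raising x) * (raising xc * lowering xc)"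
    unfolding L_def R_def using raising_raising_commute[OF x_props(5)] by (metis mult.assoc)
  then have "R * L * ?p = (lowering x * raising x) * (raising xc * lowering xc * ?p)"
    by (simp only: mult.assoc)
  also have "raising xc * lowering xc * ?p = (casimir xc - ?c) * ?p"
    by (rule raising_lowering_p)
  also have "(casimir xc - ?c) * ?p = ?p * (casimir xc - ?c)"
    by (simp add: left_diff_distrib right_diff_distrib casimir_p sc_commute)
  also have "(lowering x * raising x) * (?p * (casimir xc - ?c))
      = (casimir x - ?c) * (?p * (casimir xc - ?c))"
    by (simp only: mult.assoc[symmetric] raising_lowering_p(4))
  also have "?p * (casimir xc - ?c) = (casimir xc - ?c) * ?p"
    by (simp add: left_diff_distrib right_diff_distrib casimir_p sc_commute)
  finally show ?thesis by (simp only: mult.assoc)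
qed

text \<open>
  Splitting the raising and lowering operators of \<open>S\<close> over the two halves shows that \<open>A\<close> is
  tridiagonal on the distance layers, with diagonal part a function of the sum of the Casimir operators.
\<close>

lemma A_p:
  "A * p i = R * p i + L * p i
    + (casimir x + casimir xc - sc (cval d i + cval d (Suc i) + of_nat d)) * p i"
proof -
  have "raising S * lowering S = (raising x + raising xc) * (lowering x + lowering xc)"
    using raising_Un lowering_Un x_props(1,2,5,9) by metis
  also have "\<dots> = raising x * lowering x + raising xc * lowering xc + R + L"
    using raising_lowering_commute[OF x_props(6)]
    by (simp add: R_def L_def distrib_left distrib_right)
  finally have "A * p i = raising x * lowering x * p i + raising xc * lowering xc * p i
      + R * p i + L * p i - sc (of_nat d) * p i"
    by (simp only: A_def distrib_right left_diff_distrib)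
  then show ?thesis
    unfolding raising_lowering_p by (simp add: sc_add distrib_right left_diff_distrib)
qed

end

section \<open>Matrix units\<close>

text \<open>
  A family of operators \<open>up l i\<close>, \<open>dn l i\<close> that pair to nonzero idempotents \<open>e l\<close> yields
  matrix units \<open>M l i j = up l i * dn l j\<close>, one block of size \<open>n l\<close> for each \<open>l \<in> \<Lambda>\<close>.
\<close>

locale matrix_units =
  fixes \<Lambda> :: "'l set" and n :: "'l \<Rightarrow> nat" and up dn :: "'l \<Rightarrow> nat \<Rightarrow> 'a lop" and e :: "'l \<Rightarrow> 'a lop"
  assumes finite_\<Lambda>: "finite \<Lambda>"
    and dn_up: "\<lbrakk>l \<in> \<Lambda>; k \<in> \<Lambda>; i < n l; j < n k\<rbrakk> \<Longrightarrow>
      dn l i * up k j = (if l = k \<and> i = j then e l else 0)"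
    and up_e: "\<lbrakk>l \<in> \<Lambda>; i < n l\<rbrakk> \<Longrightarrow> up l i * e l = up l i"
    and e_nonzero: "l \<in> \<Lambda> \<Longrightarrow> e l \<noteq> 0"
begin

definition M :: "'l \<Rightarrow> nat \<Rightarrow> nat \<Rightarrow> 'a lop" where
  "M l i j = up l i * dn l j"

text \<open>
  The operator with block coordinates \<open>f\<close>.  Values of \<open>f\<close> outside the blocks are ignored.
\<close>

definition H :: "('l \<Rightarrow> nat \<Rightarrow> nat \<Rightarrow> complex) \<Rightarrow> 'a lop" where
  "H f = (\<Sum>l\<in>\<Lambda>. \<Sum>i<n l. \<Sum>j<n l. sc (f l i j) * M l i j)"

lemma M_up:
  assumes "l \<in> \<Lambda>" "k \<in> \<Lambda>" "j < n l" "i' < n k" "i < n l"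
  shows "M l i j * up k i' = (if l = k \<and> j = i' then up l i else 0)"
  using assms by (auto simp: M_def mult.assoc dn_up up_e)

lemma H_up:
  assumes "k \<in> \<Lambda>" "j < n k"
  shows "H f * up k j = (\<Sum>i<n k. sc (f k i j) * up k i)"
proof -
  have "(\<Sum>i<n l. \<Sum>j'<n l. sc (f l i j') * (M l i j' * up k j))
      = (if l = k then \<Sum>i<n k. sc (f k i j) * up k i else 0)" if "l \<in> \<Lambda>" for l
  proof -
    have "(\<Sum>i<n l. \<Sum>j'<n l. sc (f l i j') * (M l i j' * up k j))
        = (\<Sum>i<n l. \<Sum>j'<n l. if j' = j then (if l = k then sc (f l i j') * up l i else 0) else 0)"
      using that assms by (intro sum.cong) (auto simp: M_up)
    then show ?thesis using assms by (cases "l = k") (auto cong: if_cong)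
  qed
  then show ?thesis
    using assms finite_\<Lambda> by (simp add: H_def sum_distrib_right mult.assoc)
qed

lemma H_mult: "H f * H g = H (\<lambda>l i j. \<Sum>k<n l. f l i k * g l k j)"
proof -
  have "H f * M l k j = (\<Sum>i<n l. sc (f l i k) * M l i j)" if "l \<in> \<Lambda>" "k < n l" for l k j
    using H_up[OF that, of f] by (simp add: M_def mult.assoc [symmetric] sum_distrib_right)
  then have "H f * (sc c * M l k j) = (\<Sum>i<n l. sc (f l i k * c) * M l i j)"
    if "l \<in> \<Lambda>" "k < n l" for l k j c
    by (simp only: sc_left_commute[of "H f"] that sum_distrib_left)
      (simp only: mult.assoc [symmetric] sc_mult [symmetric] mult.commute[of c])
  then have "H f * H g = (\<Sum>l\<in>\<Lambda>. \<Sum>k<n l. \<Sum>j<n l. \<Sum>i<n l. sc (f l i k * g l k j) * M l i j)"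
    by (simp add: H_def[of g] sum_distrib_left)
  also have "\<dots> = (\<Sum>l\<in>\<Lambda>. \<Sum>i<n l. \<Sum>j<n l. \<Sum>k<n l. sc (f l i k * g l k j) * M l i j)"
  proof (rule sum.cong[OF refl])
    fix l
    have "(\<Sum>k<n l. \<Sum>j<n l. \<Sum>i<n l. sc (f l i k * g l k j) * M l i j)
        = (\<Sum>k<n l. \<Sum>i<n l. \<Sum>j<n l. sc (f l i k * g l k j) * M l i j)"
      by (intro sum.cong[OF refl] sum.swap)
    also have "\<dots> = (\<Sum>i<n l. \<Sum>k<n l. \<Sum>j<n l. sc (f l i k * g l k j) * M l i j)"
      by (rule sum.swap)
    also have "\<dots> = (\<Sum>i<n l. \<Sum>j<n l. \<Sum>k<n l. sc (f l i k * g l k j) * M l i j)"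
      by (intro sum.cong[OF refl] sum.swap)
    finally show "(\<Sum>k<n l. \<Sum>j<n l. \<Sum>i<n l. sc (f l i k * g l k j) * M l i j)
        = (\<Sum>i<n l. \<Sum>j<n l. \<Sum>k<n l. sc (f l i k * g l k j) * M l i j)" .
  qed
  also have "\<dots> = H (\<lambda>l i j. \<Sum>k<n l. f l i k * g l k j)"
  proof -
    have "(sc (\<Sum>k\<in>K. c k) :: 'a lop) = (\<Sum>k\<in>K. sc (c k))" for K :: "nat set" and c
      by (induction K rule: infinite_finite_induct) (simp_all add: sc_add)
    then show ?thesis by (simp add: H_def sum_distrib_right)
  qed
  finally show ?thesis .
qed

lemma H_coeff:
  assumes l: "l \<in> \<Lambda>" and ij: "i < n l" "j < n l"
  shows "dn l i * H f * up l j = sc (f l i j) * e l"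
proof -
  have "dn l i * H f * up l j = (\<Sum>i'<n l. sc (f l i' j) * (dn l i * up l i'))"
    by (simp add: mult.assoc H_up[OF l ij(2)] sum_distrib_left sc_left_commute[of "dn l i"])
  also have "\<dots> = (\<Sum>i'<n l. if i' = i then sc (f l i' j) * e l else 0)"
    using l ij by (intro sum.cong) (auto simp: dn_up)
  finally show ?thesis using ij by simp
qed

lemma H_inject:
  assumes "H f = H g" "l \<in> \<Lambda>" "i < n l" "j < n l"
  shows "f l i j = g l i j"
proof (rule ccontr)
  assume "f l i j \<noteq> g l i j"
  moreover have "sc (f l i j - g l i j) * e l = 0"
    using H_coeff[OF assms(2-4), of f] H_coeff[OF assms(2-4), of g] assms(1)
    by (simp add: sc_diff left_diff_distrib)
  ultimately show False using e_nonzero[OF assms(2)] by (simp add: sc_eq_0_iff)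
qed

lemma H_cong: "(\<And>l i j. l \<in> \<Lambda> \<Longrightarrow> i < n l \<Longrightarrow> j < n l \<Longrightarrow> f l i j = g l i j) \<Longrightarrow> H f = H g"
  unfolding H_def by (intro sum.cong refl) auto

lemma H_add: "H f + H g = H (\<lambda>l i j. f l i j + g l i j)"
  by (simp add: H_def sum.distrib [symmetric] sc_add distrib_right)

lemma H_scale: "sc c * H f = H (\<lambda>l i j. c * f l i j)"
  by (simp add: H_def sum_distrib_left sc_mult mult.assoc)

lemma range_H_add: "F \<in> range H \<Longrightarrow> G \<in> range H \<Longrightarrow> F + G \<in> range H"
  by (auto simp: H_add)

lemma range_H_scale: "F \<in> range H \<Longrightarrow> sc c * F \<in> range H"
  by (auto simp: H_scale)

lemma range_H_mult: "F \<in> range H \<Longrightarrow> G \<in> range H \<Longrightarrow> F * G \<in> range H"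
  by (auto simp: H_mult)

lemma range_H_0: "0 \<in> range H"
  by (rule range_eqI[of _ _ "\<lambda>_ _ _. 0"]) (simp add: H_def)

lemma range_H_sum: "(\<And>i. i \<in> I \<Longrightarrow> F i \<in> range H) \<Longrightarrow> (\<Sum>i\<in>I. F i) \<in> range H"
  by (induction I rule: infinite_finite_induct) (auto intro: range_H_0 range_H_add)

lemma range_H_M:
  assumes "l \<in> \<Lambda>" "i < n l" "j < n l"
  shows "M l i j \<in> range H"
proof (rule range_eqI)
  let ?f = "\<lambda>l' i' j'. if l' = l then if i' = i then if j' = j then 1 else 0 else 0 else 0"
  have "(\<Sum>i'<n l. \<Sum>j'<n l. sc (?f l i' j') * M l i' j')
      = (\<Sum>i'<n l. \<Sum>j'<n l. if j' = j then if i' = i then M l i j else 0 else 0)"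
    by (intro sum.cong refl) auto
  also have "\<dots> = M l i j" using assms by simp
  finally have "(\<Sum>i'<n l'. \<Sum>j'<n l'. sc (?f l' i' j') * M l' i' j') = (if l' = l then M l i j else 0)" for l'
    by simp
  then have "H ?f = (\<Sum>l'\<in>\<Lambda>. if l' = l then M l i j else 0)"
    by (simp only: H_def)
  then show "M l i j = H ?f" using assms finite_\<Lambda> by simp
qed

lemma range_H_left_ideal:
  assumes "\<And>l i j. l \<in> \<Lambda> \<Longrightarrow> i < n l \<Longrightarrow> j < n l \<Longrightarrow> G * M l i j \<in> range H" and F: "F \<in> range H"
  shows "G * F \<in> range H"
proof -
  obtain f where "F = H f" using F by auto
  then have "G * F = (\<Sum>l\<in>\<Lambda>. \<Sum>i<n l. \<Sum>j<n l. sc (f l i j) * (G * M l i j))"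
    by (simp add: H_def sum_distrib_left sc_left_commute[of G])
  then show ?thesis
    by (auto intro!: range_H_sum range_H_scale assms(1))
qed

end


section \<open>Matrix units of the Terwilliger algebra\<close>

context terwilliger
begin

text \<open>
  The isotypic projections of the two halves.
\<close>

definition e1 :: "nat \<Rightarrow> nat set lop" where "e1 = isotypic x"
definition e2 :: "nat \<Rightarrow> nat set lop" where "e2 = isotypic xc"

text \<open>
  \<open>Theta\<close> is a symmetric polynomial in the two Casimir operators.  Its eigenvalue \<open>theta a b\<close> on the
  product of the components \<open>a\<close> and \<open>b\<close> determines the unordered pair \<open>{a, b}\<close>, which the sum of the
  Casimir operators alone does not.
\<close>

definition theta :: "nat \<Rightarrow> nat \<Rightarrow> complex" where
  "theta a b = (\<i> + cval d a) * (\<i> + cval d b)"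

definition Theta :: "nat set lop" where
  "Theta = (sc \<i> + casimir x) * (sc \<i> + casimir xc)"

text \<open>
  Unordered pairs of components, written \<open>(s, r)\<close> with \<open>r \<le> s\<close>.
\<close>

definition pairs :: "(nat \<times> nat) set" where
  "pairs = (SIGMA s:{0..m}. {0..s})"

abbreviation "thetas \<equiv> (\<lambda>(s, r). theta r s) ` pairs"

text \<open>
  The central idempotent of an unordered pair: the spectral projection of \<open>Theta\<close>.
\<close>

definition idem :: "nat \<times> nat \<Rightarrow> nat set lop" where
  "idem l = ev (lagrange thetas (case l of (s, r) \<Rightarrow> theta r s)) Theta"

lemma finite_pairs: "finite pairs"
  by (simp add: pairs_def)

lemma theta_eq_iff:
  assumes "a \<le> m" "b \<le> m" "r \<le> m" "s \<le> m"
  shows "theta a b = theta r s \<longleftrightarrow> a = r \<and> b = s \<or> a = s \<and> b = r"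
proof
  assume "theta a b = theta r s"
  then have "cval d a = cval d r \<and> cval d b = cval d s \<or> cval d a = cval d s \<and> cval d b = cval d r"
    unfolding theta_def by (intro theta_eq_imp) simp_all
  then show "a = r \<and> b = s \<or> a = s \<and> b = r"
    using assms inj_on_eq_iff[OF inj_on_cval[of d]] by auto
qed (auto simp: theta_def)

lemma inj_on_theta: "inj_on (\<lambda>(s, r). theta r s) pairs"
  by (auto simp: inj_on_def pairs_def theta_eq_iff)

lemma theta_in_thetas: "a \<le> m \<Longrightarrow> b \<le> m \<Longrightarrow> theta a b \<in> thetas"
  by (rule image_eqI[of _ _ "(max a b, min a b)"])
    (auto simp: pairs_def theta_def max_def min_def)

lemma commute_isotypic: "F * casimir T = casimir T * F \<Longrightarrow> F * isotypic T r = isotypic T r * F"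
  unfolding isotypic_def by (rule ev_commute[symmetric]) simp

lemma e1_e2: "e1 a * e2 b = e2 b * e1 a"
  unfolding e1_def e2_def
  by (intro commute_isotypic commute_isotypic[symmetric]) (simp add: casimir_casimir)

lemma casimir_e1_e2:
  assumes "a \<le> m" "b \<le> m"
  shows "casimir x * (e1 a * e2 b) = sc (cval d a) * (e1 a * e2 b)"
    and "casimir xc * (e1 a * e2 b) = sc (cval d b) * (e1 a * e2 b)"
proof -
  have 1: "casimir x * e1 a = sc (cval d a) * e1 a" and 2: "casimir xc * e2 b = sc (cval d b) * e2 b"
    using casimir_isotypic[OF x_props(1), of a] casimir_isotypic[OF x_props(2), of b] assms x_props
    by (simp_all add: e1_def e2_def)
  show "casimir x * (e1 a * e2 b) = sc (cval d a) * (e1 a * e2 b)"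
    by (simp only: mult.assoc [symmetric] 1)
  show "casimir xc * (e1 a * e2 b) = sc (cval d b) * (e1 a * e2 b)"
    by (simp only: e1_e2 mult.assoc [symmetric] 2)
qed

lemma Theta_e1_e2:
  assumes "a \<le> m" "b \<le> m"
  shows "Theta * (e1 a * e2 b) = sc (theta a b) * (e1 a * e2 b)"
proof -
  have "Theta * (e1 a * e2 b) = (sc \<i> + casimir x) * (sc (\<i> + cval d b) * (e1 a * e2 b))"
    by (simp only: Theta_def mult.assoc distrib_right[of _ _ "e1 a * e2 b"]
        casimir_e1_e2[OF assms] sc_add[of \<i> "cval d b"])
  also have "\<dots> = sc (\<i> + cval d b) * (sc (\<i> + cval d a) * (e1 a * e2 b))"
    by (simp only: sc_left_commute[of "sc \<i> + casimir x"] distrib_right[of _ _ "e1 a * e2 b"]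
        casimir_e1_e2[OF assms] sc_add[of \<i> "cval d a"])
  also have "\<dots> = sc (theta a b) * (e1 a * e2 b)"
    unfolding theta_def by (simp only: mult.assoc [symmetric] sc_mult [symmetric] mult.commute[of "\<i> + cval d b"])
  finally show ?thesis .
qed

lemma sum_e1_e2: "(\<Sum>a\<le>m. \<Sum>b\<le>m. e1 a * e2 b) = 1"
  using sum_isotypic[OF x_props(1)] sum_isotypic[OF x_props(2)] x_props(3,4)
  by (simp add: e1_def e2_def sum_distrib_left [symmetric] sum_distrib_right [symmetric])

lemma Theta_null: "ev (\<Prod>b\<in>thetas. [:- b, 1:]) Theta = 0"
proof -
  have "ev (\<Prod>b\<in>thetas. [:- b, 1:]) Theta * (e1 a * e2 b) = 0" if "a \<le> m" "b \<le> m" for a b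
  proof -
    have "poly (\<Prod>b\<in>thetas. [:- b, 1:]) (theta a b) = 0"
      unfolding poly_prod using theta_in_thetas[OF that] finite_pairs by (intro prod_zero) auto
    then show ?thesis using ev_eigen[OF Theta_e1_e2[OF that]] by simp
  qed
  then have "ev (\<Prod>b\<in>thetas. [:- b, 1:]) Theta * (\<Sum>a\<le>m. \<Sum>b\<le>m. e1 a * e2 b) = 0"
    by (simp add: sum_distrib_left)
  then show ?thesis by (simp add: sum_e1_e2)
qed

lemma thetas_finite_nonempty: "finite thetas" "thetas \<noteq> {}"
  using finite_pairs theta_in_thetas[of 0 0] by auto

lemma sum_idem: "(\<Sum>l\<in>pairs. idem l) = 1"
  using spectral_idempotents(1)[OF thetas_finite_nonempty Theta_null]
  unfolding sum.reindex[OF inj_on_theta] o_def idem_def .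

lemma idem_mult:
  assumes "k \<in> pairs" "l \<in> pairs"
  shows "idem k * idem l = (if k = l then idem k else 0)"
  using spectral_idempotents(3)[OF thetas_finite_nonempty Theta_null imageI[OF assms(1)] imageI[OF assms(2)]]
    inj_on_eq_iff[OF inj_on_theta assms]
  by (simp add: idem_def case_prod_unfold)

text \<open>
  For \<open>r < s\<close> the sum has the two terms \<open>e1 r * e2 s\<close> and \<open>e1 s * e2 r\<close>, for \<open>r = s\<close> it has one.
\<close>

lemma idem_expand:
  assumes "(s, r) \<in> pairs"
  shows "idem (s, r) = (\<Sum>a\<le>m. \<Sum>b\<le>m. if theta a b = theta r s then e1 a * e2 b else 0)"
proof -
  have "idem (s, r) = idem (s, r) * (\<Sum>a\<le>m. \<Sum>b\<le>m. e1 a * e2 b)" by (simp add: sum_e1_e2)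
  also have "\<dots> = (\<Sum>a\<le>m. \<Sum>b\<le>m. idem (s, r) * (e1 a * e2 b))" by (simp only: sum_distrib_left)
  also have "\<dots> = (\<Sum>a\<le>m. \<Sum>b\<le>m. if theta a b = theta r s then e1 a * e2 b else 0)"
  proof (intro sum.cong refl)
    fix a b assume "a \<in> {..m}" "b \<in> {..m}"
    then have ab: "a \<le> m" "b \<le> m" by auto
    show "idem (s, r) * (e1 a * e2 b) = (if theta a b = theta r s then e1 a * e2 b else 0)"
      using ev_eigen[OF Theta_e1_e2[OF ab]] poly_lagrange[OF thetas_finite_nonempty(1) theta_in_thetas[OF ab]]
      by (simp add: idem_def)
  qed
  finally show ?thesis .
qed

lemma pairs_le: "(s, r) \<in> pairs \<Longrightarrow> r \<le> s \<and> s \<le> m \<and> r \<le> m"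
  by (auto simp: pairs_def)

lemma idem_eigen:
  assumes "(s, r) \<in> pairs"
    and "\<And>a b. a = r \<and> b = s \<or> a = s \<and> b = r \<Longrightarrow> F * (e1 a * e2 b) = sc c * (e1 a * e2 b)"
  shows "F * idem (s, r) = sc c * idem (s, r)"
  unfolding idem_expand[OF assms(1)] sum_distrib_left
proof (intro sum.cong refl)
  fix a b assume "a \<in> {..m}" "b \<in> {..m}"
  then have "theta a b = theta r s \<longleftrightarrow> a = r \<and> b = s \<or> a = s \<and> b = r"
    using pairs_le[OF assms(1)] by (intro theta_eq_iff) auto
  then show "F * (if theta a b = theta r s then e1 a * e2 b else 0)
      = sc c * (if theta a b = theta r s then e1 a * e2 b else 0)"
    using assms(2)[of a b] by simp
qed

lemma idem_commute:
  assumes "casimir x * G = G * casimir x" "casimir xc * G = G * casimir xc"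
  shows "idem l * G = G * idem l"
proof -
  have "(sc \<i> + c) * G = G * (sc \<i> + c)" if "c * G = G * c" for c
    using that by (simp add: distrib_left distrib_right sc_commute)
  then have "G * Theta = Theta * G"
    unfolding Theta_def using assms by (intro commute_mult) simp_all
  then show ?thesis unfolding idem_def by (intro ev_commute) simp
qed

lemma idem_p: "idem l * p i = p i * idem l"
  and idem_R: "idem l * R = R * idem l" and idem_L: "idem l * L = L * idem l"
  by (intro idem_commute; simp add: casimir_p casimir_R_L)+

lemma p_idem_eq_0:
  assumes l: "(s, r) \<in> pairs" and i: "i < s \<or> d < i + s"
  shows "p i * idem (s, r) = 0"
proof (cases "i \<le> d")
  case True
  have "e2 s * layer xc i = 0" "e1 s * layer x (d - i) = 0"
    unfolding e1_def e2_def using pairs_le[OF l] i True x_props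
    by (auto intro!: isotypic_layer)
  then have "e2 s * (layer xc i * p i) = 0" "e1 s * (layer x (d - i) * p i) = 0"
    by (simp_all only: mult.assoc [symmetric] mult_zero_left)
  then have 0: "e2 s * p i = 0" "e1 s * p i = 0"
    by (simp_all only: p_layers(1)[OF True] p_layers(2)[of i])
  have pe: "p i * e1 a = e1 a * p i" "p i * e2 a = e2 a * p i" for a
    unfolding e1_def e2_def by (intro commute_isotypic; simp add: casimir_p)+
  have "p i * (e1 a * e2 b) = sc 0 * (e1 a * e2 b)" if "a = r \<and> b = s \<or> a = s \<and> b = r" for a b
  proof -
    have "p i * (e1 a * e2 b) = e1 a * (e2 b * p i)"
      by (simp only: mult.assoc [symmetric] pe(1)) (simp only: mult.assoc pe(2))
    moreover have "p i * (e2 b * e1 a) = e2 b * (e1 a * p i)"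
      by (simp only: mult.assoc [symmetric] pe(2)) (simp only: mult.assoc pe(1))
    ultimately show ?thesis using that 0 e1_e2[of a b] by auto
  qed
  then show ?thesis using idem_eigen[OF l, of "p i" 0] by simp
qed (simp add: p_eq_0)

text \<open>
  The scalar by which \<open>L * R\<close> acts on distance layer \<open>i\<close> of the component of a pair; it is also
  the scalar of \<open>R * L\<close> on layer \<open>i + 1\<close>.
\<close>

definition mu :: "nat \<times> nat \<Rightarrow> nat \<Rightarrow> complex" where
  "mu l i = (case l of (s, r) \<Rightarrow> (cval d r - cval d (Suc i)) * (cval d s - cval d (Suc i)))"

lemma mu_nonzero: "(s, r) \<in> pairs \<Longrightarrow> s \<le> i \<Longrightarrow> i + s < d \<Longrightarrow> mu (s, r) i \<noteq> 0"
  using pairs_le[of s r] by (auto simp: mu_def cval_eq_iff)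

lemma casimirs_idem:
  assumes l: "(s, r) \<in> pairs"
  shows "(casimir x - sc (cval d (Suc i))) * (casimir xc - sc (cval d (Suc i))) * idem (s, r)
    = sc (mu (s, r) i) * idem (s, r)"
proof (rule idem_eigen[OF l])
  fix a b assume ab: "a = r \<and> b = s \<or> a = s \<and> b = r"
  then have le: "a \<le> m" "b \<le> m" using pairs_le[OF l] by auto
  let ?c = "cval d (Suc i)" and ?E = "e1 a * e2 b"
  have "(casimir x - sc ?c) * (casimir xc - sc ?c) * ?E
      = (casimir x - sc ?c) * (sc (cval d b - ?c) * ?E)"
    by (simp only: mult.assoc left_diff_distrib[of _ _ ?E] casimir_e1_e2[OF le] sc_diff)
  also have "\<dots> = sc (cval d b - ?c) * (sc (cval d a - ?c) * ?E)"
    by (simp only: sc_left_commute[of "casimir x - sc ?c"] left_diff_distrib[of _ _ ?E]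
        casimir_e1_e2[OF le] sc_diff[of "cval d a"])
  also have "\<dots> = sc ((cval d b - ?c) * (cval d a - ?c)) * ?E"
    by (simp only: sc_mult mult.assoc)
  also have "(cval d b - ?c) * (cval d a - ?c) = mu (s, r) i"
    using ab by (auto simp: mu_def mult.commute)
  finally show "(casimir x - sc ?c) * (casimir xc - sc ?c) * ?E = sc (mu (s, r) i) * ?E" .
qed

lemma L_R_p_idem:
  "l \<in> pairs \<Longrightarrow> L * R * (p i * idem l) = sc (mu l i) * (p i * idem l)"
proof (cases l)
  fix s r assume l: "l \<in> pairs" "l = (s, r)"
  have "L * R * (p i * idem l) = (casimir x - sc (cval d (Suc i))) * (casimir xc - sc (cval d (Suc i))) * idem l * p i"
    by (simp only: mult.assoc [symmetric] L_R_p) (simp only: mult.assoc idem_p)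
  also have "\<dots> = sc (mu l i) * idem l * p i"
    using casimirs_idem l by simp
  finally show ?thesis by (simp only: mult.assoc idem_p)
qed

lemma R_L_p_idem:
  "l \<in> pairs \<Longrightarrow> R * L * (p (Suc i) * idem l) = sc (mu l i) * (p (Suc i) * idem l)"
proof (cases l)
  fix s r assume l: "l \<in> pairs" "l = (s, r)"
  have "R * L * (p (Suc i) * idem l) = (casimir x - sc (cval d (Suc i))) * (casimir xc - sc (cval d (Suc i))) * idem l * p (Suc i)"
    by (simp only: mult.assoc [symmetric] R_L_p) (simp only: mult.assoc idem_p)
  also have "\<dots> = sc (mu l i) * idem l * p (Suc i)"
    using casimirs_idem l by simp
  finally show ?thesis by (simp only: mult.assoc idem_p)
qed

lemma R_pow_p: "R ^ k * p i = p (i + k) * R ^ k"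
proof (induction k)
  case (Suc k)
  have "R ^ Suc k * p i = R * p (i + k) * R ^ k"
    by (simp add: mult.assoc Suc.IH)
  then show ?case by (simp add: R_p mult.assoc)
qed simp

lemma L_pow_p: "L ^ k * p (i + k) = p i * L ^ k"
proof (induction k arbitrary: i)
  case (Suc k)
  have "L ^ Suc k * p (i + Suc k) = L * (L ^ k * p (Suc i + k))"
    by (simp add: mult.assoc)
  also have "\<dots> = L * p (Suc i) * L ^ k" by (simp only: Suc.IH mult.assoc)
  finally show ?case by (simp add: L_p mult.assoc)
qed simp

lemma L_pow_p_eq_0:
  assumes "i < k"
  shows "L ^ k * p i = 0"
proof -
  have "L ^ k = L ^ (k - Suc i) * L * L ^ i"
    using assms by (simp add: power_Suc2 [symmetric] power_add [symmetric] del: power_Suc)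
  then have "L ^ k * p i = L ^ (k - Suc i) * (L * (L ^ i * p (0 + i)))"
    by (simp add: mult.assoc)
  also have "\<dots> = L ^ (k - Suc i) * (L * p 0 * L ^ i)"
    by (simp only: L_pow_p mult.assoc)
  finally show ?thesis by (simp add: L_p_0)
qed

lemma idem_R_pow: "idem l * R ^ k = R ^ k * idem l" and idem_L_pow: "idem l * L ^ k = L ^ k * idem l"
  by (intro commute_power idem_R idem_L)+

text \<open>
  The scalar of \<open>L ^ k * R ^ k\<close> on the lowest distance layer of the component of a pair.
\<close>

definition nu :: "nat \<times> nat \<Rightarrow> nat \<Rightarrow> complex" where
  "nu l k = (\<Prod>t<k. mu l (fst l + t))"

lemma nu_nonzero: "l \<in> pairs \<Longrightarrow> k + 2 * fst l \<le> d \<Longrightarrow> nu l k \<noteq> 0"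
  by (cases l) (simp add: nu_def mu_nonzero)

lemma L_R_pow:
  assumes l: "l \<in> pairs"
  shows "L ^ k * R ^ k * (p (fst l) * idem l) = sc (nu l k) * (p (fst l) * idem l)"
proof (induction k)
  case (Suc k)
  let ?s = "fst l"
  have R: "R ^ k * (p ?s * idem l) = p (?s + k) * idem l * R ^ k"
    by (simp only: mult.assoc [symmetric] R_pow_p) (simp only: mult.assoc idem_R_pow)
  have "L ^ Suc k * R ^ Suc k * (p ?s * idem l) = L ^ k * (L * R * (R ^ k * (p ?s * idem l)))"
    by (simp only: power_Suc2[of L] power_Suc[of R] mult.assoc)
  also have "L * R * (R ^ k * (p ?s * idem l)) = L * R * (p (?s + k) * idem l) * R ^ k"
    by (simp only: R mult.assoc)
  also have "\<dots> = sc (mu l (?s + k)) * (p (?s + k) * idem l) * R ^ k"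
    by (simp only: L_R_p_idem[OF l])
  also have "\<dots> = sc (mu l (?s + k)) * (R ^ k * (p ?s * idem l))"
    by (simp only: R mult.assoc)
  also have "L ^ k * (sc (mu l (?s + k)) * (R ^ k * (p ?s * idem l)))
      = sc (mu l (?s + k)) * (L ^ k * R ^ k * (p ?s * idem l))"
    by (simp only: sc_left_commute[of "L ^ k"] mult.assoc)
  also have "\<dots> = sc (mu l (?s + k) * nu l k) * (p ?s * idem l)"
    by (simp only: Suc.IH) (simp only: sc_mult mult.assoc)
  finally show ?case by (simp add: nu_def mult.commute)
qed (simp add: nu_def)

lemma R_L_pow:
  assumes l: "l \<in> pairs"
  shows "R ^ k * L ^ k * (p (fst l + k) * idem l) = sc (nu l k) * (p (fst l + k) * idem l)"
proof (induction k)
  case (Suc k)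
  let ?s = "fst l"
  have "R ^ Suc k * L ^ Suc k * (p (?s + Suc k) * idem l)
      = R * (R ^ k * L ^ k * (L * p (Suc (?s + k)) * idem l))"
    by (simp only: power_Suc2[of L] power_Suc[of R] mult.assoc add_Suc_right)
  also have "L * p (Suc (?s + k)) * idem l = p (?s + k) * idem l * L"
    by (simp only: L_p mult.assoc idem_L)
  also have "R * (R ^ k * L ^ k * (p (?s + k) * idem l * L)) = R * (sc (nu l k) * (p (?s + k) * idem l) * L)"
    by (simp only: Suc.IH [symmetric] mult.assoc)
  also have "\<dots> = sc (nu l k) * (R * (p (?s + k) * idem l * L))"
    by (simp only: mult.assoc sc_left_commute[of R])
  also have "p (?s + k) * idem l * L = L * (p (Suc (?s + k)) * idem l)"
    by (simp only: L_p [symmetric] mult.assoc idem_L) (simp only: mult.assoc [symmetric] L_p)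
  also have "R * (L * (p (Suc (?s + k)) * idem l)) = sc (mu l (?s + k)) * (p (Suc (?s + k)) * idem l)"
    using R_L_p_idem[OF l, of "?s + k"] by (simp only: mult.assoc)
  also have "sc (nu l k) * (sc (mu l (?s + k)) * (p (Suc (?s + k)) * idem l))
      = sc (nu l k * mu l (?s + k)) * (p (Suc (?s + k)) * idem l)"
    by (simp only: sc_mult mult.assoc)
  finally show ?case by (simp add: nu_def)
qed (simp add: nu_def)

text \<open>
  The number of distance layers \<open>s, \<dots>, d - s\<close> on which the component of \<open>(s, r)\<close> is nonzero.
\<close>

definition blk :: "nat \<times> nat \<Rightarrow> nat" where "blk l = d + 1 - 2 * fst l"

text \<open>
  The lowest distance layer of a component, and the operators that connect it with layer
  \<open>s + k\<close>, normalised to be inverse to each other.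
\<close>

definition corner :: "nat \<times> nat \<Rightarrow> nat set lop" where
  "corner l = p (fst l) * idem l"

definition upw :: "nat \<times> nat \<Rightarrow> nat \<Rightarrow> nat set lop" where
  "upw l k = R ^ k * corner l"

definition dnw :: "nat \<times> nat \<Rightarrow> nat \<Rightarrow> nat set lop" where
  "dnw l k = sc (1 / nu l k) * (corner l * L ^ k)"

lemma corner_idem: "l \<in> pairs \<Longrightarrow> corner l * corner l = corner l"
proof -
  assume l: "l \<in> pairs"
  have "corner l * corner l = p (fst l) * (idem l * p (fst l)) * idem l"
    by (simp only: corner_def mult.assoc)
  also have "\<dots> = (p (fst l) * p (fst l)) * (idem l * idem l)"
    by (simp only: idem_p mult.assoc)
  finally show ?thesis by (simp add: p_mult idem_mult[OF l l] corner_def)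
qed

text \<open>
  The product of an eigenvector for \<open>x\<close> in layer \<open>d - s\<close> and one for \<open>xc\<close> in layer \<open>s\<close> is a
  nonzero fixed vector of \<open>corner l\<close>.
\<close>

lemma corner_nonzero:
  assumes l: "l \<in> pairs"
  shows "corner l \<noteq> 0"
proof -
  obtain s r where sr: "l = (s, r)" by fastforce
  have le: "r \<le> s" "s \<le> m" using l pairs_le sr by auto
  obtain v where v: "v \<noteq> (\<lambda>_. 0)" "app (casimir x) v = (\<lambda>y. cval d r * v y)"
    "\<And>y. v y \<noteq> 0 \<Longrightarrow> card (x \<inter> y) = d - s" "\<And>y. v y = v (x \<inter> y)"
    using casimir_eigenvector_exists[OF x_props(1), of r "d - s"] le x_props(3) by fastforce
  obtain w where w: "w \<noteq> (\<lambda>_. 0)" "app (casimir xc) w = (\<lambda>y. cval d s * w y)"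
    "\<And>y. w y \<noteq> 0 \<Longrightarrow> card (xc \<inter> y) = s" "\<And>y. w y = w (xc \<inter> y)"
    using casimir_eigenvector_exists[OF x_props(2), of s s] le x_props(4) by fastforce
  \<comment> \<open>each factor depends on one half only, so each Casimir operator sees only its own factor\<close>
  define u where "u y = (if y \<subseteq> S then 1 else 0) * v y * w y" for y
  have inv: "xc \<inter> insert a y = xc \<inter> y" if "a \<in> x" for a y using that x_props by auto
  have inv': "x \<inter> insert a y = x \<inter> y" if "a \<in> xc" for a y using that x_props by auto
  have sub: "insert a y \<subseteq> S \<longleftrightarrow> y \<subseteq> S" if "a \<in> x \<union> xc" for a y using that x_props by auto
  have 1: "app (casimir x) u = (\<lambda>y. cval d r * u y)"
  proof -
    define g where "g y = (if y \<subseteq> S then 1 else 0) * w y" for y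
    have "g (insert a y) = g y" if "a \<in> x" for a y
      using inv[OF that, of y] sub[of a y] that w(4)[of "insert a y"] w(4)[of y] by (simp add: g_def)
    then have "app (casimir x * diag g) v = app (diag g * casimir x) v"
      by (simp only: casimir_diag)
    moreover have "u = app (diag g) v" by (simp add: u_def g_def mult.commute mult.left_commute fun_eq_iff)
    ultimately have "app (casimir x) u = app (diag g) (app (casimir x) v)"
      by (simp only: times_lop.rep_eq)
    then show ?thesis by (simp add: v(2) u_def g_def fun_eq_iff)
  qed
  have 2: "app (casimir xc) u = (\<lambda>y. cval d s * u y)"
  proof -
    define g where "g y = (if y \<subseteq> S then 1 else 0) * v y" for y
    have "g (insert a y) = g y" if "a \<in> xc" for a y
      using inv'[OF that, of y] sub[of a y] that v(4)[of "insert a y"] v(4)[of y] by (simp add: g_def)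
    then have "app (casimir xc * diag g) w = app (diag g * casimir xc) w"
      by (simp only: casimir_diag)
    moreover have "u = app (diag g) w" by (simp add: u_def g_def fun_eq_iff)
    ultimately have "app (casimir xc) u = app (diag g) (app (casimir xc) w)"
      by (simp only: times_lop.rep_eq)
    then show ?thesis by (simp add: w(2) u_def g_def fun_eq_iff)
  qed
  have "app Theta u = (\<lambda>y. theta r s * u y)"
  proof -
    have "app (sc \<i> + casimir xc) u = (\<lambda>y. (\<i> + cval d s) * u y)"
      by (simp add: 2 distrib_right)
    then have "app Theta u = (\<lambda>y. (\<i> + cval d s) * app (sc \<i> + casimir x) u y)"
      unfolding Theta_def times_lop.rep_eq by (simp only: app_scale)
    then show ?thesis by (simp add: 1 theta_def distrib_right mult.assoc mult.left_commute fun_eq_iff algebra_simps)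
  qed
  then have "app (idem l) u = u"
    using ev_app_eigen[of Theta u "theta r s" "lagrange thetas (theta r s)"]
      poly_lagrange[OF thetas_finite_nonempty(1), of "theta r s" "theta r s"]
      theta_in_thetas[of r s] le
    by (simp add: idem_def sr)
  moreover have "app (p s) u = u"
    using v(3) w(3) le by (force simp: p_def u_def fun_eq_iff)
  ultimately have "app (corner l) u = u" by (simp add: corner_def sr)
  moreover have "u \<noteq> (\<lambda>_. 0)"
  proof -
    obtain y z where yz: "v y \<noteq> 0" "w z \<noteq> 0" using v(1) w(1) by (meson ext)
    let ?t = "(x \<inter> y) \<union> (xc \<inter> z)"
    have "x \<inter> ?t = x \<inter> y" "xc \<inter> ?t = xc \<inter> z" "?t \<subseteq> S" using x_props by auto
    then have "u ?t = v y * w z"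
      using v(4)[of ?t] v(4)[of y] w(4)[of ?t] w(4)[of z] by (simp add: u_def)
    then have "u ?t \<noteq> 0" using yz by simp
    then show ?thesis by auto
  qed
  ultimately show ?thesis by force
qed

lemma blk_less: "l \<in> pairs \<Longrightarrow> k < blk l \<longleftrightarrow> k + 2 * fst l \<le> d"
  using pairs_le[of "fst l" "snd l"] by (auto simp: blk_def)

lemma dnw_upw:
  assumes l: "l \<in> pairs" and k: "k \<in> pairs" and i: "i < blk l" and j: "j < blk k"
  shows "dnw l i * upw k j = (if l = k \<and> i = j then corner l else 0)"
proof (cases "l = k")
  case False
  have "corner l * L ^ i * (R ^ j * corner k) = p (fst l) * (idem l * L ^ i) * R ^ j * p (fst k) * idem k"
    by (simp only: corner_def mult.assoc)
  also have "\<dots> = p (fst l) * L ^ i * (idem l * R ^ j) * p (fst k) * idem k"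
    by (simp only: idem_L_pow mult.assoc)
  also have "\<dots> = p (fst l) * L ^ i * R ^ j * (idem l * p (fst k)) * idem k"
    by (simp only: idem_R_pow mult.assoc)
  also have "\<dots> = p (fst l) * L ^ i * R ^ j * p (fst k) * (idem l * idem k)"
    by (simp only: idem_p mult.assoc)
  finally show ?thesis
    using False l k by (simp add: dnw_def upw_def idem_mult mult.assoc)
next
  case True
  show ?thesis
  proof (cases "i = j")
    case eq: True
    have "L ^ i * (R ^ i * corner l) = sc (nu l i) * corner l"
      using L_R_pow[OF l, of i] by (simp only: corner_def mult.assoc)
    then have "corner l * L ^ i * (R ^ i * corner l) = corner l * (sc (nu l i) * corner l)"
      by (simp only: mult.assoc)
    also have "\<dots> = sc (nu l i) * corner l"
      by (simp only: sc_left_commute[of "corner l"] corner_idem[OF l])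
    finally have "dnw l i * upw l i = sc (1 / nu l i * nu l i) * corner l"
      by (simp only: dnw_def upw_def mult.assoc sc_mult)
    then show ?thesis
      using True eq nu_nonzero[OF l] i blk_less[OF l] by simp
  next
    case neq: False
    let ?s = "fst l"
    have "p ?s * L ^ i * R ^ j * p ?s = p ?s * (L ^ i * p (?s + j)) * R ^ j"
      by (simp only: mult.assoc R_pow_p)
    also have "\<dots> = 0"
    proof (cases "i \<le> ?s + j")
      case le: True
      have "L ^ i * p (?s + j) = p (?s + j - i) * L ^ i"
        using L_pow_p[of i "?s + j - i"] le by simp
      moreover have "p ?s * p (?s + j - i) = 0" using neq le by (auto simp: p_mult)
      ultimately show ?thesis by (simp add: mult.assoc [symmetric])
    qed (simp add: L_pow_p_eq_0)
    finally have 0: "p ?s * L ^ i * R ^ j * p ?s = 0" .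
    have "corner l * L ^ i * (R ^ j * corner l) = idem l * (p ?s * L ^ i * R ^ j * p ?s) * idem l"
      by (simp only: corner_def idem_p [symmetric] mult.assoc)
    also have "\<dots> = 0" by (simp only: 0 mult_zero_left mult_zero_right)
    finally have "dnw l i * upw l j = 0"
      by (simp only: dnw_def upw_def mult.assoc mult_zero_right)
    then show ?thesis using True neq by simp
  qed
qed

sublocale units: matrix_units pairs blk upw dnw corner
proof
  show "upw l i * corner l = upw l i" if "l \<in> pairs" for l i
    using corner_idem[OF that] by (simp add: upw_def mult.assoc)
qed (use finite_pairs dnw_upw corner_nonzero in auto)

end

section \<open>The span of the matrix units\<close>

context terwilliger
begin

text \<open>
  The projection onto the functions on the vertices, which is the identity of the matrix algebra.
\<close>

definition Q :: "nat set lop" where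
  "Q = diag (\<lambda>y. if y \<in> johnson_X d then 1 else 0)"

lemma johnson_X_iff: "y \<in> johnson_X d \<longleftrightarrow> y \<subseteq> S \<and> card (x \<inter> y) + card (xc \<inter> y) = d"
proof -
  have "card y = card (x \<inter> y) + card (xc \<inter> y)" if y: "y \<subseteq> S"
  proof -
    have "y = (x \<inter> y) \<union> (xc \<inter> y)" using y x_props(9) by auto
    then have "card y = card ((x \<inter> y) \<union> (xc \<inter> y))" by (rule arg_cong)
    also have "\<dots> = card (x \<inter> y) + card (xc \<inter> y)"
      using x_props by (intro card_Un_disjoint) auto
    finally show ?thesis .
  qed
  then show ?thesis
    using finite_subset[of y S] by (auto simp: johnson_X_def nsets_def)
qed

lemma Q_sum: "Q = (\<Sum>i\<le>d. p i)"
proof -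
  have "(\<Sum>i\<le>d. if y \<subseteq> S \<and> card (x \<inter> y) + i = d \<and> card (xc \<inter> y) = i then 1 else 0)
      = (if y \<in> johnson_X d then 1 else 0 :: complex)" for y
  proof -
    have "(\<Sum>i\<le>d. if y \<subseteq> S \<and> card (x \<inter> y) + i = d \<and> card (xc \<inter> y) = i then 1 else 0)
        = (\<Sum>i\<le>d. if i = card (xc \<inter> y) then if y \<in> johnson_X d then 1 else 0 else 0 :: complex)"
      by (intro sum.cong) (auto simp: johnson_X_iff)
    also have "\<dots> = (if y \<in> johnson_X d then 1 else 0)"
      using johnson_X_iff[of y] by (simp add: sum.delta)
    finally show ?thesis .
  qed
  then show ?thesis by (simp add: Q_def p_def diag_sum)
qed

lemma Q_p: "Q * p i = p i"
  by (rule lop_eqI) (auto simp: Q_def p_def johnson_X_iff)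

lemma p_Q: "p i * Q = p i"
  by (rule lop_eqI) (auto simp: Q_def p_def johnson_X_iff)

lemma Q_Q: "Q * Q = Q"
  by (rule lop_eqI) (auto simp: Q_def)

abbreviation span :: "nat set lop set" where "span \<equiv> range units.H"

lemma p_idem_span:
  assumes l: "l \<in> pairs"
  shows "p i * idem l \<in> span"
proof (cases "fst l \<le> i \<and> i + fst l \<le> d")
  case False
  then have "p i * idem l = 0" using p_idem_eq_0[of "fst l" "snd l" i] l by auto
  then show ?thesis by (simp add: units.range_H_0)
next
  case True
  define k where "k = i - fst l"
  have k: "k < blk l" "i = fst l + k" using True by (auto simp: k_def blk_less[OF l])
  have corner: "corner l * L ^ k = L ^ k * (p i * idem l)"
    unfolding corner_def k(2)
    by (simp only: mult.assoc idem_L_pow) (simp only: mult.assoc [symmetric] L_pow_p)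
  have "units.M l k k = sc (1 / nu l k) * (R ^ k * (corner l * corner l * L ^ k))"
    by (simp only: units.M_def upw_def dnw_def mult.assoc sc_left_commute[of "corner l"] sc_left_commute[of "R ^ k"])
  also have "corner l * corner l * L ^ k = L ^ k * (p i * idem l)"
    by (simp only: corner_idem[OF l] corner)
  also have "R ^ k * (L ^ k * (p i * idem l)) = sc (nu l k) * (p i * idem l)"
    using R_L_pow[OF l, of k] by (simp only: k(2) mult.assoc)
  also have "sc (1 / nu l k) * (sc (nu l k) * (p i * idem l)) = sc (1 / nu l k * nu l k) * (p i * idem l)"
    by (simp only: sc_mult mult.assoc)
  also have "\<dots> = p i * idem l"
    using nu_nonzero[OF l] k blk_less[OF l] by simp
  finally show ?thesis using units.range_H_M[OF l k(1) k(1)] by simp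
qed

lemma Q_span: "Q \<in> span"
proof -
  have "Q = (\<Sum>i\<le>d. p i) * (\<Sum>l\<in>pairs. idem l)" by (simp add: Q_sum sum_idem)
  also have "\<dots> = (\<Sum>i\<le>d. \<Sum>l\<in>pairs. p i * idem l)" by (simp add: sum_product)
  finally show ?thesis using p_idem_span by (auto intro!: units.range_H_sum)
qed

lemma p_upw:
  "p i * upw l k = (if i = fst l + k then upw l k else 0)"
proof -
  have "upw l k = p (fst l + k) * upw l k"
    using p_mult[of "fst l" "fst l"]
    by (simp only: upw_def corner_def mult.assoc [symmetric] R_pow_p [symmetric])
      (simp only: mult.assoc if_True refl)
  moreover have "p i * (p (fst l + k) * upw l k) = (if i = fst l + k then p i * upw l k else 0)"
    by (simp add: mult.assoc [symmetric] p_mult)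
  ultimately show ?thesis by metis
qed

lemma upw_blk_eq_0:
  assumes l: "l \<in> pairs" and k: "\<not> k < blk l"
  shows "upw l k = 0"
proof -
  have "upw l k = p (fst l + k) * (R ^ k * idem l)"
    by (simp only: upw_def corner_def mult.assoc [symmetric] R_pow_p)
  also have "\<dots> = p (fst l + k) * idem l * R ^ k" by (simp only: idem_R_pow mult.assoc)
  also have "p (fst l + k) * idem l = 0"
    using p_idem_eq_0[of "fst l" "snd l" "fst l + k"] l k blk_less[OF l] by auto
  finally show ?thesis by simp
qed

lemma R_upw: "R * upw l k = upw l (Suc k)"
  by (simp add: upw_def mult.assoc)

lemma L_upw_0:
  assumes l: "l \<in> pairs"
  shows "L * upw l 0 = 0"
proof (cases "fst l")
  case 0
  then show ?thesis by (simp add: upw_def corner_def mult.assoc [symmetric] L_p_0)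
next
  case (Suc t)
  have "L * upw l 0 = p t * (L * idem l)"
    by (simp add: upw_def corner_def Suc mult.assoc [symmetric] L_p)
  also have "\<dots> = p t * idem l * L" by (simp only: idem_L mult.assoc)
  also have "p t * idem l = 0"
    using p_idem_eq_0[of "fst l" "snd l" t] l Suc by (cases l) auto
  finally show ?thesis by simp
qed

lemma L_upw_Suc:
  assumes l: "l \<in> pairs"
  shows "L * upw l (Suc k) = sc (mu l (fst l + k)) * upw l k"
proof -
  have u: "upw l k = p (fst l + k) * idem l * R ^ k"
    by (simp only: upw_def corner_def mult.assoc [symmetric] R_pow_p) (simp only: mult.assoc idem_R_pow)
  have "L * upw l (Suc k) = L * R * (p (fst l + k) * idem l) * R ^ k"
    by (simp only: R_upw [symmetric] u mult.assoc)
  also have "\<dots> = sc (mu l (fst l + k)) * (p (fst l + k) * idem l) * R ^ k"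
    by (simp only: L_R_p_idem[OF l])
  finally show ?thesis by (simp only: u mult.assoc)
qed

lemma casimirs_upw:
  assumes l: "(s, r) \<in> pairs"
  shows "(casimir x + casimir xc) * upw (s, r) k = sc (cval d r + cval d s) * upw (s, r) k"
proof -
  let ?Z = "casimir x + casimir xc"
  have "?Z * R = R * ?Z" by (simp add: distrib_left distrib_right casimir_R_L)
  then have 1: "?Z * R ^ k = R ^ k * ?Z" by (rule commute_power)
  have 2: "?Z * p s = p s * ?Z" by (simp add: distrib_left distrib_right casimir_p)
  have 3: "?Z * idem (s, r) = sc (cval d r + cval d s) * idem (s, r)"
  proof (rule idem_eigen[OF l])
    fix a b assume ab: "a = r \<and> b = s \<or> a = s \<and> b = r"
    then have "a \<le> m" "b \<le> m" using pairs_le[OF l] by auto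
    then have "?Z * (e1 a * e2 b) = sc (cval d a + cval d b) * (e1 a * e2 b)"
      by (simp only: distrib_right casimir_e1_e2 sc_add)
    then show "?Z * (e1 a * e2 b) = sc (cval d r + cval d s) * (e1 a * e2 b)"
      using ab by (auto simp: add.commute)
  qed
  have "?Z * upw (s, r) k = R ^ k * (?Z * p s) * idem (s, r)"
    by (simp only: upw_def corner_def fst_conv mult.assoc [symmetric] 1)
  also have "\<dots> = R ^ k * (p s * (sc (cval d r + cval d s) * idem (s, r)))"
    by (simp only: 2 mult.assoc 3)
  finally show ?thesis
    by (simp only: upw_def corner_def fst_conv sc_left_commute[of "p s"] sc_left_commute[of "R ^ k"])
qed

lemma p_M_span:
  assumes "l \<in> pairs" "i < blk l" "j < blk l"
  shows "p k * units.M l i j \<in> span"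
  using units.range_H_M[OF assms] units.range_H_0
  by (simp add: units.M_def mult.assoc [symmetric] p_upw)

lemma A_M_span:
  assumes l: "l \<in> pairs" and ij: "i < blk l" "j < blk l"
  shows "A * units.M l i j \<in> span"
proof -
  obtain s r where sr: "l = (s, r)" by fastforce
  have up: "upw l k * dnw l j \<in> span" for k
    using units.range_H_M[OF l _ ij(2), of k] upw_blk_eq_0[OF l, of k] units.range_H_0
    by (cases "k < blk l") (auto simp: units.M_def)
  have "L * upw l i * dnw l j \<in> span"
  proof (cases i)
    case 0
    then show ?thesis using L_upw_0[OF l] units.range_H_0 by simp
  next
    case (Suc k)
    then show ?thesis
      using units.range_H_scale[OF up, of "mu l (fst l + k)" k] by (simp add: L_upw_Suc[OF l] mult.assoc)
  qed
  moreover have "R * upw l i * dnw l j \<in> span" by (simp only: R_upw up)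
  moreover have "sc c * upw l i * dnw l j \<in> span" for c
    using units.range_H_scale[OF up] by (simp only: mult.assoc)
  moreover have "A * upw l i = R * upw l i + L * upw l i
      + sc (cval d r + cval d s - (cval d (s + i) + cval d (Suc (s + i)) + of_nat d)) * upw l i"
  proof -
    have p: "p (s + i) * upw l i = upw l i" by (simp add: p_upw sr)
    have "A * upw l i = A * p (s + i) * upw l i" by (simp only: p mult.assoc)
    also have "\<dots> = R * upw l i + L * upw l i + ((casimir x + casimir xc) * upw l i
        - sc (cval d (s + i) + cval d (Suc (s + i)) + of_nat d) * upw l i)"
      by (simp only: A_p distrib_right left_diff_distrib mult.assoc p)
    finally show ?thesis
      using casimirs_upw[of s r i] l by (simp only: sr sc_diff left_diff_distrib)
  qed
  ultimately show ?thesis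
    unfolding units.M_def mult.assoc [symmetric] by (simp only: distrib_right units.range_H_add)
qed

lemma p_span: "p i \<in> span"
proof -
  have "p i * Q \<in> span"
    by (rule units.range_H_left_ideal) (rule p_M_span Q_span; assumption)+
  then show ?thesis by (simp only: p_Q)
qed

lemma A_span: "F \<in> span \<Longrightarrow> A * F \<in> span"
  by (rule units.range_H_left_ideal) (rule A_M_span; assumption)

text \<open>
  Every matrix unit is a polynomial in the compression of \<open>A\<close> and the \<open>p i\<close>.  The blocks
  \<open>p j * A * p i\<close> give \<open>R\<close>, \<open>L\<close> and the sum of the Casimir operators, then \<open>L * R\<close> gives their
  product, hence \<open>Theta\<close> and the central idempotents.
\<close>

lemma span_minimal:
  assumes add: "\<And>F G. F \<in> \<S> \<Longrightarrow> G \<in> \<S> \<Longrightarrow> F + G \<in> \<S>"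
    and mult: "\<And>F G. F \<in> \<S> \<Longrightarrow> G \<in> \<S> \<Longrightarrow> F * G \<in> \<S>"
    and scale: "\<And>c F. F \<in> \<S> \<Longrightarrow> sc c * F \<in> \<S>"
    and Q: "Q \<in> \<S>" and p: "\<And>i. i \<le> d \<Longrightarrow> p i \<in> \<S>" and AQ: "A * Q \<in> \<S>"
  shows "span \<subseteq> \<S>"
proof -
  have zero: "0 \<in> \<S>" using scale[OF Q, of 0] by simp
  have pi: "p i \<in> \<S>" for i using p p_eq_0 zero by (cases "i \<le> d") auto
  have diff: "F - G \<in> \<S>" if "F \<in> \<S>" "G \<in> \<S>" for F G
    using add[OF that(1) scale[OF that(2), of "-1"]] by (simp add: sc_minus)
  have sum: "(\<Sum>i\<in>I. F i) \<in> \<S>" if "\<And>i. i \<in> I \<Longrightarrow> F i \<in> \<S>" for I :: "'b set" and F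
    using that by (induction I rule: infinite_finite_induct) (auto intro: zero add)
  have pAp: "p j * A * p i = p j * R * p i + p j * L * p i
      + p j * (casimir x + casimir xc - sc (cval d i + cval d (Suc i) + of_nat d)) * p i" for i j
    by (simp only: mult.assoc A_p distrib_left)
  have pAp_in: "p j * A * p i \<in> \<S>" for i j
    using mult[OF pi[of j] mult[OF AQ pi[of i]]] by (simp add: mult.assoc Q_p)
  have p_p: "p i * (p j * F) = (if i = j then p i * F else 0)" for i j F
    by (simp add: mult.assoc [symmetric] p_mult)
  have pL: "p j * L * p i = (if i = Suc j then L * p i else 0)" for i j
    by (cases i) (simp_all add: mult.assoc L_p_0 L_p p_p)
  have pR: "p j * R * p i = (if j = Suc i then R * p i else 0)" for i j
    by (simp add: mult.assoc R_p p_p)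
  have pZ: "p j * (casimir x + casimir xc - sc c) * p i
      = (if i = j then (casimir x + casimir xc - sc c) * p i else 0)" for i j c
  proof -
    have "p j * (casimir x + casimir xc - sc c) = (casimir x + casimir xc - sc c) * p j"
      by (simp add: distrib_left distrib_right left_diff_distrib right_diff_distrib casimir_p sc_commute)
    then show ?thesis by (simp add: mult.assoc p_mult)
  qed
  have R: "R * p i \<in> \<S>" for i
    using pAp_in[of "Suc i" i] unfolding pAp by (simp only: pR pL pZ) simp
  have L: "L * p (Suc i) \<in> \<S>" for i
    using pAp_in[of i "Suc i"] unfolding pAp by (simp only: pR pL pZ) simp
  let ?Z = "casimir x + casimir xc"
  have Z: "?Z * p i \<in> \<S>" for i
  proof -
    let ?c = "cval d i + cval d (Suc i) + of_nat d"
    have "(?Z - sc ?c) * p i \<in> \<S>"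
      using pAp_in[of i i] unfolding pAp by (simp only: pR pL pZ) simp
    then have "(?Z - sc ?c) * p i + sc ?c * p i \<in> \<S>" by (intro add scale pi)
    then show ?thesis by (simp only: left_diff_distrib diff_add_cancel)
  qed
  have W: "casimir x * casimir xc * p i \<in> \<S>" for i
  proof -
    let ?c = "cval d (Suc i)"
    have "L * p (Suc i) * (R * p i) \<in> \<S>" by (intro mult L R)
    also have "L * p (Suc i) * (R * p i) = L * R * p i"
      by (simp only: mult.assoc R_p p_p if_True refl)
    also have "\<dots> = casimir x * casimir xc * p i - sc ?c * (?Z * p i) + sc (?c * ?c) * p i"
      unfolding L_R_p
      by (simp add: left_diff_distrib right_diff_distrib distrib_left distrib_right sc_commute[of "casimir x"] sc_mult mult.assoc)
    finally have "casimir x * casimir xc * p i - sc ?c * (?Z * p i) + sc (?c * ?c) * p i \<in> \<S>" .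
    from diff[OF add[OF this scale[OF Z[of i], of ?c]] scale[OF pi[of i], of "?c * ?c"]]
    show ?thesis by simp
  qed
  have Theta: "Theta * p i \<in> \<S>" for i
  proof -
    have "casimir x * casimir xc * p i + sc \<i> * (?Z * p i) - p i \<in> \<S>"
      by (intro add diff scale W Z pi)
    also have "casimir x * casimir xc * p i + sc \<i> * (?Z * p i) - p i = Theta * p i"
    proof -
      have "sc \<i> * (sc \<i> * p i) = - p i" by (simp add: mult.assoc [symmetric] sc_mult [symmetric] sc_minus)
      then show ?thesis
        by (simp add: Theta_def distrib_left distrib_right sc_commute[of "casimir x"] mult.assoc)
    qed
    finally show ?thesis .
  qed
  have Theta_p: "Theta * p i = p i * Theta" for i
  proof -
    have "(sc \<i> + c) * p i = p i * (sc \<i> + c)" if "c * p i = p i * c" for c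
      using that by (simp add: distrib_left distrib_right sc_commute)
    then show ?thesis unfolding Theta_def by (intro commute_mult[symmetric]) (simp_all add: casimir_p)
  qed
  have ev: "ev q Theta * p i \<in> \<S>" for q i
  proof (induction q)
    case (pCons a q)
    have "sc a * p i + Theta * p i * (ev q Theta * p i) \<in> \<S>"
      by (intro add scale pi mult Theta pCons.IH)
    also have "Theta * p i * (ev q Theta * p i) = Theta * (p i * ev q Theta) * p i"
      by (simp only: mult.assoc)
    also have "\<dots> = Theta * (ev q Theta * (p i * p i))"
      by (simp only: ev_commute[OF Theta_p, symmetric] mult.assoc)
    finally show ?case by (simp add: distrib_right mult.assoc p_mult)
  qed (simp add: zero)
  have corner: "corner l \<in> \<S>" for l
    using ev[of _ "fst l"] unfolding corner_def idem_p [symmetric] by (simp add: idem_def)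
  have up: "upw l k \<in> \<S>" for l k
  proof (induction k)
    case (Suc k)
    have "R * p (fst l + k) * upw l k \<in> \<S>" by (intro mult R Suc.IH)
    then show ?case by (simp add: mult.assoc p_upw R_upw)
  qed (simp add: upw_def corner)
  have dn: "corner l * L ^ k \<in> \<S>" for l k
  proof (induction k)
    case (Suc k)
    let ?s = "fst l"
    have "corner l * L ^ k * (L * p (Suc (?s + k))) \<in> \<S>" by (intro mult L Suc.IH)
    also have "corner l * L ^ k * (L * p (Suc (?s + k))) = corner l * (L ^ Suc k * p (?s + Suc k))"
      by (simp only: power_Suc2 mult.assoc add_Suc_right)
    also have "\<dots> = corner l * (p ?s * L ^ Suc k)" by (simp only: L_pow_p)
    also have "\<dots> = corner l * L ^ Suc k"
      by (simp only: corner_def mult.assoc [symmetric] idem_p [symmetric])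
        (simp only: mult.assoc p_p if_True refl)
    finally show ?case .
  qed (simp add: corner)
  have "units.M l i j \<in> \<S>" for l i j
    unfolding units.M_def dnw_def by (intro mult scale up dn)
  then show ?thesis unfolding units.H_def by (auto intro!: sum scale)
qed

end

section \<open>Matrices as operators\<close>

text \<open>
  The operator of a matrix indexed by \<open>I\<close>, and the matrix of an operator.
\<close>

lift_definition op_of :: "'a set \<Rightarrow> 'a smat \<Rightarrow> 'a lop" is "\<lambda>I A u. smat_apply I A u"
  by (auto simp: smat_apply_def fun_eq_iff sum.distrib sum_distrib_left algebra_simps)

definition entries :: "'a lop \<Rightarrow> 'a smat" where
  "entries F = (\<lambda>y z. app F (delta z) y)"

lemma app_op_of: "app (op_of I A) u y = (\<Sum>z\<in>I. A y z * u z)"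
  by (simp add: op_of.rep_eq smat_apply_def)

lemma op_of_mult: "finite I \<Longrightarrow> op_of I (\<lambda>y z. \<Sum>w\<in>I. A y w * B w z) = op_of I A * op_of I B"
  by (rule lop_eqI)
    (simp add: app_op_of sum_distrib_left sum_distrib_right mult.assoc, rule sum.swap)

lemma op_of_add: "op_of I (\<lambda>y z. A y z + B y z) = op_of I A + op_of I B"
  by (rule lop_eqI) (simp add: app_op_of distrib_right sum.distrib)

lemma op_of_scale: "op_of I (\<lambda>y z. c * A y z) = sc c * op_of I A"
  by (rule lop_eqI) (simp add: app_op_of sum_distrib_left mult.assoc)

lemma op_of_diagonal:
  assumes "finite I"
  shows "op_of I (\<lambda>y z. if y = z \<and> P y then 1 else 0) = diag (\<lambda>y. if y \<in> I \<and> P y then 1 else 0)"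
proof (rule lop_eqI)
  fix u :: "'a \<Rightarrow> complex" and y
  have "(\<Sum>z\<in>I. (if y = z \<and> P y then 1 else 0) * u z)
      = (\<Sum>z\<in>I. if z = y then if P y then u y else 0 else 0)"
    by (intro sum.cong) auto
  then show "app (op_of I (\<lambda>y z. if y = z \<and> P y then 1 else 0)) u y
      = app (diag (\<lambda>y. if y \<in> I \<and> P y then 1 else 0)) u y"
    using assms by (simp add: app_op_of)
qed

lemma entries_op_of:
  assumes "finite I" "A \<in> smat_carrier I"
  shows "entries (op_of I A) = A"
proof (intro ext)
  fix y z
  have "(\<Sum>w\<in>I. A y w * delta z w) = (\<Sum>w\<in>I. if w = z then A y z else 0)"
    by (intro sum.cong) (auto simp: delta_def)
  then show "entries (op_of I A) y z = A y z"
    using assms by (auto simp: entries_def app_op_of smat_carrier_def)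
qed

lemma op_of_entries:
  assumes I: "finite I" and F: "F * diag (\<lambda>y. if y \<in> I then 1 else 0) = F"
  shows "op_of I (entries F) = F"
proof (rule lop_eqI)
  fix u y
  let ?u = "app (diag (\<lambda>y. if y \<in> I then 1 else 0)) u"
  have u: "?u \<in> svec_carrier I" by (simp add: svec_carrier_def)
  have "app F u y = app F ?u y" using F by (metis times_lop.rep_eq)
  also have "\<dots> = (\<Sum>z\<in>I. ?u z * app F (delta z) y)"
    by (subst svec_delta_sum[OF I u]) (simp only: app_sum app_scale)
  also have "\<dots> = app (op_of I (entries F)) u y"
    unfolding app_op_of entries_def by (intro sum.cong) auto
  finally show "app (op_of I (entries F)) u y = app F u y" by simp
qed

lemma entries_carrier:
  assumes F: "F * diag (\<lambda>y. if y \<in> I then 1 else 0) = F"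
    and F': "diag (\<lambda>y. if y \<in> I then 1 else 0) * F = F"
  shows "entries F \<in> smat_carrier I"
  unfolding smat_carrier_def
proof (intro CollectI allI impI)
  fix y z assume nz: "entries F y z \<noteq> 0"
  let ?D = "diag (\<lambda>y. if y \<in> I then 1 else 0)"
  have "app (?D * F) (delta z) y = app F (delta z) y" by (simp only: F')
  then have "y \<in> I" using nz by (auto simp: entries_def split: if_splits)
  moreover have "z \<in> I"
  proof (rule ccontr)
    assume "z \<notin> I"
    then have "app ?D (delta z) = (\<lambda>_. 0)" by (auto simp: delta_def)
    then have "app (F * ?D) (delta z) y = 0" by simp
    then show False using nz by (simp add: F entries_def del: times_lop.rep_eq)
  qed
  ultimately show "y \<in> I \<and> z \<in> I" ..
qed

lemma entries_mult:
  assumes I: "finite I" and F: "F * diag (\<lambda>y. if y \<in> I then 1 else 0) = F"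
    and G: "G * diag (\<lambda>y. if y \<in> I then 1 else 0) = G" "diag (\<lambda>y. if y \<in> I then 1 else 0) * G = G"
  shows "entries (F * G) = (\<lambda>y z. \<Sum>w\<in>I. entries F y w * entries G w z)"
proof (intro ext)
  fix y z
  have "app F (app G (delta z)) y = app (op_of I (entries F)) (app G (delta z)) y"
    by (simp only: op_of_entries[OF I F])
  then show "entries (F * G) y z = (\<Sum>w\<in>I. entries F y w * entries G w z)"
    by (simp add: app_op_of) (simp add: entries_def)
qed


section \<open>The Terwilliger algebra as a span of matrix units\<close>

context terwilliger
begin

abbreviation "X \<equiv> johnson_X d"

lemma finite_X: "finite X"
  by (simp add: johnson_X_def finite_imp_finite_nsets)

lemma op_of_johnson_dual_E:
  assumes "i \<le> d"
  shows "op_of X (johnson_dual_E d x i) = p i"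
proof -
  have "johnson_dual_E d x i = (\<lambda>y z. if y = z \<and> (x, y) \<in> johnson_R d i then 1 else 0)"
    by (simp add: johnson_dual_E_def)
  moreover have "y \<in> X \<and> (x, y) \<in> johnson_R d i
      \<longleftrightarrow> y \<subseteq> S \<and> card (x \<inter> y) + i = d \<and> card (xc \<inter> y) = i" for y
    using assms x by (auto simp: johnson_R_def johnson_X_iff)
  ultimately show ?thesis
    by (simp add: op_of_diagonal[OF finite_X] p_def del: One_nat_def)
qed

lemma Q_A: "Q * (A * Q) = A * Q"
proof -
  have "Q * (A * p i) = A * p i" for i
  proof -
    have "(casimir x + casimir xc - sc c) * p i = p i * (casimir x + casimir xc - sc c)" for c
      by (simp add: distrib_left distrib_right left_diff_distrib right_diff_distrib casimir_p sc_commute)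
    moreover have "Q * (L * p i) = L * p i"
      by (cases i) (simp_all add: L_p_0 L_p mult.assoc [symmetric] Q_p)
    moreover have "Q * (R * p i) = R * p i" by (simp add: R_p mult.assoc [symmetric] Q_p)
    ultimately show ?thesis
      by (simp only: A_p distrib_left) (simp only: mult.assoc [symmetric] Q_p)
  qed
  moreover have "A * Q = (\<Sum>i\<le>d. A * p i)" by (simp only: Q_sum sum_distrib_left)
  ultimately show ?thesis by (simp only: sum_distrib_left)
qed

text \<open>The \<open>0/1\<close> matrix of the pairs that meet in \<open>t\<close> points, as an operator.\<close>

definition B :: "nat \<Rightarrow> nat set lop" where
  "B t = op_of X (\<lambda>y z. if y \<in> X \<and> z \<in> X \<and> card (y \<inter> z) = t then 1 else 0)"

lemma op_of_johnson_A: "op_of X (johnson_A d i) = B (d - i)"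
  by (simp add: B_def johnson_A_def johnson_R_def)

lemma A_Q: "A * Q = B (d - 1)"
proof (rule lop_eqI)
  fix u y
  show "app (A * Q) u y = app (B (d - 1)) u y"
  proof (cases "y \<in> X")
    case False
    have "app (A * Q) u y = app (Q * (A * Q)) u y" by (simp only: Q_A)
    also have "\<dots> = 0" using False by (simp add: Q_def)
    finally show ?thesis using False by (simp add: B_def app_op_of)
  next
    case True
    have y: "card (S \<inter> y) = d" "card y = d" "S \<inter> y = y"
      using True by (auto simp: johnson_X_def nsets_def Int_absorb1)
    have "app (A * Q) u y = (\<Sum>a\<in>S \<inter> y. \<Sum>b\<in>S - y. app Q u (insert b (y - {a})))"
      by (simp add: A_def app_raising_lowering y del: One_nat_def)
    also have "\<dots> = (\<Sum>z\<in>X. (if card (y \<inter> z) + 1 = d then 1 else 0) * app Q u z)"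
      using True sum_adjacent[of S y d "app Q u"] by (simp add: johnson_X_def del: One_nat_def)
    also have "\<dots> = app (B (d - 1)) u y"
      unfolding B_def app_op_of using True d_pos by (intro sum.cong) (auto simp: Q_def)
    finally show ?thesis .
  qed
qed

text \<open>
  Of the neighbours of \<open>y\<close>, \<open>c\<^sup>2\<close> meet \<open>z\<close> in \<open>c - 1\<close> points and \<open>(d - c)\<^sup>2\<close> in \<open>c + 1\<close> points; the
  others meet it in \<open>c\<close> points.
\<close>

lemma sum_neighbours:
  fixes \<phi> :: "nat \<Rightarrow> complex"
  assumes y: "y \<in> X" and z: "z \<in> X" and c: "card (y \<inter> z) = c"
  shows "(\<Sum>a\<in>S \<inter> y. \<Sum>b\<in>S - y. \<phi> (card (insert b (y - {a}) \<inter> z)))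
    = of_nat c ^ 2 * \<phi> (c - 1) + 2 * of_nat c * of_nat (d - c) * \<phi> c + of_nat (d - c) ^ 2 * \<phi> (c + 1)"
proof -
  have yz: "finite y" "y \<subseteq> S" "card y = d" "finite z" "z \<subseteq> S" "card z = d"
    using y z by (auto simp: johnson_X_def nsets_def)
  have cd: "c \<le> d" using c yz by (metis card_mono Int_lower1)
  have cards: "card (y - z) = d - c" "card (z - y) = d - c" "card (S - y - z) = c"
  proof -
    show 1: "card (y - z) = d - c" "card (z - y) = d - c"
      using c yz by (simp_all add: card_Diff_subset_Int Int_commute)
    have "card (S - y) = d" using yz by (simp add: card_Diff_subset del: One_nat_def)
    moreover have "S - y - z = (S - y) - (z - y)" by auto
    ultimately show "card (S - y - z) = c"
      using 1(2) cd yz card_Diff_subset[of "z - y" "S - y"] by auto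
  qed
  have Sy: "S - y = (z - y) \<union> (S - y - z)" "S \<inter> y = (y \<inter> z) \<union> (y - z)" using yz by auto
  have c1: "card (insert b (y - {a}) \<inter> z) = c" if "a \<in> y \<inter> z" "b \<in> z - y" for a b
  proof -
    have "insert b (y - {a}) \<inter> z = insert b (y \<inter> z - {a})" using that by auto
    moreover have "card (y \<inter> z - {a}) = c - 1" "c > 0"
      using that c yz by (auto simp: card_gt_0_iff)
    ultimately show ?thesis using that yz by simp
  qed
  have c2: "card (insert b (y - {a}) \<inter> z) = c - 1" if "a \<in> y \<inter> z" "b \<in> S - y - z" for a b
  proof -
    have "insert b (y - {a}) \<inter> z = y \<inter> z - {a}" using that by auto
    then show ?thesis using that c yz by simp
  qed
  have c3: "card (insert b (y - {a}) \<inter> z) = c + 1" if "a \<in> y - z" "b \<in> z - y" for a b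
  proof -
    have "insert b (y - {a}) \<inter> z = insert b (y \<inter> z)" using that by auto
    then show ?thesis using that c yz by simp
  qed
  have c4: "card (insert b (y - {a}) \<inter> z) = c" if "a \<in> y - z" "b \<in> S - y - z" for a b
  proof -
    have "insert b (y - {a}) \<inter> z = y \<inter> z" using that by auto
    then show ?thesis using c by simp
  qed
  have inner: "(\<Sum>b\<in>S - y. g b) = (\<Sum>b\<in>z - y. g b) + (\<Sum>b\<in>S - y - z. g b)" for g :: "nat \<Rightarrow> complex"
    using yz by (subst Sy(1), intro sum.union_disjoint) auto
  have outer: "(\<Sum>b\<in>S \<inter> y. g b) = (\<Sum>b\<in>y \<inter> z. g b) + (\<Sum>b\<in>y - z. g b)" for g :: "nat \<Rightarrow> complex"
    using yz by (subst Sy(2), intro sum.union_disjoint) auto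
  have I1: "(\<Sum>b\<in>S - y. \<phi> (card (insert b (y - {a}) \<inter> z))) = of_nat (d - c) * \<phi> c + of_nat c * \<phi> (c - 1)"
    if a: "a \<in> y \<inter> z" for a
  proof -
    have "(\<Sum>b\<in>z - y. \<phi> (card (insert b (y - {a}) \<inter> z))) = (\<Sum>b\<in>z - y. \<phi> c)"
      "(\<Sum>b\<in>S - y - z. \<phi> (card (insert b (y - {a}) \<inter> z))) = (\<Sum>b\<in>S - y - z. \<phi> (c - 1))"
      by (intro sum.cong refl; simp only: c1[OF a] c2[OF a])+
    then show ?thesis unfolding inner by (simp only: sum_constant cards)
  qed
  have I2: "(\<Sum>b\<in>S - y. \<phi> (card (insert b (y - {a}) \<inter> z))) = of_nat (d - c) * \<phi> (c + 1) + of_nat c * \<phi> c"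
    if a: "a \<in> y - z" for a
  proof -
    have "(\<Sum>b\<in>z - y. \<phi> (card (insert b (y - {a}) \<inter> z))) = (\<Sum>b\<in>z - y. \<phi> (c + 1))"
      "(\<Sum>b\<in>S - y - z. \<phi> (card (insert b (y - {a}) \<inter> z))) = (\<Sum>b\<in>S - y - z. \<phi> c)"
      by (intro sum.cong refl; simp only: c3[OF a] c4[OF a])+
    then show ?thesis unfolding inner by (simp only: sum_constant cards)
  qed
  have "(\<Sum>a\<in>S \<inter> y. \<Sum>b\<in>S - y. \<phi> (card (insert b (y - {a}) \<inter> z)))
      = (\<Sum>a\<in>y \<inter> z. of_nat (d - c) * \<phi> c + of_nat c * \<phi> (c - 1))
        + (\<Sum>a\<in>y - z. of_nat (d - c) * \<phi> (c + 1) + of_nat c * \<phi> c)"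
    unfolding outer by (intro arg_cong2[of _ _ _ _ "(+)"] sum.cong refl I1 I2)
  also have "\<dots>
      = of_nat c * (of_nat (d - c) * \<phi> c + of_nat c * \<phi> (c - 1))
        + of_nat (d - c) * (of_nat (d - c) * \<phi> (c + 1) + of_nat c * \<phi> c)"
    by (simp only: sum_constant c cards)
  finally show ?thesis by (simp add: algebra_simps power2_eq_square)
qed

text \<open>
  The three-term recurrence of the Johnson scheme.  Since \<open>(d - (t - 1))\<^sup>2 \<noteq> 0\<close> for
  \<open>1 \<le> t \<le> d\<close>, it makes every distance matrix a polynomial in the adjacency matrix.
\<close>

lemma A_B:
  "A * B t = sc (of_nat (t + 1) ^ 2) * B (t + 1) + sc (2 * of_nat t * of_nat (d - t)) * B t
    + (if t = 0 then 0 else sc (of_nat (d - (t - 1)) ^ 2) * B (t - 1))"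
proof (rule lop_eqI)
  fix u :: "nat set \<Rightarrow> complex" and y
  have QB: "Q * B t = B t"
    by (rule lop_eqI) (simp add: Q_def B_def app_op_of)
  show "app (A * B t) u y = app (sc (of_nat (t + 1) ^ 2) * B (t + 1)
      + sc (2 * of_nat t * of_nat (d - t)) * B t
      + (if t = 0 then 0 else sc (of_nat (d - (t - 1)) ^ 2) * B (t - 1))) u y" (is "_ = app ?F u y")
  proof (cases "y \<in> X")
    case False
    have "app (A * B t) u y = app (Q * (A * Q) * B t) u y" by (simp only: Q_A mult.assoc QB)
    also have "\<dots> = 0" using False by (simp add: Q_def)
    also have "0 = app ?F u y" using False by (simp add: B_def app_op_of)
    finally show ?thesis .
  next
    case True
    let ?ind = "\<lambda>k. if k = t then 1 else 0 :: complex"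
    have yS: "S \<inter> y = y" "finite y" "card y = d" "y \<subseteq> S"
      using True by (auto simp: johnson_X_def nsets_def)
    have mem: "insert b (y - {a}) \<in> X" if "a \<in> S \<inter> y" "b \<in> S - y" for a b
    proof -
      have "card (insert b (y - {a})) = d"
        using that yS by (metis DiffD1 DiffD2 IntD2 card.remove card_insert_disjoint finite_Diff)
      then show ?thesis using that yS by (auto simp: johnson_X_def nsets_def)
    qed
    have "app (A * B t) u y = (\<Sum>a\<in>S \<inter> y. \<Sum>b\<in>S - y. app (B t) u (insert b (y - {a})))"
      using yS by (simp add: A_def app_raising_lowering del: One_nat_def)
    also have "\<dots> = (\<Sum>a\<in>S \<inter> y. \<Sum>b\<in>S - y. \<Sum>z\<in>X. ?ind (card (insert b (y - {a}) \<inter> z)) * u z)"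
      unfolding B_def app_op_of by (intro sum.cong refl) (simp only: mem simp_thms)
    also have "\<dots> = (\<Sum>z\<in>X. \<Sum>a\<in>S \<inter> y. \<Sum>b\<in>S - y. ?ind (card (insert b (y - {a}) \<inter> z)) * u z)"
      by (subst sum.swap[of _ X]) (intro sum.cong refl sum.swap)
    also have "\<dots> = (\<Sum>z\<in>X. (\<Sum>a\<in>S \<inter> y. \<Sum>b\<in>S - y. ?ind (card (insert b (y - {a}) \<inter> z))) * u z)"
      by (simp only: sum_distrib_right)
    also have "\<dots> = app ?F u y"
    proof -
      have F: "app ?F u y = (\<Sum>z\<in>X. (of_nat (t + 1) ^ 2 * (if card (y \<inter> z) = t + 1 then 1 else 0)
          + 2 * of_nat t * of_nat (d - t) * (if card (y \<inter> z) = t then 1 else 0)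
          + (if t = 0 then 0 else of_nat (d - (t - 1)) ^ 2 * (if card (y \<inter> z) = t - 1 then 1 else 0))) * u z)"
        using True by (simp add: B_def app_op_of distrib_right sum.distrib sum_distrib_left mult.assoc)
      have coeff: "of_nat c ^ 2 * ?ind (c - 1) + 2 * of_nat c * of_nat (d - c) * ?ind c
            + of_nat (d - c) ^ 2 * ?ind (c + 1)
          = of_nat (t + 1) ^ 2 * (if c = t + 1 then 1 else 0)
            + 2 * of_nat t * of_nat (d - t) * (if c = t then 1 else 0)
            + (if t = 0 then 0 else of_nat (d - (t - 1)) ^ 2 * (if c = t - 1 then 1 else 0))" for c
        \<comment> \<open>truncation in \<open>c - 1\<close> at \<open>c = 0\<close> is harmless because of the factor \<open>c\<^sup>2\<close>\<close>
        by (cases c; cases t) auto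
      show ?thesis
        unfolding F using sum_neighbours[OF True _ refl, of _ ?ind]
        by (intro sum.cong refl) (simp only: coeff)
    qed
    finally show ?thesis .
  qed
qed

lemma B_span: "k \<le> d \<Longrightarrow> B (d - k) \<in> span"
proof (induction k rule: less_induct)
  case (less k)
  have card_le: "card (y \<inter> z) \<le> d" if "y \<in> X" for y z
    using that by (auto simp: johnson_X_def nsets_def intro: card_mono[THEN order.trans])
  show ?case
  proof (cases k)
    case 0
    have "card (y \<inter> z) = d \<longleftrightarrow> y = z" if "y \<in> X" "z \<in> X" for y z
      using that by (auto simp: johnson_X_def nsets_def)
        (metis Int_lower1 Int_lower2 card_subset_eq)+
    then have "B d = op_of X (\<lambda>y z. if y = z \<and> y \<in> X then 1 else 0)"
      unfolding B_def by (intro arg_cong[of _ _ "op_of X"] ext) (auto simp: johnson_X_def nsets_def)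
    then have "B d = Q" by (simp add: op_of_diagonal[OF finite_X] Q_def)
    then show ?thesis using 0 Q_span by simp
  next
    case (Suc j)
    define t where "t = d - j"
    have t: "t \<noteq> 0" "t - 1 = d - k" "d - (t - 1) = k" "t \<le> d" using Suc less.prems by (auto simp: t_def)
    have Bt: "B t \<in> span" unfolding t_def using less.IH[of j] Suc less.prems by simp
    have Bt1: "B (t + 1) \<in> span"
    proof (cases j)
      case 0
      have "\<not> (y \<in> X \<and> z \<in> X \<and> card (y \<inter> z) = t + 1)" for y z
        using card_le[of y z] 0 by (auto simp: t_def)
      then have "B (t + 1) = 0"
        unfolding B_def by (intro lop_eqI) (simp only: app_op_of if_False mult_zero_left sum.neutral_const zero_lop.rep_eq)
      then show ?thesis by (simp add: units.range_H_0)
    next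
      case (Suc i)
      then have "t + 1 = d - i" using t by (auto simp: t_def)
      then show ?thesis using less.IH[of i] \<open>k = Suc j\<close> Suc less.prems by simp
    qed
    have "A * B t = sc (of_nat (t + 1) ^ 2) * B (t + 1) + sc (2 * of_nat t * of_nat (d - t)) * B t
        + sc (of_nat (d - (t - 1)) ^ 2) * B (t - 1)"
      using A_B[of t] t(1) by (simp only: if_False)
    then have AB: "A * B t = sc (of_nat (t + 1) ^ 2) * B (t + 1) + sc (2 * of_nat t * of_nat (d - t)) * B t
        + sc (of_nat k ^ 2) * B (d - k)"
      using t(2,3) by (simp only:)
    have "sc (of_nat k ^ 2) * B (d - k) = A * B t + sc (- (of_nat (t + 1) ^ 2)) * B (t + 1)
        + sc (- (2 * of_nat t * of_nat (d - t))) * B t"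
      by (simp only: AB sc_minus mult_minus_left) simp
    also have "\<dots> \<in> span" by (intro units.range_H_add units.range_H_scale A_span Bt Bt1)
    finally have "sc (1 / of_nat k ^ 2) * (sc (of_nat k ^ 2) * B (d - k)) \<in> span"
      by (rule units.range_H_scale)
    moreover have "sc (1 / of_nat k ^ 2) * (sc (of_nat k ^ 2) * B (d - k)) = B (d - k)"
    proof -
      have "of_nat k \<noteq> (0 :: complex)" using Suc by (simp only: of_nat_eq_0_iff)
      then show ?thesis by (simp add: mult.assoc [symmetric] sc_mult [symmetric])
    qed
    ultimately show ?thesis by simp
  qed
qed

lemma span_corner: "F \<in> span \<Longrightarrow> F * Q = F" "F \<in> span \<Longrightarrow> Q * F = F"
proof -
  have "span \<subseteq> {F. F * Q = F \<and> Q * F = F}"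
  proof (rule span_minimal)
    fix F G assume "F \<in> {F. F * Q = F \<and> Q * F = F}" "G \<in> {F. F * Q = F \<and> Q * F = F}"
    then have "F * Q = F" "Q * F = F" "G * Q = G" "Q * G = G" by auto
    moreover from this have "F * G * Q = F * G" "Q * (F * G) = F * G"
      by (simp only: mult.assoc, simp only: mult.assoc [symmetric])
    ultimately show "F + G \<in> {F. F * Q = F \<and> Q * F = F}" "F * G \<in> {F. F * Q = F \<and> Q * F = F}"
      by (simp_all add: distrib_left distrib_right)
  next
    fix c F assume "F \<in> {F. F * Q = F \<and> Q * F = F}"
    then have "F * Q = F" "Q * F = F" by auto
    then show "sc c * F \<in> {F. F * Q = F \<and> Q * F = F}"
      by (simp add: mult.assoc sc_left_commute[of Q])
  next
    show "A * Q \<in> {F. F * Q = F \<and> Q * F = F}"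
      by (simp add: mult.assoc Q_Q Q_A)
  qed (simp_all add: Q_Q Q_p p_Q)
  then show "F \<in> span \<Longrightarrow> F * Q = F" "F \<in> span \<Longrightarrow> Q * F = F" by auto
qed

end

section \<open>The isomorphism\<close>

text \<open>
  It suffices to give the isomorphism in the opposite direction.
\<close>

lemma algebra_isomorphicI:
  assumes bij: "bij_betw h (carrier N) (carrier M)"
    and one: "\<one>\<^bsub>N\<^esub> \<in> carrier N" "h \<one>\<^bsub>N\<^esub> = \<one>\<^bsub>M\<^esub>"
    and add: "\<And>a b. a \<in> carrier N \<Longrightarrow> b \<in> carrier N \<Longrightarrow> a \<oplus>\<^bsub>N\<^esub> b \<in> carrier N"
      "\<And>a b. a \<in> carrier N \<Longrightarrow> b \<in> carrier N \<Longrightarrow> h (a \<oplus>\<^bsub>N\<^esub> b) = h a \<oplus>\<^bsub>M\<^esub> h b"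
    and mult: "\<And>a b. a \<in> carrier N \<Longrightarrow> b \<in> carrier N \<Longrightarrow> a \<otimes>\<^bsub>N\<^esub> b \<in> carrier N"
      "\<And>a b. a \<in> carrier N \<Longrightarrow> b \<in> carrier N \<Longrightarrow> h (a \<otimes>\<^bsub>N\<^esub> b) = h a \<otimes>\<^bsub>M\<^esub> h b"
    and smult: "\<And>c a. a \<in> carrier N \<Longrightarrow> c \<odot>\<^bsub>N\<^esub> a \<in> carrier N"
      "\<And>c a. a \<in> carrier N \<Longrightarrow> h (c \<odot>\<^bsub>N\<^esub> a) = c \<odot>\<^bsub>M\<^esub> h a"
  shows "M \<simeq>\<^sub>a\<^sub>l\<^sub>g N"
  unfolding algebra_isomorphic_def
proof (intro bexI allI ballI)
  define g where "g = inv_into (carrier N) h"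
  have g: "bij_betw g (carrier M) (carrier N)" unfolding g_def by (rule bij_betw_inv_into[OF bij])
  have gN: "g a \<in> carrier N" if "a \<in> carrier M" for a using g that by (rule bij_betwE[THEN bspec])
  have hg: "h (g a) = a" if "a \<in> carrier M" for a
    unfolding g_def using bij that by (rule bij_betw_inv_into_right)
  have gh: "g (h a) = a" if "a \<in> carrier N" for a
    unfolding g_def using bij that by (rule bij_betw_inv_into_left)
  show "inv_into (carrier N) h (c \<odot>\<^bsub>M\<^esub> a) = c \<odot>\<^bsub>N\<^esub> inv_into (carrier N) h a"
    if "a \<in> carrier M" for c a
    using gh[OF smult(1)[OF gN[OF that]]] smult(2)[OF gN[OF that]] hg[OF that]
    unfolding g_def by simp
  have "g \<in> Ring.ring_hom M N"
  proof (rule ring_hom_memI)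
    fix a b assume ab: "a \<in> carrier M" "b \<in> carrier M"
    note gab = gN[OF ab(1)] gN[OF ab(2)]
    show "g (a \<otimes>\<^bsub>M\<^esub> b) = g a \<otimes>\<^bsub>N\<^esub> g b"
      using gh[OF mult(1)[OF gab]] mult(2)[OF gab] hg ab by simp
    show "g (a \<oplus>\<^bsub>M\<^esub> b) = g a \<oplus>\<^bsub>N\<^esub> g b"
      using gh[OF add(1)[OF gab]] add(2)[OF gab] hg ab by simp
  next
    show "g \<one>\<^bsub>M\<^esub> = \<one>\<^bsub>N\<^esub>" using gh[OF one(1)] one(2) by simp
  qed (rule gN)
  then show "inv_into (carrier N) h \<in> ring_iso M N"
    using g by (simp add: ring_iso_def g_def)
qed

lemma direct_sum_cong:
  assumes "\<And>i. i \<in> I \<Longrightarrow> M i = N i"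
  shows "direct_sum I M = direct_sum I N"
  using assms by (simp add: direct_sum_def cong: PiE_cong restrict_cong)

context terwilliger
begin

lemma carrier_terwilliger: "carrier (terwilliger_algebra d x) = entries ` span"
proof
  let ?M = "Mat_algebra X"
  let ?gens = "johnson_A d ` {0..d} \<union> johnson_dual_E d x ` {0..d}"
  have T: "carrier (terwilliger_algebra d x) = subalgebra_of ?M hull ?gens"
    by (simp add: terwilliger_algebra_def generated_subalgebra_def)
  have gens: "?gens \<subseteq> smat_carrier X"
    by (auto simp: johnson_A_def johnson_dual_E_def johnson_R_def smat_carrier_def split: if_splits)
  have Q: "diag (\<lambda>y. if y \<in> X then 1 else 0) = Q" by (simp add: Q_def)
  have op_one: "op_of X (\<lambda>y z. if y \<in> X \<and> y = z then 1 else 0) = Q"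
    using op_of_diagonal[OF finite_X, of "\<lambda>y. y \<in> X"] by (simp add: Q_def conj_commute)
  have op_entries: "op_of X (entries F) = F" "entries F \<in> smat_carrier X" if "F \<in> span" for F
    using op_of_entries[OF finite_X, of F] entries_carrier[of F X] span_corner[OF that]
    unfolding Q by blast+
  let ?B = "{a \<in> smat_carrier X. op_of X a \<in> span}"
  have "subalgebra_of ?M ?B"
    unfolding subalgebra_of_def
  proof (intro conjI ballI allI)
    show "?B \<subseteq> carrier ?M" by (auto simp: Mat_algebra_def)
    show "\<one>\<^bsub>?M\<^esub> \<in> ?B"
      by (simp add: Mat_algebra_def op_one Q_span) (simp add: smat_carrier_def)
  next
    fix a b assume ab: "a \<in> ?B" "b \<in> ?B"
    have "(\<lambda>y z. a y z + b y z) \<in> smat_carrier X"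
      unfolding smat_carrier_def
    proof (intro CollectI allI impI)
      fix y z assume "a y z + b y z \<noteq> 0"
      then have "a y z \<noteq> 0 \<or> b y z \<noteq> 0" by auto
      then show "y \<in> X \<and> z \<in> X" using ab by (auto simp: smat_carrier_def)
    qed
    then show "a \<oplus>\<^bsub>?M\<^esub> b \<in> ?B"
      using ab by (simp add: Mat_algebra_def op_of_add units.range_H_add)
    have "(\<lambda>y z. \<Sum>w\<in>X. a y w * b w z) \<in> smat_carrier X"
      using ab by (auto simp: smat_carrier_def elim!: sum.not_neutral_contains_not_neutral)
    then show "a \<otimes>\<^bsub>?M\<^esub> b \<in> ?B"
      using ab by (simp add: Mat_algebra_def op_of_mult[OF finite_X] units.range_H_mult)
  next
    fix c a assume a: "a \<in> ?B"
    have "(\<lambda>y z. c * a y z) \<in> smat_carrier X"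
      using a by (auto simp: smat_carrier_def)
    then show "c \<odot>\<^bsub>?M\<^esub> a \<in> ?B"
      using a by (simp add: Mat_algebra_def op_of_scale units.range_H_scale)
  qed
  moreover have "?gens \<subseteq> ?B"
    using gens by (auto simp: op_of_johnson_A op_of_johnson_dual_E B_span p_span)
  ultimately have "subalgebra_of ?M hull ?gens \<subseteq> ?B"
    by (intro hull_minimal)
  then show "carrier (terwilliger_algebra d x) \<subseteq> entries ` span"
    unfolding T using entries_op_of[OF finite_X] by (force simp: image_iff)
  show "entries ` span \<subseteq> carrier (terwilliger_algebra d x)"
    unfolding T hull_def
  proof (intro subsetI InterI, clarify)
    fix f C assume C: "subalgebra_of ?M C" "?gens \<subseteq> C"
    have C': "C \<subseteq> smat_carrier X" "(\<lambda>y z. if y \<in> X \<and> y = z then 1 else 0) \<in> C"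
      "\<And>a b. a \<in> C \<Longrightarrow> b \<in> C \<Longrightarrow> (\<lambda>y z. a y z + b y z) \<in> C"
      "\<And>a b. a \<in> C \<Longrightarrow> b \<in> C \<Longrightarrow> (\<lambda>y z. \<Sum>w\<in>X. a y w * b w z) \<in> C"
      "\<And>c a. a \<in> C \<Longrightarrow> (\<lambda>y z. c * a y z) \<in> C"
      using C(1) by (auto simp: subalgebra_of_def Mat_algebra_def)
    have "span \<subseteq> op_of X ` C"
    proof (rule span_minimal)
      fix F G assume "F \<in> op_of X ` C" "G \<in> op_of X ` C"
      then show "F + G \<in> op_of X ` C" "F * G \<in> op_of X ` C"
        using C'(3,4) by (auto simp flip: op_of_add op_of_mult[OF finite_X])
    next
      fix c F assume "F \<in> op_of X ` C"
      then show "sc c * F \<in> op_of X ` C" using C'(5) by (auto simp flip: op_of_scale)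
    next
      show "Q \<in> op_of X ` C" using C'(2) op_one by force
      show "p i \<in> op_of X ` C" if "i \<le> d" for i
        using C(2) op_of_johnson_dual_E[OF that] that by force
      have "A * Q = op_of X (johnson_A d 1)" by (simp only: A_Q op_of_johnson_A)
      moreover have "johnson_A d 1 \<in> C" using C(2) d_pos by force
      ultimately show "A * Q \<in> op_of X ` C" by blast
    qed
    then obtain a where a: "a \<in> C" "units.H f = op_of X a" by blast
    then show "entries (units.H f) \<in> C" using entries_op_of[OF finite_X] C'(1) by auto
  qed
qed

abbreviation block_algebra :: "nat \<Rightarrow> nat \<Rightarrow> (complex, complex mat) module" where
  "block_algebra s r \<equiv> module_mat TYPE(complex) (blk (s, r)) (blk (s, r))"

text \<open>
  The direct sum of matrix algebras with the block sizes computed, and the coordinates of its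
  elements as used by \<open>units.H\<close>.
\<close>

definition blocks :: "(complex, nat \<Rightarrow> nat \<Rightarrow> complex mat) module" where
  "blocks = direct_sum {0..m} (\<lambda>s. direct_sum {0..s} (block_algebra s))"

definition coords :: "(nat \<Rightarrow> nat \<Rightarrow> complex mat) \<Rightarrow> nat \<times> nat \<Rightarrow> nat \<Rightarrow> nat \<Rightarrow> complex" where
  "coords F l i j = F (fst l) (snd l) $$ (i, j)"

lemma carrier_blocks:
  "F \<in> carrier blocks \<longleftrightarrow> F \<in> (\<Pi>\<^sub>E s\<in>{0..m}. \<Pi>\<^sub>E r\<in>{0..s}. carrier_mat (blk (s, r)) (blk (s, r)))"
  by (simp add: blocks_def direct_sum_def module_mat_simps)

lemma blocks_dim:
  "F \<in> carrier blocks \<Longrightarrow> s \<le> m \<Longrightarrow> r \<le> s \<Longrightarrow> F s r \<in> carrier_mat (blk (s, r)) (blk (s, r))"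
  unfolding carrier_blocks by (auto simp: PiE_def Pi_def)

lemma entries_inj: "inj_on entries span"
proof (rule inj_onI)
  fix F G assume FG: "F \<in> span" "G \<in> span" "entries F = entries G"
  have "op_of X (entries F) = F" if "F \<in> span" for F
    using op_of_entries[OF finite_X, of F] span_corner(1)[OF that] by (simp add: Q_def)
  then show "F = G" using FG by metis
qed

lemma bij_blocks: "bij_betw (\<lambda>F. entries (units.H (coords F))) (carrier blocks) (entries ` span)"
proof (rule bij_betw_imageI)
  show "inj_on (\<lambda>F. entries (units.H (coords F))) (carrier blocks)"
  proof (rule inj_onI)
    fix F G assume F: "F \<in> carrier blocks" and G: "G \<in> carrier blocks"
      and "entries (units.H (coords F)) = entries (units.H (coords G))"
    then have H: "units.H (coords F) = units.H (coords G)"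
      using inj_onD[OF entries_inj] by blast
    have *: "F s r = G s r" if "s \<le> m" "r \<le> s" for s r
    proof (rule eq_matI)
      have l: "(s, r) \<in> pairs" using that by (simp add: pairs_def)
      show "F s r $$ (i, j) = G s r $$ (i, j)" if "i < dim_row (G s r)" "j < dim_col (G s r)" for i j
        using units.H_inject[OF H l, of i j] that blocks_dim[OF G \<open>s \<le> m\<close> \<open>r \<le> s\<close>]
        by (auto simp: coords_def)
    qed (use blocks_dim[OF F that] blocks_dim[OF G that] in auto)
    show "F = G"
    proof (rule PiE_ext[of _ _ _ G])
      fix s assume "s \<in> {0..m}"
      then have s: "s \<le> m" by simp
      show "F s = G s"
      proof (rule PiE_ext)
        show "F s \<in> (\<Pi>\<^sub>E r\<in>{0..s}. carrier_mat (blk (s, r)) (blk (s, r)))"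
          "G s \<in> (\<Pi>\<^sub>E r\<in>{0..s}. carrier_mat (blk (s, r)) (blk (s, r)))"
          using F G s unfolding carrier_blocks by (auto dest: PiE_mem)
      qed (use * s in auto)
    qed (use F G in \<open>simp_all only: carrier_blocks\<close>)
  qed
  have "\<exists>F\<in>carrier blocks. units.H f = units.H (coords F)" for f
  proof
    define F where "F = (\<lambda>s\<in>{0..m}. \<lambda>r\<in>{0..s}. mat (blk (s, r)) (blk (s, r)) (\<lambda>(i, j). f (s, r) i j))"
    show "F \<in> carrier blocks" by (auto simp: carrier_blocks F_def)
    show "units.H f = units.H (coords F)"
      by (rule units.H_cong) (auto simp: coords_def F_def pairs_def)
  qed
  then show "(\<lambda>F. entries (units.H (coords F))) ` carrier blocks = entries ` span"
    by (auto simp: image_iff) metis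
qed

lemma H_coords_one: "units.H (coords \<one>\<^bsub>blocks\<^esub>) = Q"
proof -
  have "units.H (coords \<one>\<^bsub>blocks\<^esub>) = units.H (\<lambda>l i j. if i = j then 1 else 0)"
    by (rule units.H_cong)
      (auto simp: coords_def blocks_def direct_sum_def module_mat_simps pairs_def)
  also have "\<dots> = units.H (\<lambda>l i j. if i = j then 1 else 0) * Q"
    by (rule span_corner(1)[symmetric]) blast
  also have "\<dots> = Q"
  proof -
    obtain f where f: "Q = units.H f" using Q_span by blast
    have "units.H (\<lambda>l i j. if i = j then 1 else 0) * units.H f = units.H f"
      unfolding units.H_mult by (rule units.H_cong) (simp add: if_distrib if_distribR cong: if_cong)
    then show ?thesis by (simp only: f)
  qed
  finally show ?thesis .
qed

theorem terwilliger_algebra_isomorphic_blocks: "terwilliger_algebra d x \<simeq>\<^sub>a\<^sub>l\<^sub>g blocks"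
proof (rule algebra_isomorphicI[where h = "\<lambda>F. entries (units.H (coords F))"])
  let ?T = "terwilliger_algebra d x"
  have T: "\<one>\<^bsub>?T\<^esub> = (\<lambda>y z. if y \<in> X \<and> y = z then 1 else 0)"
    "a \<oplus>\<^bsub>?T\<^esub> b = (\<lambda>y z. a y z + b y z)"
    "a \<otimes>\<^bsub>?T\<^esub> b = (\<lambda>y z. \<Sum>w\<in>X. a y w * b w z)"
    "c \<odot>\<^bsub>?T\<^esub> a = (\<lambda>y z. c * a y z)" for a b c
    by (simp_all add: terwilliger_algebra_def generated_subalgebra_def Mat_algebra_def)
  show "bij_betw (\<lambda>F. entries (units.H (coords F))) (carrier blocks) (carrier ?T)"
    unfolding carrier_terwilliger by (rule bij_blocks)
  show "\<one>\<^bsub>blocks\<^esub> \<in> carrier blocks"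
    by (auto simp: carrier_blocks) (auto simp: blocks_def direct_sum_def module_mat_simps)
  show "entries (units.H (coords \<one>\<^bsub>blocks\<^esub>)) = \<one>\<^bsub>?T\<^esub>"
    unfolding H_coords_one T by (auto simp: entries_def Q_def delta_def fun_eq_iff)
  fix F assume F: "F \<in> carrier blocks"
  note dF = blocks_dim[OF F]
  show "c \<odot>\<^bsub>blocks\<^esub> F \<in> carrier blocks" for c
    unfolding carrier_blocks
    by (auto simp: blocks_def direct_sum_def module_mat_simps dF)
  show "entries (units.H (coords (c \<odot>\<^bsub>blocks\<^esub> F))) = c \<odot>\<^bsub>?T\<^esub> entries (units.H (coords F))" for c
  proof -
    have "units.H (coords (c \<odot>\<^bsub>blocks\<^esub> F)) = sc c * units.H (coords F)"
      unfolding units.H_scale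
      using dF by (intro units.H_cong) (fastforce simp: coords_def blocks_def direct_sum_def module_mat_simps pairs_def)
    then show ?thesis unfolding T by (simp add: entries_def)
  qed
  fix G assume G: "G \<in> carrier blocks"
  note dG = blocks_dim[OF G]
  show "F \<oplus>\<^bsub>blocks\<^esub> G \<in> carrier blocks"
    unfolding carrier_blocks
    by (auto simp: blocks_def direct_sum_def module_mat_simps dF dG)
  show "entries (units.H (coords (F \<oplus>\<^bsub>blocks\<^esub> G)))
      = entries (units.H (coords F)) \<oplus>\<^bsub>?T\<^esub> entries (units.H (coords G))"
  proof -
    have "units.H (coords (F \<oplus>\<^bsub>blocks\<^esub> G)) = units.H (coords F) + units.H (coords G)"
      unfolding units.H_add
      using dF dG by (intro units.H_cong) (fastforce simp: coords_def blocks_def direct_sum_def module_mat_simps pairs_def)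
    then show ?thesis unfolding T by (simp add: entries_def)
  qed
  show "F \<otimes>\<^bsub>blocks\<^esub> G \<in> carrier blocks"
    unfolding carrier_blocks
    by (auto simp: blocks_def direct_sum_def module_mat_simps intro!: mult_carrier_mat dF dG)
  show "entries (units.H (coords (F \<otimes>\<^bsub>blocks\<^esub> G)))
      = entries (units.H (coords F)) \<otimes>\<^bsub>?T\<^esub> entries (units.H (coords G))"
  proof -
    have "units.H (coords (F \<otimes>\<^bsub>blocks\<^esub> G)) = units.H (coords F) * units.H (coords G)"
      unfolding units.H_mult
    proof (rule units.H_cong)
      fix l i j assume "l \<in> pairs" "i < blk l" "j < blk l"
      moreover obtain s r where l: "l = (s, r)" by fastforce
      ultimately have *: "s \<le> m" "r \<le> s" "i < blk (s, r)" "j < blk (s, r)" by (auto simp: pairs_def)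
      have "coords (F \<otimes>\<^bsub>blocks\<^esub> G) l i j = (F s r * G s r) $$ (i, j)"
        using * by (simp add: l coords_def blocks_def direct_sum_def module_mat_simps)
      also have "\<dots> = (\<Sum>k<blk l. coords F l i k * coords G l k j)"
        using * dF[OF *(1,2)] dG[OF *(1,2)]
        by (auto simp: l coords_def scalar_prod_def lessThan_atLeast0 intro!: sum.cong)
      finally show "coords (F \<otimes>\<^bsub>blocks\<^esub> G) l i j = (\<Sum>k<blk l. coords F l i k * coords G l k j)" .
    qed
    moreover have "entries (units.H (coords F) * units.H (coords G))
        = (\<lambda>y z. \<Sum>w\<in>X. entries (units.H (coords F)) y w * entries (units.H (coords G)) w z)"
      using span_corner[of "units.H (coords F)"] span_corner[of "units.H (coords G)"]
      by (intro entries_mult[OF finite_X]) (simp_all add: Q_def)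
    ultimately show ?thesis unfolding T by simp
  qed
qed

end

theorem theorem5p4:
  fixes d :: nat and x :: "nat set"
  assumes "d > 0" and "x \<in> johnson_X d"
  shows "terwilliger_algebra d x \<simeq>\<^sub>a\<^sub>l\<^sub>g
    direct_sum {0..d div 2} (\<lambda>s. direct_sum {0..s} (\<lambda>r.
      module_mat TYPE(complex) (nat (d_num d r s + 1)) (nat (d_num d r s + 1))))"
proof -
  interpret terwilliger d x
    using assms by unfold_locales
  have "direct_sum {0..d div 2} (\<lambda>s. direct_sum {0..s} (\<lambda>r.
      module_mat TYPE(complex) (nat (d_num d r s + 1)) (nat (d_num d r s + 1)))) = blocks"
    unfolding blocks_def
  proof (intro direct_sum_cong)
    fix s r assume "s \<in> {0..d div 2}" "r \<in> {0..s}"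
    then have "nat (d_num d r s + 1) = blk (s, r)"
      by (auto simp: d_num_eq blk_def)
    then show "module_mat TYPE(complex) (nat (d_num d r s + 1)) (nat (d_num d r s + 1))
        = block_algebra s r" by simp
  qed
  then show ?thesis using terwilliger_algebra_isomorphic_blocks by simp
qed

end
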